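(* Let $M$ be an object of $\mathcal O^q_{\mathrm{red,im}}$ and let $\lambda_i\in\mathfrak h^*_{red}$ ($i\in I$) be such that $M\cong\bigoplus_{i\in I}\bar M_q(\lambda_i)$; identify $M$ with this direct sum. For each $i\in I$ let $$\mathcal L(\lambda_i)=\sum_{k\ge0,\ n_1\ge\cdots\ge n_k}\mathbb A_0\,x^-_{n_1}\cdots x^-_{n_k}v_{\lambda_i}\subset\bar M_q(\lambda_i),$$ $$\mathcal B(\lambda_i)=\left\{\tilde x^-_{n_1}\cdots\tilde x^-_{n_k}v_{\lambda_i}+q^{1/2}\mathcal L(\lambda_i)\ :\ k\ge0,\ n_1\ge\cdots\ge n_k\right\}\subset\mathcal L(\lambda_i)/q^{1/2}\mathcal L(\lambda_i).$$ Put $\mathcal L=\bigoplus_{i\in I}\mathcal L(\lambda_i)$ and $\mathcal B=\bigsqcup_{i\in I}\mathcal B(\lambda_i)\subset\mathcal L/q^{1/2}\mathcal L=\bigoplus_{i\in I}\mathcal L(\lambda_i)/q^{1/2}\mathcal L(\lambda_i)$. Then the pair $(\mathcal L,\mathcal B)$ is an imaginary crystal basis of $M$.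
   Context: Let $\mathbb F$ be a field of characteristic zero, $q$ an indeterminate, $[n]=\frac{q^n-q^{-n}}{q-q^{-1}}$. Let $\mathbb A_0\subset\mathbb F(q^{1/2})$ be the ring of rational functions in $q^{1/2}$ over $\mathbb F$ regular at $q^{1/2}=0$; $\mathbb F=\mathbb A_0/q^{1/2}\mathbb A_0$. **The algebra.** $U_q=U_q(\widehat{\mathfrak{sl}(2)})$ (Drinfeld realization) is the associative unital $\mathbb F(q^{1/2})$-algebra generated by $x^{\pm}_k$ ($k\in\mathbb Z$), $h_l$ ($l\in\mathbb Z\setminus\{0\}$), $K^{\pm1}$, $D^{\pm1}$, $\gamma^{\pm1/2}$ with relations: $DD^{-1}=D^{-1}D=KK^{-1}=K^{-1}K=1$, $\gamma^{1/2}\gamma^{-1/2}=1$, $\gamma^{\pm1/2}$ central, $[h_k,h_l]=\delta_{k+l,0}\frac{[2k]}{k}\frac{\gamma^k-\gamma^{-k}}{q-q^{-1}}$, $[h_k,K]=0=[D,K]$, $Dh_kD^{-1}=q^kh_k$, $Dx_k^\pm D^{-1}=q^kx_k^\pm$, $Kx_k^\pm K^{-1}=q^{\pm2}x_k^\pm$, $[h_k,x_l^\pm]=\pm\frac{[2k]}{k}\gamma^{\mp|k|/2}x^\pm_{k+l}$, $x^\pm_{k+1}x^\pm_l-q^{\pm2}x^\pm_lx^\pm_{k+1}=q^{\pm2}x^\pm_kx^\pm_{l+1}-x^\pm_{l+1}x^\pm_k$, and $[x^+_k,x^-_l]=\frac{1}{q-q^{-1}}\left(\gamma^{\frac{k-l}{2}}\psi(k+l)-\gamma^{\frac{l-k}{2}}\phi(k+l)\right)$,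 where $\sum_{k\ge0}\psi(k)z^{-k}=K\exp\left((q-q^{-1})\sum_{k\ge1}h_kz^{-k}\right)$, $\sum_{k\ge0}\phi(-k)z^k=K^{-1}\exp\left(-(q-q^{-1})\sum_{k\ge1}h_{-k}z^k\right)$, and $\psi(k)=0=\phi(-k)$ for $k<0$. **Weights.** $P=\mathbb Z\Lambda_0\oplus\mathbb Z\Lambda_1\oplus\mathbb Z\delta$ is the weight lattice of $\widehat{\mathfrak{sl}(2)}$; with $h=h(0)$ the simple coroot $h_1$, $c=h_0+h_1$ the central element and $d$ the degree derivation, $\Lambda_0(h)=0$, $\Lambda_1(h)=1$, $\Lambda_i(c)=1$, $\Lambda_i(d)=0$, $\delta(h)=\delta(c)=0$, $\delta(d)=1$. Let $P_0=\{\mu\in P:\mu(c)=0\}$ and $\mathfrak h^*_{red}=\{\lambda\in P_0: \lambda(h)\ne0\}$. For a $U_q$-module $M$ and $\mu\in P_0$, $M_\mu=\{m\in M: Km=q^{\mu(h)}m,\ Dm=q^{\mu(d)}m\}$. **Reduced quantized imaginary Verma modules.** For $\lambda\in\mathfrak h^*_{red}$, $\bar M_q(\lambda)=U_q/J^q(\lambda)$, where $J^q(\lambda)$ is the left ideal generated by $x^+_k$ ($k\in\mathbb Z$), $h_l$ ($l\ne0$), $K^{\pm1}-q^{\pm\lambda(h)}$, $\gamma^{\pm1/2}-1$, $D^{\pm1}-q^{\pm\lambda(d)}$; $v_\lambda$ denotes the image of $1$. It has $\mathbb F(q^{1/2})$-basis $x^-_{n_1}\cdots x^-_{n_k}v_\lambda$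 with $k\ge0$, $n_1\ge\cdots\ge n_k$, and it is a simple $U_q$-module. **The category.** $\mathcal O^q_{\mathrm{red,im}}$ is the category whose objects are the $U_q$-modules isomorphic to direct sums $\bigoplus_{i\in I}\bar M_q(\lambda_i)$ with $\lambda_i\in\mathfrak h^*_{red}$ ($I$ any index set), and whose morphisms are all $U_q$-module homomorphisms. **The operators.** Let $\mathcal N$ be the unital $\mathbb F(q^{1/2})$-algebra generated by $x_n^-$ ($n\in\mathbb Z$) with relations $x^-_lx^-_{k+1}-q^2x^-_{k+1}x^-_l=q^2x^-_{l+1}x^-_k-x^-_kx^-_{l+1}$ (this is the subalgebra of $U_q$ generated by $\gamma^{\pm1/2}$ and the $x_n^-$, with $\gamma^{\pm 1/2}$ specialized to $1$); $a\mapsto av_\lambda$ is a linear bijection $\mathcal N\to\bar M_q(\lambda)$. Let $g_{q^{-1}}(r)$ be the Taylor coefficients at $t=0$ of $\frac{q^{-2}t-1}{t-q^{-2}}$, i.e. $g_{q^{-1}}(0)=q^2$, $g_{q^{-1}}(r)=(q^4-1)q^{2(r-1)}$ for $r>0$. The linear operators $\Omega_\psi(k):\mathcal N\to\mathcal N$ ($k\in\mathbb Z$) are determined by the generating-function formula $$\sum_{k}\Omega_\psi(k)u^{-k}\bigl(x^-(v_1)\cdots x^-(v_n)\bigr)=\sum_{l=1}^n\Bigl(\prod_{j=1}^{l-1}g_{q^{-1}}(v_j/v_l)\Bigr)x^-(v_1)\cdots\widehat{x^-(v_l)}\cdots x^-(v_n)\,\delta(u/v_l),$$ where $x^-(v)=\sum_px_p^-v^{-p}$,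 $\delta(z)=\sum_{k\in\mathbb Z}z^k$, $g_{q^{-1}}(t)=\sum_{r\ge0}g_{q^{-1}}(r)t^r$; equivalently by $\Omega_\psi(k)(1)=0$ and $\Omega_\psi(k)x^-_m=\delta_{k,-m}+\sum_{r\ge0}g_{q^{-1}}(r)x^-_{m+r}\Omega_\psi(k-r)$ as operators on $\mathcal N$ ($x_m^-$ acting by left multiplication; the sum is finite on each element). For an object $M$ with a decomposition $M=\bigoplus_i\bar M_q(\lambda_i)$, the operators $\tilde\Omega_\psi(m)$ and $\tilde x_m^-$ ($m\in\mathbb Z$) on $M$ are the linear maps given on each summand by $\tilde\Omega_\psi(m)(x^-_{n_1}\cdots x^-_{n_k}v_{\lambda_i})=\Omega_\psi(m)(x^-_{n_1}\cdots x^-_{n_k})v_{\lambda_i}$ and $\tilde x_m^-(x^-_{n_1}\cdots x^-_{n_k}v_{\lambda_i})=x_m^-x^-_{n_1}\cdots x^-_{n_k}v_{\lambda_i}$. It is known that they are well defined (independent of the chosen decomposition). **Imaginary crystal lattice.** For $M\in\mathcal O^q_{\mathrm{red,im}}$, a free $\mathbb A_0$-submodule $\mathcal L\subset M$ is an imaginary crystal $\mathbb A_0$-lattice of $M$ if: (i) $\mathbb F(q^{1/2})\otimes_{\mathbb A_0}\mathcal L\cong M$ (via the natural map); (ii) $\mathcal L=\bigoplus_{\mu\in P_0}\mathcal L_\mu$ with $\mathcal L_\mu=\mathcal L\cap M_\mu$; (iii) $\tilde\Omega_\psi(m)\mathcal L\subseteq\mathcal L$ and $\tilde x_m^-\mathcal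 L\subseteq\mathcal L$ for all $m\in\mathbb Z$. **Imaginary crystal basis.** An imaginary crystal basis of $M$ is a pair $(\mathcal L,\mathcal B)$ such that: (1) $\mathcal L$ is an imaginary crystal lattice of $M$; (2) $\mathcal B$ is an $\mathbb F$-basis of $\mathcal L/q^{1/2}\mathcal L\cong\mathbb F\otimes_{\mathbb A_0}\mathcal L$; (3) $\mathcal B=\bigsqcup_{\mu\in P_0}\mathcal B_\mu$ with $\mathcal B_\mu=\mathcal B\cap(\mathcal L_\mu/q^{1/2}\mathcal L_\mu)$; (4) $\tilde x_m^-\mathcal B\subset\pm\mathcal B\cup\{0\}$ and $\tilde\Omega_\psi(m)\mathcal B\subset\pm\mathcal B\cup\{0\}$ for all $m\in\mathbb Z$; (5) for $m\in\mathbb Z$ and $b\in\mathcal B$, if $\tilde\Omega_\psi(-m)b\ne0$ and $\tilde x_m^-b\ne0$, then $\tilde x_m^-\tilde\Omega_\psi(-m)b=\tilde\Omega_\psi(-m)\tilde x_m^-b$. In (4) and (5) the operators are those induced on $\mathcal L/q^{1/2}\mathcal L$. *)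

theory Defs
  imports
    "HOL-Library.Poly_Mapping"
    "HOL-Library.Disjoint_Sets"
    "HOL-Computational_Algebra.Polynomial"
    "HOL-Computational_Algebra.Fraction_Field"
    "HOL-Computational_Algebra.Formal_Power_Series"
    "HOL-Algebra.AbelCoset"
    "HOL-Algebra.Module"
begin

unbundle fps_syntax

text \<open>The field of rational functions in the indeterminate \<open>q\<^sup>1\<^sup>/\<^sup>2\<close>, which is \<open>qh\<close> below.\<close>

type_synonym 'f rq = "'f poly fract"

definition qh :: "'f::field_char_0 rq" where
  "qh = Fraction_Field.Fract [:0, 1:] 1"

definition qq :: "'f::field_char_0 rq" where
  "qq = qh ^ 2"

definition rq_const :: "'f::field_char_0 \<Rightarrow> 'f rq" where
  "rq_const c = Fraction_Field.Fract [:c:] 1"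

definition A0 :: "'f::field_char_0 rq set" where
  "A0 = {Fraction_Field.Fract a b | a b. poly b 0 \<noteq> 0}"

definition qint :: "int \<Rightarrow> 'f::field_char_0 rq" where
  "qint n = (qq powi n - qq powi (- n)) / (qq - inverse qq)"

text \<open>The Taylor coefficients at \<open>t = 0\<close> of \<open>(q\<^sup>-\<^sup>2 t - 1) / (t - q\<^sup>-\<^sup>2)\<close>.\<close>

definition gcoef :: "nat \<Rightarrow> 'f::field_char_0 rq" where
  "gcoef r = (if r = 0 then qq ^ 2 else (qq ^ 4 - 1) * qq ^ (2 * (r - 1)))"


datatype 'g fword = FWord (letters: "'g list")

instantiation fword :: (type) monoid_add
begin
definition "0 = FWord []"
definition "u + v = FWord (letters u @ letters v)"
instance by standard (simp_all add: zero_fword_def plus_fword_def)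
end

type_synonym ('g, 'k) free_alg = "'g fword \<Rightarrow>\<^sub>0 'k"

definition fgen :: "'g \<Rightarrow> ('g, 'k::comm_ring_1) free_alg" where
  "fgen g = Poly_Mapping.single (FWord [g]) 1"

definition fconst :: "'k::comm_ring_1 \<Rightarrow> ('g, 'k) free_alg" where
  "fconst c = Poly_Mapping.single 0 c"

lemma free_alg_induct:
  assumes "P 0" "\<And>w c. P (Poly_Mapping.single w c)" "\<And>a b. P a \<Longrightarrow> P b \<Longrightarrow> P (a + b)"
  shows "P (p :: ('g, 'k::comm_ring_1) free_alg)"
proof (induction p rule: Poly_Mapping.update_induct)
  case (update p a b)
  have "Poly_Mapping.update a b p = p + Poly_Mapping.single a b"
    using update.hyps(1)
    by (intro poly_mapping_eqI) (auto simp: lookup_update lookup_add lookup_single in_keys_iff when_def)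
  then show ?case using assms update.IH by metis
qed (simp add: assms)

inductive_set two_sided_ideal :: "'r::ring_1 set \<Rightarrow> 'r set" for S where
  zero: "0 \<in> two_sided_ideal S"
| gen: "s \<in> S \<Longrightarrow> a * s * b \<in> two_sided_ideal S"
| add: "x \<in> two_sided_ideal S \<Longrightarrow> y \<in> two_sided_ideal S \<Longrightarrow> x + y \<in> two_sided_ideal S"

lemma two_sided_ideal_mult:
  assumes "x \<in> two_sided_ideal S"
  shows "a * x * b \<in> two_sided_ideal S"
  using assms
proof induction
  case (gen s c d)
  then show ?case using two_sided_ideal.gen[of s S "a * c" "d * b"] by (simp add: mult.assoc)
qed (auto simp: distrib_left distrib_right intro: two_sided_ideal.intros)

lemma two_sided_ideal_uminus: "x \<in> two_sided_ideal S \<Longrightarrow> - x \<in> two_sided_ideal S"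
  using two_sided_ideal_mult[of x S "-1" 1] by simp

lemma two_sided_ideal_diff:
  "x \<in> two_sided_ideal S \<Longrightarrow> y \<in> two_sided_ideal S \<Longrightarrow> x - y \<in> two_sided_ideal S"
  using two_sided_ideal.add[OF _ two_sided_ideal_uminus, of x S y] by simp

lemma equivp_two_sided_ideal: "equivp (\<lambda>x y. x - y \<in> two_sided_ideal S)"
proof (intro equivpI reflpI sympI transpI)
  fix x y z assume "x - y \<in> two_sided_ideal S" "y - z \<in> two_sided_ideal S"
  then show "x - z \<in> two_sided_ideal S"
    using two_sided_ideal.add by fastforce
next
  fix x y assume "x - y \<in> two_sided_ideal S"
  then show "y - x \<in> two_sided_ideal S"
    using two_sided_ideal_uminus by fastforce
qed (auto intro: two_sided_ideal.zero)

lemma two_sided_ideal_cong_add: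
  assumes "a - b \<in> two_sided_ideal S" "c - d \<in> two_sided_ideal S"
  shows "(a + c) - (b + d) \<in> two_sided_ideal S"
  using two_sided_ideal.add[OF assms] by (simp add: algebra_simps)

lemma two_sided_ideal_cong_diff:
  assumes "a - b \<in> two_sided_ideal S" "c - d \<in> two_sided_ideal S"
  shows "(a - c) - (b - d) \<in> two_sided_ideal S"
  using two_sided_ideal_diff[OF assms] by (simp add: algebra_simps)

lemma two_sided_ideal_cong_uminus:
  assumes "a - b \<in> two_sided_ideal S"
  shows "(- a) - (- b) \<in> two_sided_ideal S"
  using two_sided_ideal_uminus[OF assms] by simp

lemma two_sided_ideal_cong_mult:
  assumes "a - b \<in> two_sided_ideal S" "c - d \<in> two_sided_ideal S"
  shows "(a * c) - (b * d) \<in> two_sided_ideal S"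
proof -
  have "1 * (a - b) * c + b * (c - d) * 1 \<in> two_sided_ideal S"
    by (intro two_sided_ideal.add two_sided_ideal_mult assms)
  then show ?thesis by (simp add: algebra_simps)
qed

text \<open>The algebra homomorphism out of a free algebra given by the images of the scalars and
  of the generators.\<close>

definition free_lift ::
    "('k \<Rightarrow> 'b) \<Rightarrow> ('g \<Rightarrow> 'b) \<Rightarrow> ('g, 'k::comm_ring_1) free_alg \<Rightarrow> 'b::{ring,monoid_mult}" where
  "free_lift h f p =
     (\<Sum>w\<in>Poly_Mapping.keys p. h (Poly_Mapping.lookup p w) * prod_list (map f (letters w)))"

locale free_lift_hom =
  fixes h :: "'k::comm_ring_1 \<Rightarrow> 'b::{ring,monoid_mult}" and f :: "'g \<Rightarrow> 'b"
  assumes h_add: "h (c + d) = h c + h d"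
    and h_mult: "h (c * d) = h c * h d"
    and h_one: "h 1 = 1"
    and h_central: "h c * b = b * h c"
begin

lemma h_zero: "h 0 = 0"
  using h_add[of 0 0] by simp

lemma free_lift_superset:
  assumes "finite W" "Poly_Mapping.keys p \<subseteq> W"
  shows "free_lift h f p = (\<Sum>w\<in>W. h (Poly_Mapping.lookup p w) * prod_list (map f (letters w)))"
  unfolding free_lift_def using assms
  by (intro sum.mono_neutral_left) (auto simp: in_keys_iff h_zero)

lemma free_lift_single:
  "free_lift h f (Poly_Mapping.single w c) = h c * prod_list (map f (letters w))"
  by (subst free_lift_superset[of "{w}"]) auto

lemma free_lift_zero: "free_lift h f 0 = 0"
  by (simp add: free_lift_def)

lemma free_lift_add: "free_lift h f (p + r) = free_lift h f p + free_lift h f r"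
  by (subst (1 2 3) free_lift_superset[of "Poly_Mapping.keys p \<union> Poly_Mapping.keys r"])
     (use Poly_Mapping.keys_add[of p r] in
       \<open>auto simp: lookup_add h_add distrib_right sum.distrib\<close>)

lemma free_lift_uminus: "free_lift h f (- p) = - free_lift h f p"
  using free_lift_add[of "- p" p] by (simp add: free_lift_zero eq_neg_iff_add_eq_0)

lemma free_lift_diff: "free_lift h f (p - r) = free_lift h f p - free_lift h f r"
  using free_lift_add[of p "- r"] by (simp add: free_lift_uminus)

lemma free_lift_mult: "free_lift h f (p * r) = free_lift h f p * free_lift h f r"
proof (induction p rule: free_alg_induct)
  case 1 then show ?case by (simp add: free_lift_zero)
next
  case (2 w c)
  show ?case
  proof (induction r rule: free_alg_induct)
    case 1 then show ?case by (simp add: free_lift_zero)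
  next
    case (2 v d)
    have "h c * h d * (A * B) = h c * A * (h d * B)" for A B
      by (metis h_central mult.assoc)
    then show ?case
      by (simp add: mult_single free_lift_single h_mult plus_fword_def)
  next
    case (3 a b) then show ?case by (simp add: distrib_left free_lift_add)
  qed
next
  case (3 a b) then show ?case by (simp add: distrib_right free_lift_add)
qed

lemma free_lift_fgen: "free_lift h f (fgen g) = f g"
  by (simp add: fgen_def free_lift_single h_one)

lemma free_lift_fconst: "free_lift h f (fconst c) = h c"
  by (simp add: fconst_def free_lift_single zero_fword_def)

lemma free_lift_ideal:
  assumes "\<And>s. s \<in> S \<Longrightarrow> free_lift h f s = 0" "p \<in> two_sided_ideal S"
  shows "free_lift h f p = 0"
  using assms(2) by induction (simp_all add: assms(1) free_lift_mult free_lift_add free_lift_zero)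

end


text \<open>\<open>Gp\<close>, \<open>Gm\<close> stand for \<open>\<gamma>\<^sup>1\<^sup>/\<^sup>2\<close>, \<open>\<gamma>\<^sup>-\<^sup>1\<^sup>/\<^sup>2\<close>. The constructor \<open>Hh\<close> has a superfluous value \<open>Hh 0\<close>,
  which is set to zero by a relation.\<close>

datatype ugen = Xp int | Xm int | Hh int | Kp | Km | Dp | Dm | Gp | Gm

type_synonym 'f ufree = "(ugen, 'f rq) free_alg"

text \<open>\<open>gam n\<close> is \<open>\<gamma>\<^sup>n\<^sup>/\<^sup>2\<close>.\<close>

definition gam :: "int \<Rightarrow> 'f::field_char_0 ufree" where
  "gam n = (if n \<ge> 0 then fgen Gp ^ nat n else fgen Gm ^ nat (- n))"

definition fps_exp_series :: "'f::field_char_0 ufree fps" where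
  "fps_exp_series = Abs_fps (\<lambda>n. fconst (inverse (of_nat (fact n))))"

text \<open>The first two series are in the variable \<open>z\<^sup>-\<^sup>1\<close> resp. \<open>z\<close>.\<close>

definition psi_series :: "'f::field_char_0 ufree fps" where
  "psi_series = fps_const (fgen Kp) *
     (fps_exp_series oo
       Abs_fps (\<lambda>k. if k = 0 then 0 else fconst (qq - inverse qq) * fgen (Hh (int k))))"

definition phi_series :: "'f::field_char_0 ufree fps" where
  "phi_series = fps_const (fgen Km) *
     (fps_exp_series oo
       Abs_fps (\<lambda>k. if k = 0 then 0 else - fconst (qq - inverse qq) * fgen (Hh (- int k))))"

definition psi_el :: "int \<Rightarrow> 'f::field_char_0 ufree" where
  "psi_el k = (if k \<ge> 0 then psi_series $ nat k else 0)"

definition phi_el :: "int \<Rightarrow> 'f::field_char_0 ufree" where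
  "phi_el k = (if k \<le> 0 then phi_series $ nat (- k) else 0)"

text \<open>Each relation \<open>a = b\<close> is recorded as the element \<open>a - b\<close>.\<close>

inductive_set uq_rels :: "'f::field_char_0 ufree set" where
  H_zero: "fgen (Hh 0) \<in> uq_rels"
| DD': "fgen Dp * fgen Dm - 1 \<in> uq_rels"
| D'D: "fgen Dm * fgen Dp - 1 \<in> uq_rels"
| KK': "fgen Kp * fgen Km - 1 \<in> uq_rels"
| K'K: "fgen Km * fgen Kp - 1 \<in> uq_rels"
| GG': "fgen Gp * fgen Gm - 1 \<in> uq_rels"
| G_central: "fgen Gp * fgen g - fgen g * fgen Gp \<in> uq_rels"
| G'_central: "fgen Gm * fgen g - fgen g * fgen Gm \<in> uq_rels"
| HH: "k \<noteq> 0 \<Longrightarrow> l \<noteq> 0 \<Longrightarrow>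
    (fgen (Hh k) * fgen (Hh l) - fgen (Hh l) * fgen (Hh k))
    - (if k + l = 0
       then fconst (qint (2 * k) / of_int k / (qq - inverse qq)) * (gam (2 * k) - gam (- 2 * k))
       else 0) \<in> uq_rels"
| HK: "k \<noteq> 0 \<Longrightarrow> fgen (Hh k) * fgen Kp - fgen Kp * fgen (Hh k) \<in> uq_rels"
| DK: "fgen Dp * fgen Kp - fgen Kp * fgen Dp \<in> uq_rels"
| DH: "k \<noteq> 0 \<Longrightarrow>
    fgen Dp * fgen (Hh k) * fgen Dm - fconst (qq powi k) * fgen (Hh k) \<in> uq_rels"
| DXp: "fgen Dp * fgen (Xp k) * fgen Dm - fconst (qq powi k) * fgen (Xp k) \<in> uq_rels"
| DXm: "fgen Dp * fgen (Xm k) * fgen Dm - fconst (qq powi k) * fgen (Xm k) \<in> uq_rels"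
| KXp: "fgen Kp * fgen (Xp k) * fgen Km - fconst (qq powi 2) * fgen (Xp k) \<in> uq_rels"
| KXm: "fgen Kp * fgen (Xm k) * fgen Km - fconst (qq powi (- 2)) * fgen (Xm k) \<in> uq_rels"
| HXp: "k \<noteq> 0 \<Longrightarrow>
    (fgen (Hh k) * fgen (Xp l) - fgen (Xp l) * fgen (Hh k))
    - fconst (qint (2 * k) / of_int k) * gam (- \<bar>k\<bar>) * fgen (Xp (k + l)) \<in> uq_rels"
| HXm: "k \<noteq> 0 \<Longrightarrow>
    (fgen (Hh k) * fgen (Xm l) - fgen (Xm l) * fgen (Hh k))
    + fconst (qint (2 * k) / of_int k) * gam \<bar>k\<bar> * fgen (Xm (k + l)) \<in> uq_rels"
| XpXp:
    "(fgen (Xp (k + 1)) * fgen (Xp l) - fconst (qq powi 2) * fgen (Xp l) * fgen (Xp (k + 1)))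
    - (fconst (qq powi 2) * fgen (Xp k) * fgen (Xp (l + 1)) - fgen (Xp (l + 1)) * fgen (Xp k))
      \<in> uq_rels"
| XmXm:
    "(fgen (Xm (k + 1)) * fgen (Xm l) - fconst (qq powi (- 2)) * fgen (Xm l) * fgen (Xm (k + 1)))
    - (fconst (qq powi (- 2)) * fgen (Xm k) * fgen (Xm (l + 1)) - fgen (Xm (l + 1)) * fgen (Xm k))
      \<in> uq_rels"
| XpXm:
    "(fgen (Xp k) * fgen (Xm l) - fgen (Xm l) * fgen (Xp k))
    - fconst (inverse (qq - inverse qq)) *
        (gam (k - l) * psi_el (k + l) - gam (l - k) * phi_el (k + l)) \<in> uq_rels"

quotient_type (overloaded) 'f uq = "'f::field_char_0 ufree"
  / "\<lambda>x y. x - y \<in> two_sided_ideal uq_rels"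
  by (rule equivp_two_sided_ideal)

instantiation uq :: (field_char_0) "{ring,monoid_mult}"
begin
lift_definition zero_uq :: "'a uq" is 0 .
lift_definition one_uq :: "'a uq" is 1 .
lift_definition plus_uq :: "'a uq \<Rightarrow> 'a uq \<Rightarrow> 'a uq" is "(+)"
  by (rule two_sided_ideal_cong_add)
lift_definition minus_uq :: "'a uq \<Rightarrow> 'a uq \<Rightarrow> 'a uq" is "(-)"
  by (rule two_sided_ideal_cong_diff)
lift_definition uminus_uq :: "'a uq \<Rightarrow> 'a uq" is uminus
  by (rule two_sided_ideal_cong_uminus)
lift_definition times_uq :: "'a uq \<Rightarrow> 'a uq \<Rightarrow> 'a uq" is "(*)"
  by (rule two_sided_ideal_cong_mult)
instance
  by standard
     (transfer; simp add: algebra_simps two_sided_ideal.zero)+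
end

definition uq_gen :: "ugen \<Rightarrow> 'f::field_char_0 uq" where
  "uq_gen g = abs_uq (fgen g)"

definition uq_const :: "'f::field_char_0 rq \<Rightarrow> 'f uq" where
  "uq_const c = abs_uq (fconst c)"


type_synonym 'f nfree = "(int, 'f rq) free_alg"

inductive_set nm_rels :: "'f::field_char_0 nfree set" where
  "(fgen l * fgen (k + 1) - fconst (qq ^ 2) * fgen (k + 1) * fgen l)
    - (fconst (qq ^ 2) * fgen (l + 1) * fgen k - fgen k * fgen (l + 1)) \<in> nm_rels"

quotient_type (overloaded) 'f nm = "'f::field_char_0 nfree"
  / "\<lambda>x y. x - y \<in> two_sided_ideal nm_rels"
  by (rule equivp_two_sided_ideal)

instantiation nm :: (field_char_0) "{ring,monoid_mult}"
begin
lift_definition zero_nm :: "'a nm" is 0 .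
lift_definition one_nm :: "'a nm" is 1 .
lift_definition plus_nm :: "'a nm \<Rightarrow> 'a nm \<Rightarrow> 'a nm" is "(+)"
  by (rule two_sided_ideal_cong_add)
lift_definition minus_nm :: "'a nm \<Rightarrow> 'a nm \<Rightarrow> 'a nm" is "(-)"
  by (rule two_sided_ideal_cong_diff)
lift_definition uminus_nm :: "'a nm \<Rightarrow> 'a nm" is uminus
  by (rule two_sided_ideal_cong_uminus)
lift_definition times_nm :: "'a nm \<Rightarrow> 'a nm \<Rightarrow> 'a nm" is "(*)"
  by (rule two_sided_ideal_cong_mult)
instance
  by standard
     (transfer; simp add: algebra_simps two_sided_ideal.zero)+
end

definition nm_gen :: "int \<Rightarrow> 'f::field_char_0 nm" where
  "nm_gen n = abs_nm (fgen n)"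

definition nm_const :: "'f::field_char_0 rq \<Rightarrow> 'f nm" where
  "nm_const c = abs_nm (fconst c)"

text \<open>The last clause determines the operators, since \<open>\<N>\<close> is spanned by the monomials in the \<open>x\<^sup>-\<^sub>m\<close>.
  Finiteness of the sum over \<open>r\<close> is part of the characterization, because \<open>Sum_any\<close> is \<open>0\<close>
  on families of infinite support.\<close>

definition is_Omega_psi :: "(int \<Rightarrow> 'f::field_char_0 nm \<Rightarrow> 'f nm) \<Rightarrow> bool" where
  "is_Omega_psi Om \<longleftrightarrow>
     (\<forall>k a b. Om k (a + b) = Om k a + Om k b) \<and>
     (\<forall>k c a. Om k (nm_const c * a) = nm_const c * Om k a) \<and>
     (\<forall>k. Om k 1 = 0) \<and>
     (\<forall>k a. finite {r::nat. Om (k - int r) a \<noteq> 0}) \<and>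
     (\<forall>k m a. Om k (nm_gen m * a) =
        (if k = - m then a else 0) +
        Sum_any (\<lambda>r::nat. nm_const (gcoef r) * nm_gen (m + int r) * Om (k - int r) a))"

definition Omega_psi :: "int \<Rightarrow> 'f::field_char_0 nm \<Rightarrow> 'f nm" where
  "Omega_psi = (THE Om. is_Omega_psi Om)"

lemma uq_free_lift_hom: "free_lift_hom (uq_const :: 'f::field_char_0 rq \<Rightarrow> 'f uq)"
proof
  fix c d :: "'f rq" and b :: "'f uq"
  show "uq_const (c + d) = uq_const c + uq_const d"
    by (simp add: uq_const_def plus_uq.abs_eq fconst_def single_add)
  show "uq_const (c * d) = uq_const c * uq_const d"
    by (simp add: uq_const_def times_uq.abs_eq fconst_def mult_single)
  show "uq_const 1 = (1 :: 'f uq)"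
    by (simp add: uq_const_def one_uq_def fconst_def)
  have "fconst c * p = p * fconst c" for p :: "'f ufree"
    by (induction p rule: free_alg_induct)
       (simp_all add: distrib_left distrib_right fconst_def mult_single mult.commute)
  then show "uq_const c * b = b * uq_const c"
    by (induction b rule: uq.abs_induct) (simp add: uq_const_def times_uq.abs_eq)
qed

text \<open>The algebra homomorphism \<open>\<N> \<rightarrow> U\<^sub>q\<close> with \<open>x\<^sup>-\<^sub>n \<mapsto> x\<^sup>-\<^sub>n\<close>; it exists since the relations of \<open>\<N>\<close>
  do not involve \<open>\<gamma>\<close>.\<close>

lemma qh_nonzero: "qh \<noteq> (0 :: 'f::field_char_0 rq)"
  by (simp add: qh_def Zero_fract_def eq_fract)

lemma abs_uq_eq_0: "abs_uq p = 0 \<longleftrightarrow> p \<in> two_sided_ideal uq_rels"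
  by (simp add: zero_uq_def uq.abs_eq_iff)

lemma uq_XmXm:
  "(uq_gen (Xm l) * uq_gen (Xm (k + 1)) - uq_const (qq ^ 2) * uq_gen (Xm (k + 1)) * uq_gen (Xm l))
    - (uq_const (qq ^ 2) * uq_gen (Xm (l + 1)) * uq_gen (Xm k) - uq_gen (Xm k) * uq_gen (Xm (l + 1)))
   = (0 :: 'f::field_char_0 uq)"
proof -
  interpret free_lift_hom "uq_const :: 'f rq \<Rightarrow> 'f uq" "\<lambda>_::unit. 0" by (rule uq_free_lift_hom)
  let ?r = "(fgen (Xm (k + 1)) * fgen (Xm l) - fconst (qq powi (- 2)) * fgen (Xm l) * fgen (Xm (k + 1)))
    - (fconst (qq powi (- 2)) * fgen (Xm k) * fgen (Xm (l + 1)) - fgen (Xm (l + 1)) * fgen (Xm k))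
    :: 'f ufree"
  have "?r \<in> two_sided_ideal uq_rels"
    using two_sided_ideal.gen[OF uq_rels.XmXm, of 1 k l 1] by simp
  then have "abs_uq ?r = 0" by (simp add: abs_uq_eq_0)
  then have r: "(uq_gen (Xm (k + 1)) * uq_gen (Xm l)
      - uq_const (qq powi (- 2)) * (uq_gen (Xm l) * uq_gen (Xm (k + 1))))
    - (uq_const (qq powi (- 2)) * (uq_gen (Xm k) * uq_gen (Xm (l + 1)))
       - uq_gen (Xm (l + 1)) * uq_gen (Xm k)) = (0 :: 'f uq)"
    by (simp add: uq_gen_def uq_const_def times_uq.abs_eq minus_uq.abs_eq mult.assoc)
  have q: "qq ^ 2 * qq powi (- 2) = (1 :: 'f rq)"
    using qh_nonzero[where 'f = 'f] by (simp add: qq_def power_int_minus)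
  have c: "uq_const (qq ^ 2) * (uq_const (qq powi (- 2)) * x) = (x :: 'f uq)" for x
    by (metis h_mult h_one q mult.assoc mult_1)
  show ?thesis
    using arg_cong[OF r, of "\<lambda>x. uq_const (qq ^ 2) * x"]
    by (simp only: right_diff_distrib c mult.assoc mult_zero_right) (simp add: algebra_simps)
qed

lift_definition nm_to_uq :: "'f::field_char_0 nm \<Rightarrow> 'f uq" is
  "free_lift uq_const (\<lambda>n. uq_gen (Xm n))"
proof -
  fix p r :: "'f nfree"
  interpret free_lift_hom "uq_const :: 'f rq \<Rightarrow> 'f uq" "\<lambda>n. uq_gen (Xm n)"
    by (rule uq_free_lift_hom)
  assume "p - r \<in> two_sided_ideal nm_rels"
  then have "free_lift uq_const (\<lambda>n. uq_gen (Xm n)) (p - r) = (0 :: 'f uq)"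
    by (rule free_lift_ideal[rotated])
       (auto elim!: nm_rels.cases
         simp: free_lift_diff free_lift_mult free_lift_fgen free_lift_fconst uq_XmXm)
  then show "free_lift uq_const (\<lambda>n. uq_gen (Xm n)) p
      = (free_lift uq_const (\<lambda>n. uq_gen (Xm n)) r :: 'f uq)"
    by (simp add: free_lift_diff)
qed


text \<open>Modules are records of HOL-Algebra; their components \<open>mult\<close> and \<open>one\<close> play no role. The
  locale \<open>module\<close> does not apply, as it requires commutative scalars.\<close>

definition left_module :: "('r::{ring,monoid_mult}, 'm) module \<Rightarrow> bool" where
  "left_module M \<longleftrightarrow> abelian_group M \<and>
     (\<forall>a. \<forall>x\<in>carrier M. a \<odot>\<^bsub>M\<^esub> x \<in> carrier M) \<and>
     (\<forall>a b. \<forall>x\<in>carrier M. (a + b) \<odot>\<^bsub>M\<^esub> x = a \<odot>\<^bsub>M\<^esub> x \<oplus>\<^bsub>M\<^esub> b \<odot>\<^bsub>M\<^esub> x) \<and>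
     (\<forall>a. \<forall>x\<in>carrier M. \<forall>y\<in>carrier M. a \<odot>\<^bsub>M\<^esub> (x \<oplus>\<^bsub>M\<^esub> y) = a \<odot>\<^bsub>M\<^esub> x \<oplus>\<^bsub>M\<^esub> a \<odot>\<^bsub>M\<^esub> y) \<and>
     (\<forall>a b. \<forall>x\<in>carrier M. (a * b) \<odot>\<^bsub>M\<^esub> x = a \<odot>\<^bsub>M\<^esub> (b \<odot>\<^bsub>M\<^esub> x)) \<and>
     (\<forall>x\<in>carrier M. 1 \<odot>\<^bsub>M\<^esub> x = x)"

definition module_iso :: "('r, 'm) module \<Rightarrow> ('r, 'n) module \<Rightarrow> ('m \<Rightarrow> 'n) \<Rightarrow> bool" where
  "module_iso M N f \<longleftrightarrow> bij_betw f (carrier M) (carrier N) \<and>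
     (\<forall>x\<in>carrier M. \<forall>y\<in>carrier M. f (x \<oplus>\<^bsub>M\<^esub> y) = f x \<oplus>\<^bsub>N\<^esub> f y) \<and>
     (\<forall>a. \<forall>x\<in>carrier M. f (a \<odot>\<^bsub>M\<^esub> x) = a \<odot>\<^bsub>N\<^esub> f x)"

definition regular_module :: "('r::{ring,monoid_mult}, 'r) module" where
  "regular_module = \<lparr>carrier = UNIV, mult = (*), one = 1, zero = 0, add = (+), smult = (*)\<rparr>"

definition quot_module :: "('r, 'm) module \<Rightarrow> 'm set \<Rightarrow> ('r, 'm set) module" where
  "quot_module M H = \<lparr>carrier = a_rcosets\<^bsub>M\<^esub> H, mult = undefined, one = undefined,
     zero = H, add = (\<lambda>X Y. X <+>\<^bsub>M\<^esub> Y), smult = (\<lambda>a X. \<Union>x\<in>X. H +>\<^bsub>M\<^esub> (a \<odot>\<^bsub>M\<^esub> x))\<rparr>"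

definition restrict_scalars :: "('k \<Rightarrow> 'r) \<Rightarrow> ('r, 'm) module \<Rightarrow> ('k, 'm) module" where
  "restrict_scalars h M = \<lparr>carrier = carrier M, mult = mult M, one = one M,
     zero = zero M, add = add M, smult = (\<lambda>c x. h c \<odot>\<^bsub>M\<^esub> x)\<rparr>"

definition dsum :: "'i set \<Rightarrow> ('i \<Rightarrow> ('r, 'm) module) \<Rightarrow> ('r, 'i \<Rightarrow> 'm) module" where
  "dsum I Ms = \<lparr>carrier = {f \<in> (\<Pi>\<^sub>E i\<in>I. carrier (Ms i)). finite {i\<in>I. f i \<noteq> \<zero>\<^bsub>Ms i\<^esub>}},
     mult = undefined, one = undefined,
     zero = (\<lambda>i\<in>I. \<zero>\<^bsub>Ms i\<^esub>),
     add = (\<lambda>f g. \<lambda>i\<in>I. f i \<oplus>\<^bsub>Ms i\<^esub> g i),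
     smult = (\<lambda>a f. \<lambda>i\<in>I. a \<odot>\<^bsub>Ms i\<^esub> f i)\<rparr>"

inductive_set left_ideal :: "'r::{ring,monoid_mult} set \<Rightarrow> 'r set" for S where
  zero: "0 \<in> left_ideal S"
| gen: "s \<in> S \<Longrightarrow> a * s \<in> left_ideal S"
| add: "x \<in> left_ideal S \<Longrightarrow> y \<in> left_ideal S \<Longrightarrow> x + y \<in> left_ideal S"

text \<open>\<open>Weight a b n\<close> is the weight \<open>a\<Lambda>\<^sub>0 + b\<Lambda>\<^sub>1 + n\<delta>\<close>.\<close>

datatype weight = Weight int int int

fun at_h :: "weight \<Rightarrow> int" where "at_h (Weight a b n) = b"
fun at_c :: "weight \<Rightarrow> int" where "at_c (Weight a b n) = a + b"
fun at_d :: "weight \<Rightarrow> int" where "at_d (Weight a b n) = n"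

definition P0 :: "weight set" where
  "P0 = {\<mu>. at_c \<mu> = 0}"

definition hred :: "weight set" where
  "hred = {\<mu>\<in>P0. at_h \<mu> \<noteq> 0}"

definition weight_space :: "('f::field_char_0 uq, 'm) module \<Rightarrow> weight \<Rightarrow> 'm set" where
  "weight_space M \<mu> = {x \<in> carrier M.
     uq_gen Kp \<odot>\<^bsub>M\<^esub> x = uq_const (qq powi at_h \<mu>) \<odot>\<^bsub>M\<^esub> x \<and>
     uq_gen Dp \<odot>\<^bsub>M\<^esub> x = uq_const (qq powi at_d \<mu>) \<odot>\<^bsub>M\<^esub> x}"

definition J_gens :: "weight \<Rightarrow> 'f::field_char_0 uq set" where
  "J_gens \<mu> = range (\<lambda>k. uq_gen (Xp k)) \<union> {uq_gen (Hh l) | l. l \<noteq> 0} \<union>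
     {uq_gen Kp - uq_const (qq powi at_h \<mu>), uq_gen Km - uq_const (qq powi (- at_h \<mu>)),
      uq_gen Gp - 1, uq_gen Gm - 1,
      uq_gen Dp - uq_const (qq powi at_d \<mu>), uq_gen Dm - uq_const (qq powi (- at_d \<mu>))}"

definition Mbar :: "weight \<Rightarrow> ('f::field_char_0 uq, 'f uq set) module" where
  "Mbar \<mu> = quot_module regular_module (left_ideal (J_gens \<mu>))"

definition hw_vec :: "weight \<Rightarrow> 'f::field_char_0 uq set" where
  "hw_vec \<mu> = left_ideal (J_gens \<mu>) +>\<^bsub>regular_module\<^esub> 1"

definition decomposes ::
    "('f::field_char_0 uq, 'm) module \<Rightarrow> 'i set \<Rightarrow> ('i \<Rightarrow> weight) \<Rightarrow> (('i \<Rightarrow> 'f uq set) \<Rightarrow> 'm) \<Rightarrow> bool"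
  where
  "decomposes M I lam \<theta> \<longleftrightarrow>
     (\<forall>i\<in>I. lam i \<in> hred) \<and> module_iso (dsum I (\<lambda>i. Mbar (lam i))) M \<theta>"

text \<open>Indexing by subsets of \<open>'m\<close> is no restriction: the summands of any decomposition can be
  indexed by the images of their generators \<open>v\<^sub>\<lambda>\<close>, which are pairwise distinct.\<close>

definition O_red_im :: "('f::field_char_0 uq, 'm) module \<Rightarrow> bool" where
  "O_red_im M \<longleftrightarrow> left_module M \<and>
     (\<exists>(I :: 'm set) lam \<theta>. decomposes M I lam \<theta>)"

text \<open>The map \<open>a \<mapsto> a v\<^sub>\<lambda>\<close>, a bijection from \<open>\<N>\<close> to the carrier of \<open>Mbar \<mu>\<close>, along which operators
  on \<open>\<N>\<close> are transported.\<close>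

definition hw_map :: "weight \<Rightarrow> 'f::field_char_0 nm \<Rightarrow> 'f uq set" where
  "hw_map \<mu> a = nm_to_uq a \<odot>\<^bsub>Mbar \<mu>\<^esub> hw_vec \<mu>"

definition tilde_summand ::
    "weight \<Rightarrow> ('f::field_char_0 nm \<Rightarrow> 'f nm) \<Rightarrow> 'f uq set \<Rightarrow> 'f uq set" where
  "tilde_summand \<mu> T y = hw_map \<mu> (T (inv_into UNIV (hw_map \<mu>) y))"

definition tilde_op ::
    "'i set \<Rightarrow> ('i \<Rightarrow> weight) \<Rightarrow> (('i \<Rightarrow> 'f::field_char_0 uq set) \<Rightarrow> 'm) \<Rightarrow>
     ('f nm \<Rightarrow> 'f nm) \<Rightarrow> 'm \<Rightarrow> 'm" where
  "tilde_op I lam \<theta> T y =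
     \<theta> (\<lambda>i\<in>I. tilde_summand (lam i) T
                (inv_into (carrier (dsum I (\<lambda>i. Mbar (lam i)))) \<theta> y i))"

abbreviation tilde_Omega where
  "tilde_Omega I lam \<theta> m \<equiv> tilde_op I lam \<theta> (Omega_psi m)"

abbreviation tilde_x where
  "tilde_x I lam \<theta> m \<equiv> tilde_op I lam \<theta> (\<lambda>a. nm_gen m * a)"

definition lincomb :: "('k::zero, 'm) module \<Rightarrow> ('m \<Rightarrow>\<^sub>0 'k) \<Rightarrow> 'm" where
  "lincomb V c = (\<Oplus>\<^bsub>V\<^esub>x\<in>Poly_Mapping.keys c. Poly_Mapping.lookup c x \<odot>\<^bsub>V\<^esub> x)"

definition coeffs_in :: "'k::zero set \<Rightarrow> 'm set \<Rightarrow> ('m \<Rightarrow>\<^sub>0 'k) set" where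
  "coeffs_in R S = {c. Poly_Mapping.keys c \<subseteq> S \<and> range (Poly_Mapping.lookup c) \<subseteq> R}"

definition is_basis :: "'k::zero set \<Rightarrow> ('k, 'm) module \<Rightarrow> 'm set \<Rightarrow> bool" where
  "is_basis R V E \<longleftrightarrow> E \<subseteq> carrier V \<and>
     (\<forall>x\<in>carrier V. \<exists>c\<in>coeffs_in R E. x = lincomb V c) \<and>
     (\<forall>c\<in>coeffs_in R E. lincomb V c = \<zero>\<^bsub>V\<^esub> \<longrightarrow> c = 0)"

definition submodule_over :: "'k set \<Rightarrow> ('k, 'm) module \<Rightarrow> 'm set \<Rightarrow> bool" where
  "submodule_over R V L \<longleftrightarrow> L \<subseteq> carrier V \<and> \<zero>\<^bsub>V\<^esub> \<in> L \<and>
     (\<forall>x\<in>L. \<forall>y\<in>L. x \<oplus>\<^bsub>V\<^esub> y \<in> L) \<and> (\<forall>a\<in>R. \<forall>x\<in>L. a \<odot>\<^bsub>V\<^esub> x \<in> L)"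

text \<open>The tensor product of the field \<open>'k\<close> with a submodule \<open>L\<close> of the \<open>'k\<close>-vector space \<open>V\<close> over
  the subring \<open>R\<close>, as a quotient of the free abelian group on \<open>UNIV \<times> L\<close>.\<close>

inductive_set tensor_rels ::
    "'k::comm_ring_1 set \<Rightarrow> ('k, 'm) module \<Rightarrow> 'm set \<Rightarrow> ('k \<times> 'm \<Rightarrow>\<^sub>0 int) set" for R V L where
  zero: "0 \<in> tensor_rels R V L"
| diff: "s \<in> tensor_rels R V L \<Longrightarrow> t \<in> tensor_rels R V L \<Longrightarrow> s - t \<in> tensor_rels R V L"
| left: "x \<in> L \<Longrightarrow> frag_of (c + d, x) - frag_of (c, x) - frag_of (d, x) \<in> tensor_rels R V L"
| right: "x \<in> L \<Longrightarrow> y \<in> L \<Longrightarrow>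
    frag_of (c, x \<oplus>\<^bsub>V\<^esub> y) - frag_of (c, x) - frag_of (c, y) \<in> tensor_rels R V L"
| balanced: "x \<in> L \<Longrightarrow> a \<in> R \<Longrightarrow>
    frag_of (c * a, x) - frag_of (c, a \<odot>\<^bsub>V\<^esub> x) \<in> tensor_rels R V L"

definition tensor ::
    "'k::comm_ring_1 set \<Rightarrow> ('k, 'm) module \<Rightarrow> 'm set \<Rightarrow> ('k \<times> 'm \<Rightarrow>\<^sub>0 int) set set" where
  "tensor R V L = (let F = {t. Poly_Mapping.keys t \<subseteq> UNIV \<times> L} in
     F // {(s, t). s \<in> F \<and> t \<in> F \<and> s - t \<in> tensor_rels R V L})"

definition natural_map :: "('k, 'm) module \<Rightarrow> ('k \<times> 'm \<Rightarrow>\<^sub>0 int) set \<Rightarrow> 'm" where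
  "natural_map V X = the_elem
     ((\<lambda>t. \<Oplus>\<^bsub>V\<^esub>p\<in>Poly_Mapping.keys t. [Poly_Mapping.lookup t p] \<cdot>\<^bsub>V\<^esub> (fst p \<odot>\<^bsub>V\<^esub> snd p)) ` X)"

definition is_internal_dsum :: "('k, 'm) module \<Rightarrow> 'i set \<Rightarrow> ('i \<Rightarrow> 'm set) \<Rightarrow> 'm set \<Rightarrow> bool" where
  "is_internal_dsum V I Ls L \<longleftrightarrow>
     bij_betw (\<lambda>f. \<Oplus>\<^bsub>V\<^esub>i\<in>{i\<in>I. f i \<noteq> \<zero>\<^bsub>V\<^esub>}. f i)
       (carrier (dsum I (\<lambda>i. V\<lparr>carrier := Ls i\<rparr>))) L"

definition vs :: "('f::field_char_0 uq, 'm) module \<Rightarrow> ('f rq, 'm) module" where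
  "vs M = restrict_scalars uq_const M"

text \<open>The operators on \<open>M\<close> are those attached to the given decomposition of \<open>M\<close>; they do not depend
  on it. The arguments \<open>I lam \<theta>\<close> are this decomposition.\<close>

definition imaginary_crystal_lattice ::
    "('f::field_char_0 uq, 'm) module \<Rightarrow> 'i set \<Rightarrow> ('i \<Rightarrow> weight) \<Rightarrow> (('i \<Rightarrow> 'f uq set) \<Rightarrow> 'm) \<Rightarrow>
     'm set \<Rightarrow> bool" where
  "imaginary_crystal_lattice M I lam \<theta> L \<longleftrightarrow>
     submodule_over A0 (vs M) L \<and> (\<exists>E. is_basis A0 ((vs M)\<lparr>carrier := L\<rparr>) E) \<and>
     bij_betw (natural_map (vs M)) (tensor A0 (vs M) L) (carrier M) \<and>
     is_internal_dsum (vs M) P0 (\<lambda>\<mu>. L \<inter> weight_space M \<mu>) L \<and>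
     (\<forall>m. tilde_Omega I lam \<theta> m ` L \<subseteq> L \<and> tilde_x I lam \<theta> m ` L \<subseteq> L)"

definition qh_mult :: "('f::field_char_0 uq, 'm) module \<Rightarrow> 'm set \<Rightarrow> 'm set" where
  "qh_mult M L = (\<lambda>x. qh \<odot>\<^bsub>vs M\<^esub> x) ` L"

text \<open>\<open>L / q\<^sup>1\<^sup>/\<^sup>2 L\<close> as a vector space over \<open>'f\<close>, the residue field of \<open>A0\<close>, which acts through the
  constants in \<open>A0\<close>.\<close>

definition residue_space :: "('f::field_char_0 uq, 'm) module \<Rightarrow> 'm set \<Rightarrow> ('f, 'm set) module" where
  "residue_space M L =
     quot_module (restrict_scalars rq_const ((vs M)\<lparr>carrier := L\<rparr>)) (qh_mult M L)"

definition residue_class :: "('f::field_char_0 uq, 'm) module \<Rightarrow> 'm set \<Rightarrow> 'm \<Rightarrow> 'm set" where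
  "residue_class M L x = qh_mult M L +>\<^bsub>M\<^esub> x"

definition induced_op ::
    "('f::field_char_0 uq, 'm) module \<Rightarrow> 'm set \<Rightarrow> ('m \<Rightarrow> 'm) \<Rightarrow> 'm set \<Rightarrow> 'm set" where
  "induced_op M L T X = (\<Union>x\<in>X. residue_class M L (T x))"

definition imaginary_crystal_basis ::
    "('f::field_char_0 uq, 'm) module \<Rightarrow> 'i set \<Rightarrow> ('i \<Rightarrow> weight) \<Rightarrow> (('i \<Rightarrow> 'f uq set) \<Rightarrow> 'm) \<Rightarrow>
     'm set \<Rightarrow> 'm set set \<Rightarrow> bool" where
  "imaginary_crystal_basis M I lam \<theta> L B \<longleftrightarrow>
     (let Q = residue_space M L;
          Bw = (\<lambda>\<mu>. B \<inter> residue_class M L ` (L \<inter> weight_space M \<mu>));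
          Om = (\<lambda>m. induced_op M L (tilde_Omega I lam \<theta> m));
          X = (\<lambda>m. induced_op M L (tilde_x I lam \<theta> m));
          B' = B \<union> {\<ominus>\<^bsub>Q\<^esub> b | b. b \<in> B} \<union> {\<zero>\<^bsub>Q\<^esub>}
      in imaginary_crystal_lattice M I lam \<theta> L \<and>
         is_basis UNIV Q B \<and>
         B = (\<Union>\<mu>\<in>P0. Bw \<mu>) \<and> disjoint_family_on Bw P0 \<and>
         (\<forall>m. X m ` B \<subseteq> B' \<and> Om m ` B \<subseteq> B') \<and>
         (\<forall>m. \<forall>b\<in>B. Om (- m) b \<noteq> \<zero>\<^bsub>Q\<^esub> \<and> X m b \<noteq> \<zero>\<^bsub>Q\<^esub> \<longrightarrow> X m (Om (- m) b) = Om (- m) (X m b)))"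

definition std_lattice_summand :: "weight \<Rightarrow> 'f::field_char_0 uq set set" where
  "std_lattice_summand \<mu> = lincomb (vs (Mbar \<mu>)) `
     coeffs_in A0 {foldr (\<lambda>n y. uq_gen (Xm n) \<odot>\<^bsub>Mbar \<mu>\<^esub> y) ns (hw_vec \<mu>) | ns. sorted_wrt (\<ge>) ns}"

definition std_basis_summand :: "weight \<Rightarrow> 'f::field_char_0 uq set set set" where
  "std_basis_summand \<mu> =
     {residue_class (Mbar \<mu>) (std_lattice_summand \<mu>)
        (foldr (\<lambda>n. tilde_summand \<mu> (\<lambda>a. nm_gen n * a)) ns (hw_vec \<mu>)) | ns. sorted_wrt (\<ge>) ns}"

definition std_lattice ::
    "'i set \<Rightarrow> ('i \<Rightarrow> weight) \<Rightarrow> (('i \<Rightarrow> 'f::field_char_0 uq set) \<Rightarrow> 'm) \<Rightarrow> 'm set" where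
  "std_lattice I lam \<theta> =
     \<theta> ` {f \<in> carrier (dsum I (\<lambda>i. Mbar (lam i))). \<forall>i\<in>I. f i \<in> std_lattice_summand (lam i)}"

definition dsum_incl ::
    "'i set \<Rightarrow> ('i \<Rightarrow> weight) \<Rightarrow> 'i \<Rightarrow> 'f::field_char_0 uq set \<Rightarrow> 'i \<Rightarrow> 'f uq set" where
  "dsum_incl I lam i y = (\<lambda>j\<in>I. if j = i then y else \<zero>\<^bsub>Mbar (lam j)\<^esub>)"

text \<open>The image of each \<open>\<B>(\<lambda>\<^sub>i)\<close> under the map \<open>\<L>(\<lambda>\<^sub>i) / q\<^sup>1\<^sup>/\<^sup>2 \<L>(\<lambda>\<^sub>i) \<rightarrow> \<L> / q\<^sup>1\<^sup>/\<^sup>2 \<L>\<close> induced by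
  the inclusion of the \<open>i\<close>-th summand.\<close>

definition std_basis ::
    "('f::field_char_0 uq, 'm) module \<Rightarrow> 'i set \<Rightarrow> ('i \<Rightarrow> weight) \<Rightarrow> (('i \<Rightarrow> 'f uq set) \<Rightarrow> 'm) \<Rightarrow>
     'm set set" where
  "std_basis M I lam \<theta> =
     (\<Union>i\<in>I. (\<lambda>X. \<Union>y\<in>X. residue_class M (std_lattice I lam \<theta>) (\<theta> (dsum_incl I lam i y)))
        ` std_basis_summand (lam i))"

end

theory Submission
  imports Defs "HOL-Library.Function_Algebras" "HOL-Library.Product_Plus"
begin

text \<open>The algebra \<open>\<N>\<close> and the module \<open>Mbar \<lambda>\<close> are presented by generators and relations, so the ordered
monomials are not known beforehand to be independent, and \<open>\<N>\<close> is not known to embed into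
\<open>Mbar \<lambda>\<close>. Both facts are obtained from operators on \<open>\<N>\<close>, and a map out of \<open>\<N>\<close> is always constructed
in the same way (\<open>nm_recursor\<close>): operators on some space that satisfy the quadratic relations of the
\<open>x\<^sup>-\<^sub>m\<close> make it an \<open>\<N>\<close>-module, and the map is the orbit map of a vector.

\<^bold>\<open>The operators \<open>\<Omega>\<^sub>\<psi>\<close>.\<close> Here the space consists of pairs of an element \<open>a\<close> and a candidate for the
sequence \<open>\<Omega>\<^sub>\<psi>(k) a\<close>. That the quadratic relations hold on it comes down to a two-term recursion for the
Taylor coefficients (\<open>gcoef_rec\<close>).

\<^bold>\<open>The limit \<open>q\<^sup>1\<^sup>/\<^sup>2 = 0\<close>.\<close> Let \<open>nlat\<close> be the span of all monomials over the local ring. Modulo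
\<open>q\<^sup>1\<^sup>/\<^sup>2\<close> the relations become \<open>x\<^sub>l x\<^sub>k = - x\<^sub>k\<^sub>-\<^sub>1 x\<^sub>l\<^sub>+\<^sub>1\<close>, with \<open>x\<^sub>l x\<^sub>l\<^sub>+\<^sub>1 = 0\<close>, and
\<open>\<Omega>\<^sub>\<psi>(k) x\<^sub>m = \<delta> - x\<^sub>m\<^sub>+\<^sub>1 \<Omega>\<^sub>\<psi>(k-1)\<close>, because the Taylor coefficient of index 1 is \<open>-1\<close> there and all others
vanish. Reading \<open>x\<^sub>n\<^sub>1 \<dots> x\<^sub>n\<^sub>k\<close> as the wedge product of the vectors \<open>e(n\<^sub>j - j)\<close>, these rules say that \<open>x\<^sub>m\<close> is
a shift followed by the exterior multiplication with \<open>e(m - 1)\<close>, and \<open>\<Omega>\<^sub>\<psi>(-m)\<close> the contraction with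
\<open>e(m - 1)\<close> followed by the inverse shift. Hence both send basis vectors to signed basis vectors or to
0, and they are inverse to each other where they do not vanish (\<open>x_cr_Om_cr\<close>, \<open>Om_cr_x_cr\<close>); this is
the content of the last two axioms of a crystal basis.

\<^bold>\<open>Independence.\<close> The functional that applies \<open>\<Omega>\<^sub>\<psi>(-n\<^sub>1), \<dots>, \<Omega>\<^sub>\<psi>(-n\<^sub>k)\<close> in this order and takes the constant term is
modulo \<open>q\<^sup>1\<^sup>/\<^sup>2\<close> the coordinate function of the ordered monomial \<open>x\<^sub>n\<^sub>1 \<dots> x\<^sub>n\<^sub>k\<close> (\<open>pbw_functional\<close>). So the
ordered monomials are independent, and the coefficients of an element of \<open>nlat\<close> lie in the local
ring (\<open>ncomb_nlat_coeff\<close>). A straightening argument shows that they span (\<open>slat_gen\<close>).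

\<^bold>\<open>The module \<open>Mbar \<lambda>\<close>.\<close> The algebra \<open>U\<^sub>q\<close> acts on \<open>\<N>\<close>: the \<open>x\<^sup>-\<^sub>m\<close> by left multiplication, the \<open>h\<^sub>k\<close> by
derivations, \<open>K\<close> and \<open>D\<close> by gradings, \<open>\<gamma>\<close> trivially, and the \<open>x\<^sup>+\<^sub>k\<close> by operators that kill 1 and
have the prescribed commutators with the \<open>x\<^sup>-\<^sub>m\<close>. That these operators exist, and that they satisfy their own
quadratic relations, follows from one relation between the currents \<open>\<psi>\<close>, \<open>\<phi>\<close> and \<open>x\<^sup>\<plusminus>\<close> (\<open>Theta_current\<close>), which
in turn follows from the differential equation of the exponential series (\<open>expop_current\<close>). Since 1 is killed by the left ideal that defines \<open>Mbar \<lambda>\<close>,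
and every element of \<open>U\<^sub>q\<close> agrees modulo this ideal with its value on 1 (\<open>uq_mod_J\<close>), the map
\<open>a \<mapsto> a v\<^sub>\<lambda>\<close> is an isomorphism.

\<^bold>\<open>Direct sums.\<close> A decomposition now gives coordinates on \<open>M\<close> indexed by the pairs of a summand and an
ordered monomial. The lattice consists of the vectors with coordinates in the local ring, its
residue space has the residues as coordinates, and \<open>K\<close> and \<open>D\<close> are diagonal. The axioms
are checked in these coordinates.\<close>

section \<open>The local ring at \<open>q\<^sup>1\<^sup>/\<^sup>2 = 0\<close>\<close>

text \<open>The value of a rational function at \<open>q\<^sup>1\<^sup>/\<^sup>2 = 0\<close>; it is meaningful on the local ring only.\<close>

definition A0_res :: "'f::field_char_0 rq \<Rightarrow> 'f" where
  "A0_res x = (SOME c. \<exists>a b. x = Fraction_Field.Fract a b \<and> poly b 0 \<noteq> 0 \<and> c = poly a 0 / poly b 0)"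

lemma A0_res_Fract:
  assumes "poly b 0 \<noteq> 0"
  shows "A0_res (Fraction_Field.Fract a b) = poly a 0 / poly b 0"
proof -
  have "c = poly a 0 / poly b 0"
    if c: "Fraction_Field.Fract a b = Fraction_Field.Fract a' b'" "poly b' 0 \<noteq> 0" "c = poly a' 0 / poly b' 0"
    for a' b' c
  proof -
    have "b \<noteq> 0" "b' \<noteq> 0" using assms c(2) by auto
    then have "a * b' = a' * b" using c(1) by (simp add: eq_fract)
    then have "poly a 0 * poly b' 0 = poly a' 0 * poly b 0" by (metis poly_mult)
    then show ?thesis using assms c(2,3) by (simp add: frac_eq_eq)
  qed
  then show ?thesis unfolding A0_res_def using assms by (intro some_equality) blast+
qed

lemma A0_cases [consumes 1]:
  assumes "x \<in> A0"
  obtains a b where "x = Fraction_Field.Fract a b" "poly b 0 \<noteq> 0" "b \<noteq> 0"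
    "A0_res x = poly a 0 / poly b 0"
  proof -
  obtain a b where ab: "x = Fraction_Field.Fract a b" "poly b 0 \<noteq> 0"
    using assms unfolding A0_def by blast
  moreover have "b \<noteq> 0" using ab(2) by auto
  ultimately show thesis using that by (simp add: A0_res_Fract)
qed

lemma Fract_in_A0: "poly b 0 \<noteq> 0 \<Longrightarrow> Fraction_Field.Fract a b \<in> A0"
  unfolding A0_def by blast

lemma A0_add: "x \<in> A0 \<Longrightarrow> y \<in> A0 \<Longrightarrow> x + y \<in> A0 \<and> A0_res (x + y) = A0_res x + A0_res y"
  by (erule A0_cases)+ (auto simp: Fract_in_A0 A0_res_Fract field_simps)

lemma A0_mult: "x \<in> A0 \<Longrightarrow> y \<in> A0 \<Longrightarrow> x * y \<in> A0 \<and> A0_res (x * y) = A0_res x * A0_res y"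
  by (erule A0_cases)+ (auto simp: Fract_in_A0 A0_res_Fract)

lemma A0_uminus: "x \<in> A0 \<Longrightarrow> - x \<in> A0 \<and> A0_res (- x) = - A0_res x"
  by (erule A0_cases) (auto simp: Fract_in_A0 A0_res_Fract)

lemma A0_rq_const: "rq_const c \<in> A0" "A0_res (rq_const c) = c"
  by (auto simp: rq_const_def Fract_in_A0 A0_res_Fract)

lemma rq_const_hom:
  "rq_const (c + d) = rq_const c + rq_const d"
  "rq_const (c * d) = rq_const c * rq_const d"
  "rq_const 0 = 0" "rq_const 1 = 1"
  by (simp_all add: rq_const_def Zero_fract_def One_fract_def one_pCons mult.commute)

lemma A0_0: "0 \<in> A0" "A0_res 0 = 0"
  using A0_rq_const[of 0] by (simp_all add: rq_const_hom)

lemma A0_1: "1 \<in> A0" "A0_res 1 = 1"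
  using A0_rq_const[of 1] by (simp_all add: rq_const_hom)

lemma A0_qh: "qh \<in> A0" "A0_res qh = 0"
  by (auto simp: qh_def Fract_in_A0 A0_res_Fract)

lemmas A0_arith [simp] =
  A0_add[THEN conjunct1] A0_add[THEN conjunct2] A0_mult[THEN conjunct1] A0_mult[THEN conjunct2]
  A0_uminus[THEN conjunct1] A0_uminus[THEN conjunct2] A0_rq_const A0_0 A0_1 A0_qh

lemma A0_diff [simp]:
  assumes "x \<in> A0" "y \<in> A0"
  shows "x - y \<in> A0" "A0_res (x - y) = A0_res x - A0_res y"
  using assms A0_add[of x "- y"] by simp_all

lemma A0_power [simp]: "x \<in> A0 \<Longrightarrow> x ^ n \<in> A0" "x \<in> A0 \<Longrightarrow> A0_res (x ^ n) = A0_res x ^ n"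
  by (induction n) simp_all

lemma A0_res_eq_0: assumes "x \<in> A0" "A0_res x = 0" obtains y where "y \<in> A0" "x = qh * y"
proof -
  obtain a b where ab: "x = Fraction_Field.Fract a b" "poly b 0 \<noteq> 0" "A0_res x = poly a 0 / poly b 0"
    using assms(1) by (rule A0_cases)
  then have "poly a 0 = 0" using assms(2) by simp
  then obtain c where "a = [:0, 1:] * c"
    using poly_eq_0_iff_dvd[of a 0] by (auto elim: dvdE)
  then have "x = qh * Fraction_Field.Fract c b" using ab by (simp add: qh_def)
  then show thesis using that Fract_in_A0 ab(2) by blast
qed

text \<open>The local ring is a discrete valuation ring with uniformizer \<open>q\<^sup>1\<^sup>/\<^sup>2\<close>: the exponent is the
valuation, found by splitting off the order at 0 from numerator and denominator.\<close>

lemma rq_unit_part: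
  fixes x :: "'f::field_char_0 rq"
  assumes "x \<noteq> 0"
  obtains n u where "x = qh powi n * u" "u \<in> A0" "A0_res u \<noteq> 0"
proof -
  obtain a b where ab: "x = Fraction_Field.Fract a b" "b \<noteq> 0" by (cases x) auto
  have "a \<noteq> 0" using assms ab by (auto simp: Zero_fract_def eq_fract)
  have dec: "\<exists>k r. p = [:0, 1:] ^ k * r \<and> poly r 0 \<noteq> 0" if "p \<noteq> 0" for p :: "'f poly"
    using order_decomp[OF that, of 0] by (auto simp: poly_eq_0_iff_dvd)
  obtain i a' where a: "a = [:0, 1:] ^ i * a'" "poly a' 0 \<noteq> 0" using dec \<open>a \<noteq> 0\<close> by blast
  obtain j b' where b: "b = [:0, 1:] ^ j * b'" "poly b' 0 \<noteq> 0" using dec ab(2) by blast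
  let ?u = "Fraction_Field.Fract a' b'"
  have qpow: "qh ^ n = Fraction_Field.Fract ([:0, 1:] ^ n) 1" for n
    by (induction n) (simp_all add: qh_def One_fract_def)
  have "Fraction_Field.Fract a b * qh ^ j = qh ^ i * ?u"
    using ab(2) a b by (auto simp: qpow eq_fract)
  then have "x = qh powi (int i - int j) * ?u"
    using ab(1) qh_nonzero[where 'f='f]
    by (simp add: power_int_diff field_simps)
  then show thesis using that[of "int i - int j" ?u] a(2) b(2)
    by (simp add: Fract_in_A0 A0_res_Fract)
qed

text \<open>A positive power of \<open>q\<^sup>1\<^sup>/\<^sup>2\<close> has residue 0, while 1 has residue 1. This separates weights later.\<close>

lemma qh_powi_eq_1: assumes "qh powi n = (1 :: 'f::field_char_0 rq)" shows "n = 0"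
proof -
  have *: "m = 0" if "qh ^ m = (1 :: 'f rq)" for m
  proof (rule ccontr)
    assume "m \<noteq> 0"
    then have "A0_res (qh ^ m) = (0 :: 'f)" by simp
    with that show False by simp
  qed
  show ?thesis
  proof (cases "n \<ge> 0")
    case True then show ?thesis using *[of "nat n"] assms by (simp add: power_int_def)
  next
    case False then show ?thesis using *[of "nat (- n)"] assms
      by (simp add: power_int_def power_inverse)
  qed
qed

lemma qq_nonzero: "qq \<noteq> (0 :: 'f::field_char_0 rq)"
  using qh_nonzero[where 'f='f] by (simp add: qq_def)

lemma qq_powi_inj: "qq powi m = (qq powi n :: 'f::field_char_0 rq) \<longleftrightarrow> m = n"
proof
  assume "qq powi m = (qq powi n :: 'f rq)"
  then have "qq powi (m - n) = (1 :: 'f rq)" using qq_nonzero[where 'f='f]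
    by (simp add: power_int_diff)
  moreover have "qq powi (m - n) = (qh powi (2 * (m - n)) :: 'f rq)"
    unfolding qq_def power_int_mult by simp
  ultimately show "m = n" using qh_powi_eq_1[of "2 * (m - n)", where 'f='f] by simp
qed simp

lemma qq_diff_nonzero: "qq - inverse qq \<noteq> (0 :: 'f::field_char_0 rq)"
proof
  assume "qq - inverse qq = (0 :: 'f rq)"
  then have "qq powi 1 = (qq powi (-1) :: 'f rq)" by simp
  then show False unfolding qq_powi_inj by simp
qed

lemma A0_qq: "qq \<in> A0" "A0_res qq = 0"
  by (simp_all add: qq_def)

text \<open>Only the Taylor coefficient of index 1 survives at \<open>q\<^sup>1\<^sup>/\<^sup>2 = 0\<close>, which makes the limit of \<open>\<Omega>\<^sub>\<psi>\<close> a
two-term rule.\<close>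

lemma A0_gcoef: "gcoef r \<in> A0" "A0_res (gcoef r :: 'f::field_char_0 rq) = (if r = 1 then - 1 else 0)"
  by (auto simp: gcoef_def A0_qq power_0_left)

abbreviation keys where "keys \<equiv> Poly_Mapping.keys"
abbreviation lookup where "lookup \<equiv> Poly_Mapping.lookup"
abbreviation single where "single \<equiv> Poly_Mapping.single"

section \<open>Modules over a quotient of a free algebra\<close>

definition free_act :: "('k \<Rightarrow> 'b \<Rightarrow> 'b) \<Rightarrow> ('g \<Rightarrow> 'b \<Rightarrow> 'b) \<Rightarrow> ('g, 'k::comm_ring_1) free_alg \<Rightarrow>
    'b \<Rightarrow> 'b::ab_group_add" where
  "free_act s T p y = (\<Sum>w\<in>keys p. s (lookup p w) (foldr T (letters w) y))"

text \<open>A module over a free algebra is a family of linear operators. The carrier \<open>S\<close> may be a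
proper subset of the type, since the sequences used for \<open>\<Omega>\<^sub>\<psi>\<close> have to be bounded below.\<close>

locale free_action =
  fixes S :: "'b::ab_group_add set" and s :: "'k::comm_ring_1 \<Rightarrow> 'b \<Rightarrow> 'b" and T :: "'g \<Rightarrow> 'b \<Rightarrow> 'b"
  assumes S_zero: "0 \<in> S" and S_add: "x \<in> S \<Longrightarrow> y \<in> S \<Longrightarrow> x + y \<in> S"
    and s_closed: "x \<in> S \<Longrightarrow> s c x \<in> S" and T_closed: "x \<in> S \<Longrightarrow> T g x \<in> S"
    and s_left: "x \<in> S \<Longrightarrow> s (c + d) x = s c x + s d x"
    and s_right: "x \<in> S \<Longrightarrow> y \<in> S \<Longrightarrow> s c (x + y) = s c x + s c y"
    and s_mult: "x \<in> S \<Longrightarrow> s (c * d) x = s c (s d x)"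
    and s_one: "x \<in> S \<Longrightarrow> s 1 x = x"
    and T_add: "x \<in> S \<Longrightarrow> y \<in> S \<Longrightarrow> T g (x + y) = T g x + T g y"
    and T_s: "x \<in> S \<Longrightarrow> T g (s c x) = s c (T g x)"
begin

abbreviation act where "act \<equiv> free_act s T"

lemma s_zero_left: "x \<in> S \<Longrightarrow> s 0 x = 0"
  using s_left[of x 0 0] by simp

lemma s_zero_right: "s c 0 = 0"
  using s_right[OF S_zero S_zero, of c] by simp

lemma T_zero: "T g 0 = 0"
  using T_add[OF S_zero S_zero, of g] by simp

lemma foldr_closed: "y \<in> S \<Longrightarrow> foldr T w y \<in> S"
  by (induction w) (auto intro: T_closed)

lemma foldr_add: "x \<in> S \<Longrightarrow> y \<in> S \<Longrightarrow> foldr T w (x + y) = foldr T w x + foldr T w y"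
  by (induction w) (auto simp: T_add foldr_closed)

lemma foldr_s: "x \<in> S \<Longrightarrow> foldr T w (s c x) = s c (foldr T w x)"
  by (induction w) (auto simp: T_s foldr_closed)

lemma S_sum: "(\<And>i. i \<in> A \<Longrightarrow> f i \<in> S) \<Longrightarrow> sum f A \<in> S"
  by (induction A rule: infinite_finite_induct) (auto intro: S_zero S_add)

lemma act_closed: "y \<in> S \<Longrightarrow> act p y \<in> S"
  unfolding free_act_def by (intro S_sum s_closed foldr_closed)

lemma act_superset:
  assumes "y \<in> S" "finite W" "keys p \<subseteq> W"
  shows "act p y = (\<Sum>w\<in>W. s (lookup p w) (foldr T (letters w) y))"
  unfolding free_act_def using assms
  by (intro sum.mono_neutral_left) (auto simp: in_keys_iff s_zero_left foldr_closed)

lemma act_single: "y \<in> S \<Longrightarrow> act (single w c) y = s c (foldr T (letters w) y)"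
  by (subst act_superset[of y "{w}"]) auto

lemma act_zero: "act 0 y = 0"
  by (simp add: free_act_def)

lemma act_add: "y \<in> S \<Longrightarrow> act (p + r) y = act p y + act r y"
  by (subst (1 2 3) act_superset[of y "keys p \<union> keys r"])
     (use Poly_Mapping.keys_add[of p r] in
       \<open>auto simp: lookup_add s_left foldr_closed sum.distrib\<close>)

lemma act_uminus: "y \<in> S \<Longrightarrow> act (- p) y = - act p y"
  using act_add[of y "- p" p] by (simp add: act_zero eq_neg_iff_add_eq_0)

lemma act_diff: "y \<in> S \<Longrightarrow> act (p - r) y = act p y - act r y"
  using act_add[of y p "- r"] by (simp add: act_uminus)

lemma act_right_zero: "act p 0 = 0"
proof (induction p rule: free_alg_induct)
  case (2 w c)
  have "foldr T l 0 = 0" for l by (induction l) (auto simp: T_zero)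
  then show ?case by (simp add: act_single S_zero s_zero_right)
qed (simp_all add: act_zero act_add S_zero)

lemma act_right_add: "x \<in> S \<Longrightarrow> y \<in> S \<Longrightarrow> act p (x + y) = act p x + act p y"
  by (induction p rule: free_alg_induct)
     (simp_all add: act_zero act_single act_add S_add foldr_add s_right foldr_closed)

lemma act_right_s: "x \<in> S \<Longrightarrow> act p (s c x) = s c (act p x)"
  by (induction p rule: free_alg_induct)
     (simp_all add: act_zero act_single act_add s_closed foldr_s foldr_closed s_zero_right s_right
        act_closed flip: s_mult, simp add: mult.commute)

lemma act_mult: "y \<in> S \<Longrightarrow> act (p * r) y = act p (act r y)"
proof (induction p rule: free_alg_induct)
  case 1 then show ?case by (simp add: act_zero)
next
  case (2 w c)
  show ?case using 2
  proof (induction r rule: free_alg_induct)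
    case 1 then show ?case by (simp add: act_zero act_right_zero)
  next
    case (2 v d)
    then show ?case
      by (simp add: mult_single act_single plus_fword_def s_mult s_closed foldr_closed foldr_s)
  next
    case (3 a b) then show ?case
      by (simp add: distrib_left act_add act_closed act_right_add)
  qed
next
  case (3 a b) then show ?case by (simp add: distrib_right act_add act_closed)
qed

lemma act_fgen: "y \<in> S \<Longrightarrow> act (fgen g) y = T g y"
  by (simp add: fgen_def act_single s_one T_closed)

lemma act_fconst: "y \<in> S \<Longrightarrow> act (fconst c) y = s c y"
  by (simp add: fconst_def act_single zero_fword_def)

lemma act_one: "y \<in> S \<Longrightarrow> act 1 y = y"
  using act_fconst[of y 1] by (simp add: fconst_def s_one)

lemma act_ideal:
  assumes "\<And>r y. r \<in> R \<Longrightarrow> y \<in> S \<Longrightarrow> act r y = 0" "p \<in> two_sided_ideal R" "y \<in> S"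
  shows "act p y = 0"
  using assms(2)
  by induction (simp_all add: assms act_mult act_add act_zero act_closed act_right_zero)

end

section \<open>The algebra \<open>\<N>\<close>\<close>

lemma fconst_central: "fconst c * p = p * fconst c"
  by (induction p rule: free_alg_induct)
     (simp_all add: distrib_left distrib_right fconst_def mult_single mult.commute)

definition scl :: "'f::field_char_0 rq \<Rightarrow> 'f nm \<Rightarrow> 'f nm" (infixr \<open>*\<^sub>N\<close> 75) where
  "c *\<^sub>N a = nm_const c * a"

lemma nm_const_hom:
  "nm_const (c + d) = nm_const c + nm_const d"
  "nm_const (c * d) = nm_const c * nm_const d"
  "nm_const 1 = 1"
  by (simp_all add: nm_const_def plus_nm.abs_eq times_nm.abs_eq one_nm_def fconst_def single_add mult_single)

lemma nm_const_central: "nm_const c * b = b * nm_const c"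
  by (induction b rule: nm.abs_induct) (simp add: nm_const_def times_nm.abs_eq fconst_central)

interpretation N: vector_space scl
  by standard (simp_all add: scl_def nm_const_hom algebra_simps)

lemma scl_mult [simp]: "(c *\<^sub>N a) * b = c *\<^sub>N (a * b)" "a * (c *\<^sub>N b) = c *\<^sub>N (a * b)"
  by (simp_all add: scl_def mult.assoc, metis mult.assoc nm_const_central)

definition mon :: "int list \<Rightarrow> 'f::field_char_0 nm" where
  "mon ns = prod_list (map nm_gen ns)"

lemma mon_simps [simp]: "mon [] = 1" "mon (n # ns) = nm_gen n * mon ns" "mon (ns @ ms) = mon ns * mon ms"
  by (simp_all add: mon_def)

lemma abs_nm_single: "abs_nm (single w c) = c *\<^sub>N mon (letters w)"
proof -
  have "abs_nm (single (FWord ns) 1) = (mon ns :: 'a nm)" for ns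
  proof (induction ns)
    case Nil show ?case by (simp add: one_nm_def flip: zero_fword_def)
  next
    case (Cons n ns)
    have "single (FWord (n # ns)) 1 = (fgen n * single (FWord ns) 1 :: 'a nfree)"
      by (simp add: fgen_def mult_single plus_fword_def)
    then show ?case using Cons by (simp add: nm_gen_def flip: times_nm.abs_eq)
  qed
  from this[of "letters w"]
  have "abs_nm (single w 1) = (mon (letters w) :: 'a nm)" by simp
  moreover have "single w c = fconst c * single w 1"
    by (simp add: fconst_def mult_single)
  ultimately show ?thesis by (simp add: scl_def nm_const_def flip: times_nm.abs_eq)
qed

lemma nm_span_induct [case_names zero mon add]:
  assumes "P 0" "\<And>c ns. P (c *\<^sub>N mon ns)" "\<And>a b. P a \<Longrightarrow> P b \<Longrightarrow> P (a + b)"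
  shows "P (a :: 'f::field_char_0 nm)"
proof (induction a rule: nm.abs_induct)
  case (1 p)
  show ?case
    by (induction p rule: free_alg_induct)
       (use assms in \<open>simp_all add: abs_nm_single flip: zero_nm_def plus_nm.abs_eq\<close>)
qed

lemma nm_induct [case_names one gen scl add]:
  assumes one: "P 1" and gen: "\<And>m a. P a \<Longrightarrow> P (nm_gen m * a)"
    and scl: "\<And>c a. P a \<Longrightarrow> P (c *\<^sub>N a)" and add: "\<And>a b. P a \<Longrightarrow> P b \<Longrightarrow> P (a + b)"
  shows "P (a :: 'f::field_char_0 nm)"
proof (induction a rule: nm_span_induct)
  case zero show ?case using scl[OF one, of 0] by simp
next
  case (mon c ns)
  have "P (mon ns)" by (induction ns) (simp_all add: one gen)
  then show ?case by (rule scl)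
qed (rule add)

definition lin :: "('f::field_char_0 nm \<Rightarrow> 'f nm) \<Rightarrow> bool" where
  "lin f \<longleftrightarrow> (\<forall>a b. f (a + b) = f a + f b) \<and> (\<forall>c a. f (c *\<^sub>N a) = c *\<^sub>N f a)"

lemma linI: "(\<And>a b. f (a + b) = f a + f b) \<Longrightarrow> (\<And>c a. f (c *\<^sub>N a) = c *\<^sub>N f a) \<Longrightarrow> lin f"
  by (simp add: lin_def)

lemma lin_add: "lin f \<Longrightarrow> f (a + b) = f a + f b" by (simp add: lin_def)
lemma lin_scl: "lin f \<Longrightarrow> f (c *\<^sub>N a) = c *\<^sub>N f a" by (simp add: lin_def)
lemma lin_zero: "lin f \<Longrightarrow> f 0 = 0" using lin_add[of f 0 0] by simp
lemma lin_uminus: "lin f \<Longrightarrow> f (- a) = - f a" using lin_add[of f "- a" a]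
  by (simp add: lin_zero eq_neg_iff_add_eq_0)
lemma lin_diff: "lin f \<Longrightarrow> f (a - b) = f a - f b" using lin_add[of f a "- b"]
  by (simp add: lin_uminus)
lemma lin_sum: "lin f \<Longrightarrow> f (sum g A) = (\<Sum>x\<in>A. f (g x))"
  by (induction A rule: infinite_finite_induct) (simp_all add: lin_zero lin_add)

lemmas lin_rules = lin_add lin_scl lin_zero lin_uminus lin_diff lin_sum

lemma nm_rel: "nm_gen l * (nm_gen (k + 1) * a) - qq ^ 2 *\<^sub>N (nm_gen (k + 1) * (nm_gen l * a))
    - (qq ^ 2 *\<^sub>N (nm_gen (l + 1) * (nm_gen k * a)) - nm_gen k * (nm_gen (l + 1) * a)) = (0 :: 'f::field_char_0 nm)"
proof -
  let ?r = "(fgen l * fgen (k + 1) - fconst (qq ^ 2) * fgen (k + 1) * fgen l)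
    - (fconst (qq ^ 2) * fgen (l + 1) * fgen k - fgen k * fgen (l + 1)) :: 'f nfree"
  have "?r \<in> two_sided_ideal nm_rels"
    using two_sided_ideal.gen[OF nm_rels.intros, of 1 l k 1] by simp
  then have "abs_nm ?r = 0" by (simp add: zero_nm_def nm.abs_eq_iff)
  then have "(nm_gen l * nm_gen (k + 1) - qq ^ 2 *\<^sub>N (nm_gen (k + 1) * nm_gen l))
    - (qq ^ 2 *\<^sub>N (nm_gen (l + 1) * nm_gen k) - nm_gen k * nm_gen (l + 1)) = (0 :: 'f nm)"
    by (simp add: nm_gen_def scl_def nm_const_def mult.assoc flip: times_nm.abs_eq minus_nm.abs_eq)
  from arg_cong[OF this, of "\<lambda>r. r * a"] show ?thesis by (simp add: algebra_simps)
qed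

text \<open>The universal property of \<open>\<N>\<close> as a recursion principle: if the operators \<open>T m\<close> satisfy the
relations of the \<open>x\<^sup>-\<^sub>m\<close>, then \<open>\<N>\<close> acts, and the orbit map of \<open>y0\<close> satisfies the recursion.\<close>

lemma nm_recursor:
  fixes s :: "'f::field_char_0 rq \<Rightarrow> 'b::ab_group_add \<Rightarrow> 'b"
  assumes act: "free_action S s T" and y0: "y0 \<in> S"
    and rel: "\<And>y l k. y \<in> S \<Longrightarrow> T l (T (k + 1) y) - s (qq ^ 2) (T (k + 1) (T l y))
      - (s (qq ^ 2) (T (l + 1) (T k y)) - T k (T (l + 1) y)) = 0"
  obtains f where "\<And>a. f a \<in> S" "\<And>a b. f (a + b) = f a + f b" "\<And>c a. f (c *\<^sub>N a) = s c (f a)"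
    "f 1 = y0" "\<And>m a. f (nm_gen m * a) = T m (f a)"
proof -
  interpret free_action S s T by (rule act)
  define f where "f a = act (rep_nm a) y0" for a
  have ideal: "act p y0 = 0" if "p \<in> two_sided_ideal nm_rels" for p
    by (rule act_ideal[OF _ that y0])
       (auto elim!: nm_rels.cases simp: act_diff act_mult act_fgen act_fconst T_closed s_closed rel)
  have f: "f (abs_nm p) = act p y0" for p
  proof -
    have "rep_nm (abs_nm p) - p \<in> two_sided_ideal nm_rels"
      using Quotient3_rep_abs[OF Quotient3_nm, of p]
      by (simp add: two_sided_ideal.zero)
    from ideal[OF this] show ?thesis by (simp add: act_diff y0 f_def)
  qed
  have 1: "f (a + b) = f a + f b" for a b
    by (induction a rule: nm.abs_induct, induction b rule: nm.abs_induct)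
       (simp add: f act_add y0 plus_nm.abs_eq)
  have 2: "f (c *\<^sub>N a) = s c (f a)" for c a
    by (induction a rule: nm.abs_induct)
       (simp add: f act_mult act_fconst act_closed y0 scl_def nm_const_def times_nm.abs_eq)
  have 3: "f (nm_gen m * a) = T m (f a)" for m a
    by (induction a rule: nm.abs_induct)
       (simp add: f act_mult act_fgen act_closed y0 nm_gen_def times_nm.abs_eq)
  have 4: "f 1 = y0" by (simp add: one_nm_def f act_one y0)
  show thesis using that[of f] 1 2 3 4 act_closed[OF y0] by (simp add: f_def)
qed

text \<open>The constant term exists because the relations are homogeneous of degree 2.\<close>

lemma nm_augmentation:
  obtains \<epsilon> :: "'f::field_char_0 nm \<Rightarrow> 'f rq" where
    "\<And>a b. \<epsilon> (a + b) = \<epsilon> a + \<epsilon> b" "\<And>c a. \<epsilon> (c *\<^sub>N a) = c * \<epsilon> a" "\<epsilon> 1 = 1"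
    "\<And>m a. \<epsilon> (nm_gen m * a) = 0"
proof -
  have fa: "free_action UNIV (*) (\<lambda>m (_ :: 'f rq). 0)"
    by standard (simp_all add: algebra_simps)
  show thesis
    by (rule nm_recursor[OF fa, of 1]) (simp_all, rule that)
qed

section \<open>The operators \<open>\<Omega>\<^sub>\<psi>\<close>\<close>

definition Om_seq :: "(int \<Rightarrow> 'f::field_char_0 nm) \<Rightarrow> bool" where
  "Om_seq h \<longleftrightarrow> (\<exists>B. \<forall>k<B. h k = 0)"

text \<open>The action of \<open>x\<^sup>-\<^sub>m\<close> on pairs \<open>(a, h)\<close> with \<open>h k\<close> in the role of \<open>\<Omega>\<^sub>\<psi>(k) a\<close>, as dictated by the
recursion for \<open>\<Omega>\<^sub>\<psi>\<close>.\<close>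

definition Om_step :: "int \<Rightarrow> 'f::field_char_0 nm \<times> (int \<Rightarrow> 'f nm) \<Rightarrow> 'f nm \<times> (int \<Rightarrow> 'f nm)" where
  "Om_step m = (\<lambda>(a, h). (nm_gen m * a, \<lambda>k. (if k = - m then a else 0) +
     Sum_any (\<lambda>r::nat. nm_const (gcoef r) * nm_gen (m + int r) * h (k - int r))))"

lemma Om_sum:
  assumes "\<forall>k<B. h k = 0" "k < B + int n"
  shows "Sum_any (\<lambda>r::nat. nm_const (gcoef r) * nm_gen (m + int r) * h (k - int r))
    = (\<Sum>r<n. gcoef r *\<^sub>N (nm_gen (m + int r) * h (k - int r)))"
proof -
  have "Sum_any (\<lambda>r::nat. nm_const (gcoef r) * nm_gen (m + int r) * h (k - int r))
    = (\<Sum>r<n. nm_const (gcoef r) * nm_gen (m + int r) * h (k - int r))"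
  proof (rule Sum_any.expand_superset)
    show "{r. nm_const (gcoef r) * nm_gen (m + int r) * h (k - int r) \<noteq> 0} \<subseteq> {..<n}"
    proof (clarsimp)
      fix r assume "nm_const (gcoef r) * nm_gen (m + int r) * h (k - int r) \<noteq> 0"
      then have "h (k - int r) \<noteq> 0" by auto
      then have "\<not> k - int r < B" using assms(1) by blast
      then show "r < n" using assms(2) by linarith
    qed
  qed simp
  then show ?thesis by (simp add: scl_def mult.assoc)
qed

text \<open>Multiplying \<open>(q\<^sup>-\<^sup>2 t - 1) / (t - q\<^sup>-\<^sup>2)\<close> by its denominator and comparing coefficients; \<open>j\<close> runs over all
integers so that the boundary terms are covered.\<close>

lemma gcoef_rec:
  "(if j + 1 \<ge> 0 then gcoef (nat (j + 1)) else 0) - qq ^ 2 * (if j \<ge> 0 then gcoef (nat j) else 0)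
    = (if j = - 1 then qq ^ 2 else if j = 0 then - 1 else 0 :: 'f::field_char_0 rq)"
proof (cases "j \<ge> 1")
  case True
  define i where "i = nat (j - 1)"
  have "j = int i + 1" using True by (simp add: i_def)
  then show ?thesis by (simp add: gcoef_def nat_add_distrib power2_eq_square)
next
  case False
  then consider "j = 0" | "j = - 1" | "j < - 1" by linarith
  then show ?thesis by cases (simp_all add: gcoef_def algebra_simps flip: power_add)
qed

text \<open>Two steps give a diagonal term, a term with one Taylor coefficient and a double sum. Only the
double sum involves \<open>h\<close>.\<close>

lemma Om_step_rel_aux:
  assumes h: "\<forall>j<B. h j = 0" and B: "B \<le> - m" and n: "k < B + int n"
  shows "snd (Om_step m' (Om_step m (a, h))) k
    = (if k = - m' then nm_gen m * a else 0)
      + (if k + m \<ge> 0 then gcoef (nat (k + m)) else 0) *\<^sub>N (nm_gen (m' + m + k) * a)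
      + (\<Sum>r<n. \<Sum>s<n. (gcoef r * gcoef s) *\<^sub>N
           (nm_gen (m' + int r) * (nm_gen (m + int s) * h (k - int r - int s))))"
proof -
  define h' where "h' = snd (Om_step m (a, h))"
  have h': "h' j = (if j = - m then a else 0) + (\<Sum>s<n. gcoef s *\<^sub>N (nm_gen (m + int s) * h (j - int s)))"
    if "j \<le> k" for j
    using Om_sum[OF h, of j n m] that n by (simp add: h'_def Om_step_def)
  have h'0: "\<forall>j<B. h' j = 0"
  proof (intro allI impI)
    fix j assume "j < B"
    then show "h' j = 0" using Om_sum[OF h, of j 0 m] B by (simp add: h'_def Om_step_def)
  qed
  have "snd (Om_step m' (Om_step m (a, h))) k = (if k = - m' then nm_gen m * a else 0)
      + (\<Sum>r<n. gcoef r *\<^sub>N (nm_gen (m' + int r) * h' (k - int r)))"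
    using Om_sum[OF h'0 n, of m'] by (simp add: Om_step_def h'_def)
  also have "(\<Sum>r<n. gcoef r *\<^sub>N (nm_gen (m' + int r) * h' (k - int r)))
     = (\<Sum>r<n. gcoef r *\<^sub>N (nm_gen (m' + int r) * (if k - int r = - m then a else 0)))
      + (\<Sum>r<n. \<Sum>s<n. (gcoef r * gcoef s) *\<^sub>N
           (nm_gen (m' + int r) * (nm_gen (m + int s) * h (k - int r - int s))))"
    by (simp add: h' distrib_left N.scale_right_distrib sum.distrib sum_distrib_left N.scale_sum_right)
  also have "(\<Sum>r<n. gcoef r *\<^sub>N (nm_gen (m' + int r) * (if k - int r = - m then a else 0)))
     = (\<Sum>r<n. if r = nat (k + m) then (if k + m \<ge> 0 then gcoef (nat (k + m)) else 0) *\<^sub>N (nm_gen (m' + m + k) * a) else 0)"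
    by (intro sum.cong) (auto simp: algebra_simps)
  also have "\<dots> = (if k + m \<ge> 0 then gcoef (nat (k + m)) else 0) *\<^sub>N (nm_gen (m' + m + k) * a)"
  proof -
    have "nat (k + m) < n \<or> k + m < 0" using B n by linarith
    then show ?thesis by auto
  qed
  finally show ?thesis by simp
qed

text \<open>In the relation for two steps the double sums combine termwise to relations of \<open>\<N>\<close> with shifted
indices, and the remaining terms, all multiples of the same generator, cancel by \<open>gcoef_rec\<close>.\<close>

lemma Om_step_rel:
  assumes "Om_seq h"
  shows "snd (Om_step l (Om_step (i + 1) (a, h))) k - qq ^ 2 *\<^sub>N snd (Om_step (i + 1) (Om_step l (a, h))) k
      - (qq ^ 2 *\<^sub>N snd (Om_step (l + 1) (Om_step i (a, h))) k - snd (Om_step i (Om_step (l + 1) (a, h))) k) = 0"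
proof -
  obtain B0 where B0: "\<forall>k<B0. h k = 0" using assms by (auto simp: Om_seq_def)
  define B where "B = min B0 (min (- l - 1) (- i - 1))"
  have B: "\<forall>j<B. h j = 0" "B \<le> - l" "B \<le> - i" "B \<le> - (l + 1)" "B \<le> - (i + 1)"
    using B0 by (auto simp: B_def)
  (* Beyond n all entries of the sequence at k - r vanish, so every sum may be cut off there. *)
  define n where "n = nat (k - B + 1)"
  have n: "k < B + int n" by (simp add: n_def)
  define D where "D = (\<lambda>m' m. \<Sum>r<n. \<Sum>s<n. (gcoef r * gcoef s) *\<^sub>N
           (nm_gen (m' + int r) * (nm_gen (m + int s) * h (k - int r - int s))))"
  (* The second and fourth products have their factors in the opposite order; exchanging the summation indices aligns them. *)
  have D_swap: "D m' m = (\<Sum>r<n. \<Sum>s<n. (gcoef r * gcoef s) *\<^sub>N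
           (nm_gen (m' + int s) * (nm_gen (m + int r) * h (k - int r - int s))))" for m' m
    unfolding D_def by (subst sum.swap) (simp add: algebra_simps)
  have "D l (i + 1) - qq ^ 2 *\<^sub>N D (i + 1) l - (qq ^ 2 *\<^sub>N D (l + 1) i - D i (l + 1))
    = (\<Sum>r<n. \<Sum>s<n. (gcoef r * gcoef s) *\<^sub>N
        (nm_gen (l + int r) * (nm_gen ((i + int s) + 1) * h (k - int r - int s))
         - qq ^ 2 *\<^sub>N (nm_gen ((i + int s) + 1) * (nm_gen (l + int r) * h (k - int r - int s)))
         - (qq ^ 2 *\<^sub>N (nm_gen ((l + int r) + 1) * (nm_gen (i + int s) * h (k - int r - int s)))
            - nm_gen (i + int s) * (nm_gen ((l + int r) + 1) * h (k - int r - int s)))))"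
    unfolding D_swap[of "i + 1" l] D_swap[of i "l + 1"]
    unfolding D_def
    by (simp add: N.scale_right_diff_distrib sum_subtractf N.scale_sum_right mult_ac add_ac)
  also have "\<dots> = 0" by (simp only: nm_rel N.scale_zero_right sum.neutral_const)
  finally have D: "D l (i + 1) - qq ^ 2 *\<^sub>N D (i + 1) l - (qq ^ 2 *\<^sub>N D (l + 1) i - D i (l + 1)) = 0" .
  define G where "G = (\<lambda>j. if j \<ge> 0 then gcoef (nat j) else 0 :: 'a rq)"
  have step: "snd (Om_step m' (Om_step m (a, h))) k = (if k = - m' then nm_gen m * a else 0)
      + G (k + m) *\<^sub>N (nm_gen (m' + m + k) * a) + D m' m" if "B \<le> - m" for m' m
    unfolding D_def G_def by (rule Om_step_rel_aux[OF B(1) that n])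
  let ?y = "nm_gen (l + i + 1 + k) * a"
  have G: "G (j + 1) - qq ^ 2 * G j = (if j = - 1 then qq ^ 2 else if j = 0 then - 1 else 0)" for j
    unfolding G_def by (rule gcoef_rec)
  have "((if k = - l then nm_gen (i + 1) * a else 0) - qq ^ 2 *\<^sub>N (if k = - (i + 1) then nm_gen l * a else 0)
      - (qq ^ 2 *\<^sub>N (if k = - (l + 1) then nm_gen i * a else 0) - (if k = - i then nm_gen (l + 1) * a else 0)))
      = ((if k = - l then 1 else 0) - qq ^ 2 * (if k = - (i + 1) then 1 else 0)
        - (qq ^ 2 * (if k = - (l + 1) then 1 else 0) - (if k = - i then 1 else 0))) *\<^sub>N ?y"
  proof -
    have d: "(if k = - l then nm_gen (i + 1) * a else 0) = (if k = - l then 1 else 0) *\<^sub>N ?y"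
      "(if k = - (i + 1) then nm_gen l * a else 0) = (if k = - (i + 1) then 1 else 0) *\<^sub>N ?y"
      "(if k = - (l + 1) then nm_gen i * a else 0) = (if k = - (l + 1) then 1 else 0) *\<^sub>N ?y"
      "(if k = - i then nm_gen (l + 1) * a else 0) = (if k = - i then 1 else 0) *\<^sub>N ?y"
      by auto
    show ?thesis unfolding d by (simp only: N.scale_left_diff_distrib N.scale_scale)
  qed
  moreover have "(G (k + (i + 1)) - qq ^ 2 * G (k + l) - (qq ^ 2 * G (k + i) - G (k + (l + 1))))
      = - ((if k = - l then 1 else 0) - qq ^ 2 * (if k = - (i + 1) then 1 else 0)
        - (qq ^ 2 * (if k = - (l + 1) then 1 else 0) - (if k = - i then 1 else 0)))"
  proof -
    have "(G (k + (i + 1)) - qq ^ 2 * G (k + l) - (qq ^ 2 * G (k + i) - G (k + (l + 1))))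
       = (G ((k + i) + 1) - qq ^ 2 * G (k + i)) + (G ((k + l) + 1) - qq ^ 2 * G (k + l))"
      by (simp add: add_ac)
    also have "\<dots> = - ((if k = - l then 1 else 0) - qq ^ 2 * (if k = - (i + 1) then 1 else 0)
        - (qq ^ 2 * (if k = - (l + 1) then 1 else 0) - (if k = - i then 1 else 0)))"
      unfolding G by auto
    finally show ?thesis .
  qed
  ultimately have "((if k = - l then nm_gen (i + 1) * a else 0) - qq ^ 2 *\<^sub>N (if k = - (i + 1) then nm_gen l * a else 0)
      - (qq ^ 2 *\<^sub>N (if k = - (l + 1) then nm_gen i * a else 0) - (if k = - i then nm_gen (l + 1) * a else 0)))
     + (G (k + (i + 1)) - qq ^ 2 * G (k + l) - (qq ^ 2 * G (k + i) - G (k + (l + 1)))) *\<^sub>N ?y = 0"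
    by (simp only: N.scale_minus_left right_minus)
  moreover have "snd (Om_step l (Om_step (i + 1) (a, h))) k - qq ^ 2 *\<^sub>N snd (Om_step (i + 1) (Om_step l (a, h))) k
      - (qq ^ 2 *\<^sub>N snd (Om_step (l + 1) (Om_step i (a, h))) k - snd (Om_step i (Om_step (l + 1) (a, h))) k)
    = (((if k = - l then nm_gen (i + 1) * a else 0) - qq ^ 2 *\<^sub>N (if k = - (i + 1) then nm_gen l * a else 0)
      - (qq ^ 2 *\<^sub>N (if k = - (l + 1) then nm_gen i * a else 0) - (if k = - i then nm_gen (l + 1) * a else 0)))
     + (G (k + (i + 1)) - qq ^ 2 * G (k + l) - (qq ^ 2 * G (k + i) - G (k + (l + 1)))) *\<^sub>N ?y)
     + (D l (i + 1) - qq ^ 2 *\<^sub>N D (i + 1) l - (qq ^ 2 *\<^sub>N D (l + 1) i - D i (l + 1)))"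
  proof -
    have idx: "i + 1 + l + k = l + i + 1 + k" "l + 1 + i + k = l + i + 1 + k" "l + (i + 1) + k = l + i + 1 + k"
      "i + (l + 1) + k = l + i + 1 + k" by simp_all
    show ?thesis unfolding step[OF B(2)] step[OF B(3)] step[OF B(4)] step[OF B(5)] idx
      by (simp only: N.scale_left_diff_distrib N.scale_right_distrib N.scale_right_diff_distrib
          N.scale_scale) (simp only: algebra_simps)
  qed
  ultimately show ?thesis using D by simp
qed

lemma Om_seq_step: "Om_seq h \<Longrightarrow> Om_seq (snd (Om_step m (a, h)))"
proof -
  assume "Om_seq h"
  then obtain B where B: "\<forall>k<B. h k = 0" by (auto simp: Om_seq_def)
  then have B': "\<forall>k<min B (- m). h k = 0" by auto
  have "\<forall>k<min B (- m). snd (Om_step m (a, h)) k = 0"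
    using Om_sum[OF B', of _ 0 m] by (auto simp: Om_step_def)
  then show ?thesis unfolding Om_seq_def by (rule exI)
qed

lemma Om_step_linear:
  assumes "Om_seq h" "Om_seq h'"
  shows "Om_step m (a + b, h + h') = Om_step m (a, h) + Om_step m (b, h')"
    "Om_step m (c *\<^sub>N a, \<lambda>k. c *\<^sub>N h k) = (c *\<^sub>N fst (Om_step m (a, h)), \<lambda>k. c *\<^sub>N snd (Om_step m (a, h)) k)"
proof -
  obtain B1 where B1: "\<forall>k<B1. h k = 0" using assms(1) by (auto simp: Om_seq_def)
  obtain B2 where B2: "\<forall>k<B2. h' k = 0" using assms(2) by (auto simp: Om_seq_def)
  define B where "B = min B1 B2"
  have B: "\<forall>k<B. h k = 0" "\<forall>k<B. h' k = 0" "\<forall>k<B. (h + h') k = 0" "\<forall>k<B. c *\<^sub>N h k = 0"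
    using B1 B2 by (auto simp: B_def)
  have step: "Om_step m (a', g) = (nm_gen m * a', \<lambda>k. (if k = - m then a' else 0)
      + (\<Sum>r<nat (k - B + 1). gcoef r *\<^sub>N (nm_gen (m + int r) * g (k - int r))))"
    if "\<forall>k<B. g k = 0" for a' g
  proof -
    have "k < B + int (nat (k - B + 1))" for k by simp
    note Om_sum[OF that this]
    then show ?thesis by (simp only: Om_step_def split)
  qed
  show "Om_step m (a + b, h + h') = Om_step m (a, h) + Om_step m (b, h')"
    unfolding step[OF B(1)] step[OF B(2)] step[OF B(3)]
    by (simp add: fun_eq_iff distrib_left sum.distrib N.scale_right_distrib)
  show "Om_step m (c *\<^sub>N a, \<lambda>k. c *\<^sub>N h k) = (c *\<^sub>N fst (Om_step m (a, h)), \<lambda>k. c *\<^sub>N snd (Om_step m (a, h)) k)"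
    unfolding step[OF B(1)] step[OF B(4)]
    by (simp add: fun_eq_iff N.scale_right_distrib N.scale_sum_right mult.commute)
qed

lemma Omega_exists: "\<exists>Om :: int \<Rightarrow> 'f::field_char_0 nm \<Rightarrow> 'f nm. is_Omega_psi Om"
proof -
  define S :: "('f nm \<times> (int \<Rightarrow> 'f nm)) set" where "S = {y. Om_seq (snd y)}"
  define s :: "'f rq \<Rightarrow> 'f nm \<times> (int \<Rightarrow> 'f nm) \<Rightarrow> 'f nm \<times> (int \<Rightarrow> 'f nm)"
    where "s = (\<lambda>c (a, h). (c *\<^sub>N a, \<lambda>k. c *\<^sub>N h k))"
  have S: "y \<in> S \<longleftrightarrow> Om_seq (snd y)" for y by (simp add: S_def)
  have add: "Om_seq (g + h)" if gh: "Om_seq g" "Om_seq h" for g h :: "int \<Rightarrow> 'f nm"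
  proof -
    obtain B1 B2 where "\<forall>k<B1. g k = 0" "\<forall>k<B2. h k = 0" using gh by (auto simp: Om_seq_def)
    then have "\<forall>k<min B1 B2. (g + h) k = 0" by simp
    then show ?thesis unfolding Om_seq_def by blast
  qed
  have act: "free_action S s Om_step"
  proof
    fix m y assume "y \<in> S"
    then show "Om_step m y \<in> S" using Om_seq_step[of "snd y" m "fst y"] by (simp add: S)
  next
    fix m x y assume "x \<in> S" "y \<in> S"
    then show "Om_step m (x + y) = Om_step m x + Om_step m y"
      using Om_step_linear(1)[of "snd x" "snd y" m "fst x" "fst y"]
      by (cases x; cases y) (simp add: S)
  next
    fix m c x assume "x \<in> S"
    then show "Om_step m (s c x) = s c (Om_step m x)"
      using Om_step_linear(2)[of "snd x" "snd x" m c "fst x"]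
      by (cases x) (simp add: S s_def split_beta)
  qed (auto simp: S s_def add, auto simp: Om_seq_def fun_eq_iff N.scale_left_distrib N.scale_right_distrib)
  have rel: "Om_step l (Om_step (k + 1) y) - s (qq ^ 2) (Om_step (k + 1) (Om_step l y))
      - (s (qq ^ 2) (Om_step (l + 1) (Om_step k y)) - Om_step k (Om_step (l + 1) y)) = 0" if "y \<in> S" for y l k
  proof (rule prod_eqI)
    show "fst (Om_step l (Om_step (k + 1) y) - s (qq ^ 2) (Om_step (k + 1) (Om_step l y))
      - (s (qq ^ 2) (Om_step (l + 1) (Om_step k y)) - Om_step k (Om_step (l + 1) y))) = fst 0"
      by (simp add: Om_step_def s_def split_beta nm_rel)
    show "snd (Om_step l (Om_step (k + 1) y) - s (qq ^ 2) (Om_step (k + 1) (Om_step l y))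
      - (s (qq ^ 2) (Om_step (l + 1) (Om_step k y)) - Om_step k (Om_step (l + 1) y))) = snd 0"
      using Om_step_rel[of "snd y" l k "fst y"] that
      by (simp add: S fun_eq_iff s_def split_beta)
  qed
  have y0: "(1, \<lambda>_. 0) \<in> S" by (auto simp: S Om_seq_def)
  obtain f where f: "\<And>a. f a \<in> S" "\<And>a b. f (a + b) = f a + f b" "\<And>c a. f (c *\<^sub>N a) = s c (f a)"
    "f 1 = (1, \<lambda>_. 0)" "\<And>m a. f (nm_gen m * a) = Om_step m (f a)"
    using nm_recursor[OF act y0 rel] by blast
  have fst_f: "fst (f a) = a" for a
    by (induction a rule: nm_induct) (simp_all add: f s_def Om_step_def split_beta)
  define Om where "Om k a = snd (f a) k" for k a
  have fin: "finite {r::nat. Om (k - int r) a \<noteq> 0}" for k a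
  proof -
    obtain B where "\<forall>j<B. Om j a = 0" using f(1)[of a] by (auto simp: S Om_seq_def Om_def)
    then have "{r::nat. Om (k - int r) a \<noteq> 0} \<subseteq> {.. nat (k - B)}"
    proof clarsimp
      fix r assume "\<forall>j<B. Om j a = 0" "Om (k - int r) a \<noteq> 0"
      then have "\<not> k - int r < B" by blast
      then show "r \<le> nat (k - B)" by linarith
    qed
    then show ?thesis by (rule finite_subset) simp
  qed
  have gen: "Om k (nm_gen m * a) = (if k = - m then a else 0) +
        Sum_any (\<lambda>r::nat. nm_const (gcoef r) * nm_gen (m + int r) * Om (k - int r) a)" for k m a
    by (simp add: Om_def f Om_step_def split_beta fst_f)
  have "is_Omega_psi Om"
    unfolding is_Omega_psi_def
    by (intro conjI allI fin gen) (simp_all add: Om_def f s_def split_beta flip: scl_def)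
  then show ?thesis by blast
qed

text \<open>The recursion determines the operators on all monomials, and these span.\<close>

lemma is_Omega_psi_unique:
  assumes "is_Omega_psi Om" "is_Omega_psi (Om' :: int \<Rightarrow> 'f::field_char_0 nm \<Rightarrow> 'f nm)"
  shows "Om = Om'"
proof -
  have "\<forall>k. Om k a = Om' k a" for a
    using assms by (induction a rule: nm_induct) (simp_all add: is_Omega_psi_def scl_def)
  then show ?thesis by blast
qed

lemma is_Omega_psi_Omega_psi: "is_Omega_psi (Omega_psi :: int \<Rightarrow> 'f::field_char_0 nm \<Rightarrow> 'f nm)"
  unfolding Omega_psi_def using Omega_exists is_Omega_psi_unique by (metis the_equality)

lemma Omega_lin: "lin (Omega_psi k)"
  using is_Omega_psi_Omega_psi unfolding is_Omega_psi_def by (auto intro!: linI simp: scl_def)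

lemma Omega_one [simp]: "Omega_psi k 1 = 0"
  using is_Omega_psi_Omega_psi unfolding is_Omega_psi_def by blast

text \<open>The index set is a finite superset of the support that contains 0 and 1, so that the term of
index 1 can be singled out.\<close>

lemma Omega_gen:
  obtains A where "finite A" "{0, 1} \<subseteq> A" "Omega_psi k (nm_gen m * a) = (if k = - m then a else 0) +
     (\<Sum>r\<in>A. gcoef r *\<^sub>N (nm_gen (m + int r) * Omega_psi (k - int r) a))"
proof -
  let ?A = "{r::nat. Omega_psi (k - int r) a \<noteq> 0} \<union> {0, 1}"
  have "finite ?A" using is_Omega_psi_Omega_psi unfolding is_Omega_psi_def by blast
  moreover have "Omega_psi k (nm_gen m * a) = (if k = - m then a else 0) +
        Sum_any (\<lambda>r::nat. nm_const (gcoef r) * nm_gen (m + int r) * Omega_psi (k - int r) a)"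
    using is_Omega_psi_Omega_psi unfolding is_Omega_psi_def by blast
  moreover have "Sum_any (\<lambda>r::nat. nm_const (gcoef r) * nm_gen (m + int r) * Omega_psi (k - int r) a)
     = (\<Sum>r\<in>?A. nm_const (gcoef r) * nm_gen (m + int r) * Omega_psi (k - int r) a)"
  proof (rule Sum_any.expand_superset[OF \<open>finite ?A\<close>])
    show "{r. nm_const (gcoef r) * nm_gen (m + int r) * Omega_psi (k - int r) a \<noteq> 0} \<subseteq> ?A"
      by auto
  qed
  ultimately show thesis using that[of ?A] by (simp add: scl_def mult.assoc)
qed

section \<open>The crystal lattice of \<open>\<N>\<close>\<close>

text \<open>The span of \<^emph>\<open>all\<close> monomials: it is visibly stable under the \<open>x\<^sup>-\<^sub>m\<close> and \<open>\<Omega>\<^sub>\<psi>(k)\<close>. That ordered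
monomials suffice is shown in \<open>nlat_eq\<close>.\<close>

inductive_set nlat :: "'f::field_char_0 nm set" where
  zero: "0 \<in> nlat"
| mon: "c \<in> A0 \<Longrightarrow> c *\<^sub>N mon ns \<in> nlat"
| add: "a \<in> nlat \<Longrightarrow> b \<in> nlat \<Longrightarrow> a + b \<in> nlat"

lemma nlat_mon: "mon ns \<in> nlat"
  using nlat.mon[of 1 ns] by simp

lemma nlat_scl: "a \<in> nlat \<Longrightarrow> c \<in> A0 \<Longrightarrow> c *\<^sub>N a \<in> nlat"
  by (induction rule: nlat.induct) (auto intro: nlat.intros simp: N.scale_right_distrib)

lemma nlat_gen: "a \<in> nlat \<Longrightarrow> nm_gen m * a \<in> nlat"
proof (induction rule: nlat.induct)
  case (mon c ns) then show ?case using nlat.mon[of c "m # ns"] by simp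
qed (auto intro: nlat.intros simp: distrib_left)

lemma nlat_sum: "(\<And>i. i \<in> A \<Longrightarrow> f i \<in> nlat) \<Longrightarrow> sum f A \<in> nlat"
  by (induction A rule: infinite_finite_induct) (auto intro: nlat.intros)

lemma nlat_uminus: "a \<in> nlat \<Longrightarrow> - a \<in> nlat"
  using nlat_scl[of a "- 1"] by simp

lemma nlat_Omega: "(a :: 'f::field_char_0 nm) \<in> nlat \<Longrightarrow> Omega_psi k a \<in> nlat"
proof (induction arbitrary: k rule: nlat.induct)
  case zero show ?case by (simp add: lin_zero Omega_lin nlat.zero)
next
  case (mon c ns)
  have "Omega_psi k (mon ns :: 'f nm) \<in> nlat" for k
  proof (induction ns arbitrary: k)
    case Nil show ?case by (simp add: nlat.zero)
  next
    case (Cons n ns)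
    obtain A where A: "Omega_psi k (nm_gen n * mon ns :: 'f nm) = (if k = - n then mon ns else 0) +
     (\<Sum>r\<in>A. gcoef r *\<^sub>N (nm_gen (n + int r) * Omega_psi (k - int r) (mon ns)))"
      by (rule Omega_gen)
    have "(if k = - n then mon ns else 0 :: 'f nm) \<in> nlat" by (simp add: nlat.zero nlat_mon)
    then show ?case unfolding mon_simps(2) A
      by (intro nlat.add nlat_sum nlat_scl nlat_gen Cons A0_gcoef)
  qed
  then show ?case using mon by (simp add: lin_scl[OF Omega_lin] nlat_scl)
qed (auto intro: nlat.add simp: lin_add[OF Omega_lin])

definition qcong :: "'f::field_char_0 nm \<Rightarrow> 'f nm \<Rightarrow> bool" (infix \<open>\<approx>\<close> 50) where
  "a \<approx> b \<longleftrightarrow> (\<exists>y\<in>nlat. a - b = qh *\<^sub>N y)"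

lemma qcong_refl [simp]: "a \<approx> a"
  by (auto simp: qcong_def intro!: bexI[of _ 0] nlat.zero)

lemma qcong_sym: "a \<approx> b \<Longrightarrow> b \<approx> a"
  unfolding qcong_def by (metis N.scale_minus_right minus_diff_eq nlat_uminus)

lemma qcong_add: "a \<approx> b \<Longrightarrow> c \<approx> d \<Longrightarrow> a + c \<approx> b + d"
  unfolding qcong_def by (metis N.scale_right_distrib add_diff_add nlat.add)

lemma qcong_trans [trans]: "a \<approx> b \<Longrightarrow> b \<approx> c \<Longrightarrow> a \<approx> c"
  using qcong_add[of a b b c] by (simp add: qcong_def)

lemma qcong_scl: "a \<approx> b \<Longrightarrow> c \<in> A0 \<Longrightarrow> c *\<^sub>N a \<approx> c *\<^sub>N b"
  unfolding qcong_def
  by (metis N.scale_right_diff_distrib N.scale_left_commute nlat_scl)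

lemma qcong_uminus: "a \<approx> b \<Longrightarrow> - a \<approx> - b"
  using qcong_scl[of a b "- 1"] by simp

lemma qcong_gen: "a \<approx> b \<Longrightarrow> nm_gen m * a \<approx> nm_gen m * b"
  unfolding qcong_def by (metis right_diff_distrib scl_mult(2) nlat_gen)

lemma qcong_Omega: "a \<approx> b \<Longrightarrow> Omega_psi k a \<approx> Omega_psi k b"
  unfolding qcong_def by (metis lin_diff lin_scl Omega_lin nlat_Omega)

lemma qcong_0I: "a \<in> nlat \<Longrightarrow> c \<in> A0 \<Longrightarrow> A0_res c = 0 \<Longrightarrow> c *\<^sub>N a \<approx> 0"
proof -
  assume a: "a \<in> nlat" and "c \<in> A0" "A0_res c = 0"
  then obtain y where "y \<in> A0" "c = qh * y" by (auto elim: A0_res_eq_0)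
  then show ?thesis unfolding qcong_def using a by (intro bexI[of _ "y *\<^sub>N a"]) (simp_all add: nlat_scl)
qed

lemma qcong_sum_0: "(\<And>j. j \<in> A \<Longrightarrow> f j \<approx> 0) \<Longrightarrow> sum f A \<approx> 0"
proof (induction A rule: infinite_finite_induct)
  case (insert x F)
  then show ?case using qcong_add[of "f x" 0 "sum f F" 0] by simp
qed simp_all

lemma qcong_sum_single:
  assumes "finite A" "i \<in> A" "\<And>j. j \<in> A \<Longrightarrow> j \<noteq> i \<Longrightarrow> f j \<approx> 0"
  shows "sum f A \<approx> f i"
  using assms qcong_add[of "f i" "f i" "sum f (A - {i})" 0] qcong_sum_0[of "A - {i}" f]
  by (simp add: sum.remove)

text \<open>All Taylor coefficients but the one of index 1 lie in the maximal ideal, and that one is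
congruent to \<open>-1\<close>.\<close>

lemma Omega_gen_qcong:
  assumes "a \<in> nlat"
  shows "Omega_psi k (nm_gen m * a) \<approx> (if k = - m then a else 0) - nm_gen (m + 1) * Omega_psi (k - 1) a"
proof -
  obtain A where A: "finite A" "{0, 1} \<subseteq> A" "Omega_psi k (nm_gen m * a) = (if k = - m then a else 0) +
     (\<Sum>r\<in>A. gcoef r *\<^sub>N (nm_gen (m + int r) * Omega_psi (k - int r) a))"
    by (rule Omega_gen)
  have nl: "nm_gen (m + int r) * Omega_psi (k - int r) a \<in> nlat" for r
    using assms by (simp add: nlat_gen nlat_Omega)
  have "(\<Sum>r\<in>A. gcoef r *\<^sub>N (nm_gen (m + int r) * Omega_psi (k - int r) a))
     \<approx> gcoef 1 *\<^sub>N (nm_gen (m + int 1) * Omega_psi (k - int 1) a)"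
    using A(1,2) by (intro qcong_sum_single) (auto intro!: qcong_0I nl simp: A0_gcoef)
  moreover have "gcoef 1 *\<^sub>N (nm_gen (m + int 1) * Omega_psi (k - int 1) a)
    \<approx> - (nm_gen (m + 1) * Omega_psi (k - 1) a)"
  proof -
    have "(gcoef 1 + 1) *\<^sub>N (nm_gen (m + int 1) * Omega_psi (k - int 1) a) \<approx> 0"
      by (intro qcong_0I nl) (auto simp: A0_gcoef)
    then show ?thesis by (simp add: qcong_def N.scale_left_distrib)
  qed
  ultimately have "(\<Sum>r\<in>A. gcoef r *\<^sub>N (nm_gen (m + int r) * Omega_psi (k - int r) a))
     \<approx> - (nm_gen (m + 1) * Omega_psi (k - 1) a)" by (rule qcong_trans)
  from qcong_add[OF qcong_refl this] show ?thesis unfolding A(3) by simp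
qed

lemma of_nat_rq: "of_nat n = (rq_const (of_nat n) :: 'f::field_char_0 rq)"
  by (induction n) (simp_all add: rq_const_hom)

lemma of_nat_rq_nonzero: "n \<noteq> 0 \<Longrightarrow> of_nat n \<noteq> (0 :: 'f::field_char_0 rq)"
  by (metis of_nat_rq A0_rq_const(2) A0_0(2) of_nat_eq_0_iff)

lemma A0_of_int: "(of_int k :: 'f::field_char_0 rq) \<in> A0" "A0_res (of_int k :: 'f::field_char_0 rq) = of_int k"
  by (cases k rule: int_cases2; simp add: of_nat_rq)+

lemma gen_gen_swap:
  "nm_gen l * (nm_gen k * a) = qq ^ 2 *\<^sub>N (nm_gen k * (nm_gen l * a))
     + qq ^ 2 *\<^sub>N (nm_gen (l + 1) * (nm_gen (k - 1) * a)) - nm_gen (k - 1) * (nm_gen (l + 1) * a)"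
  using nm_rel[of l "k - 1" a] by (simp add: algebra_simps)

text \<open>For adjacent indices both sides of the relation contain the same two monomials, and the relation
is twice the assertion.\<close>

lemma gen_gen_swap_adjacent:
  "nm_gen l * (nm_gen (l + 1) * a) = qq ^ 2 *\<^sub>N (nm_gen (l + 1) * (nm_gen l * (a :: 'f::field_char_0 nm)))"
proof -
  let ?x = "nm_gen l * (nm_gen (l + 1) * a)" and ?y = "qq ^ 2 *\<^sub>N (nm_gen (l + 1) * (nm_gen l * a))"
  have "?x + ?x = ?y + ?y" using gen_gen_swap[of l "l + 1" a] by (simp add: algebra_simps)
  then have "2 *\<^sub>N ?x = 2 *\<^sub>N ?y" by (simp only: N.scale_left_distrib N.scale_one flip: one_add_one)
  then show ?thesis using of_nat_rq_nonzero[of 2, where 'f='f]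
    by (metis N.scale_left_imp_eq numeral_2_eq_2 of_nat_numeral nat.simps(3))
qed

text \<open>Two of the three terms in \<open>gen_gen_swap\<close> carry the factor \<open>q\<^sup>2\<close>.\<close>

lemma gen_gen_qcong:
  assumes "a \<in> nlat"
  shows "nm_gen l * (nm_gen k * a) \<approx> (if k = l + 1 then 0 else - (nm_gen (k - 1) * (nm_gen (l + 1) * a)))"
proof -
  have q: "qq ^ 2 *\<^sub>N y \<approx> 0" if "y \<in> nlat" for y :: "'a nm"
    using that by (intro qcong_0I) (auto simp: A0_qq)
  show ?thesis
  proof (cases "k = l + 1")
    case True
    then show ?thesis using q assms by (simp add: gen_gen_swap_adjacent nlat_gen)
  next
    case False
    have "qq ^ 2 *\<^sub>N (nm_gen k * (nm_gen l * a)) + qq ^ 2 *\<^sub>N (nm_gen (l + 1) * (nm_gen (k - 1) * a))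
      + - (nm_gen (k - 1) * (nm_gen (l + 1) * a)) \<approx> 0 + 0 + - (nm_gen (k - 1) * (nm_gen (l + 1) * a))"
      by (intro qcong_add q nlat_gen assms qcong_refl)
    then show ?thesis using False by (simp add: gen_gen_swap[of l k])
  qed
qed

section \<open>The crystal operators\<close>

abbreviation dec :: "int list \<Rightarrow> bool" where "dec \<equiv> sorted_wrt (\<ge>)"

definition neg_cons :: "int \<Rightarrow> (int \<times> int list) option \<Rightarrow> (int \<times> int list) option" where
  "neg_cons n = map_option (\<lambda>(s, w). (- s, n # w))"

text \<open>The action of \<open>x\<^sup>-\<^sub>m\<close> on ordered monomials modulo \<open>q\<^sup>1\<^sup>/\<^sup>2\<close>, as a sign and a monomial, or \<open>None\<close> for 0. The
new letter is moved to its place by \<open>x\<^sub>m x\<^sub>n = - x\<^sub>n\<^sub>-\<^sub>1 x\<^sub>m\<^sub>+\<^sub>1\<close>.\<close>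

fun x_cr :: "int \<Rightarrow> int list \<Rightarrow> (int \<times> int list) option" where
  "x_cr m [] = Some (1, [m])"
| "x_cr m (n # ns) = (if n \<le> m then Some (1, m # n # ns) else if n = m + 1 then None
     else neg_cons (n - 1) (x_cr (m + 1) ns))"

text \<open>The action of \<open>\<Omega>\<^sub>\<psi>(-m)\<close> on ordered monomials modulo \<open>q\<^sup>1\<^sup>/\<^sup>2\<close>; the parameter is \<open>m\<close>, not \<open>-m\<close>.\<close>

fun Om_cr :: "int \<Rightarrow> int list \<Rightarrow> (int \<times> int list) option" where
  "Om_cr m [] = None"
| "Om_cr m (n # ns) = (if n = m then Some (1, ns) else neg_cons (n + 1) (Om_cr (m + 1) ns))"

definition signed_mon :: "(int \<times> int list) option \<Rightarrow> 'f::field_char_0 nm" where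
  "signed_mon r = (case r of None \<Rightarrow> 0 | Some (s, w) \<Rightarrow> of_int s *\<^sub>N mon w)"

lemma neg_cons_Some: "neg_cons n r = Some (s, w) \<longleftrightarrow> (\<exists>w'. w = n # w' \<and> r = Some (- s, w'))"
  by (cases r) (auto simp: neg_cons_def)

lemma signed_mon_neg_cons: "signed_mon (neg_cons n r) = - (nm_gen n * signed_mon r)"
  by (cases r) (auto simp: signed_mon_def neg_cons_def)

text \<open>The bound \<open>M\<close> strengthens the induction: the list built recursively must stay below the letter
that is put in front of it.\<close>

lemma x_cr_dec:
  "x_cr m ns = Some (s, w) \<Longrightarrow> dec ns \<Longrightarrow> m \<le> M \<Longrightarrow> \<forall>x\<in>set ns. x \<le> M + 1 \<Longrightarrow>
    dec w \<and> (\<forall>x\<in>set w. x \<le> M) \<and> s \<in> {1, - 1}"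
proof (induction ns arbitrary: m s w M)
  case (Cons n ns)
  show ?case
  proof (cases "n \<le> m")
    case True then show ?thesis using Cons.prems by fastforce
  next
    case False
    then have "n \<noteq> m + 1" using Cons.prems by auto
    then obtain w' where w': "w = (n - 1) # w'" "x_cr (m + 1) ns = Some (- s, w')"
      using Cons.prems(1) False by (auto simp: neg_cons_Some)
    show ?thesis using Cons.IH[OF w'(2), of "n - 1"] False \<open>n \<noteq> m + 1\<close> Cons.prems w'(1)
      by fastforce
  qed
qed auto

lemma Om_cr_dec:
  "Om_cr m ns = Some (s, w) \<Longrightarrow> dec ns \<Longrightarrow> \<forall>x\<in>set ns. x \<le> M \<Longrightarrow>
    dec w \<and> (\<forall>x\<in>set w. x \<le> M + 1) \<and> s \<in> {1, - 1}"
proof (induction ns arbitrary: m s w M)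
  case (Cons n ns)
  show ?case
  proof (cases "n = m")
    case True then show ?thesis using Cons.prems by auto
  next
    case False
    then obtain w' where w': "w = (n + 1) # w'" "Om_cr (m + 1) ns = Some (- s, w')"
      using Cons.prems(1) False by (auto simp: neg_cons_Some)
    show ?thesis using Cons.IH[OF w'(2), of n] Cons.prems w'(1) by fastforce
  qed
qed auto

text \<open>Contraction is zero if the vector does not occur: the letters of \<open>ns\<close> lie below \<open>m\<close>, and \<open>m\<close> increases
along the recursion.\<close>

lemma Om_cr_None: "\<forall>x\<in>set ns. x < m \<Longrightarrow> Om_cr m ns = None"
proof (induction ns arbitrary: m)
  case (Cons n ns)
  have "\<forall>x\<in>set ns. x < m + 1" using Cons.prems by fastforce
  then show ?case using Cons by (simp add: neg_cons_def)
qed simp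

text \<open>In terms of wedge products: if \<open>e\<close> occurs in \<open>b\<close>, then contracting with \<open>e\<close> and multiplying by \<open>e\<close> gives
\<open>b\<close> back.\<close>

lemma x_cr_Om_cr: "Om_cr m ns = Some (s, w) \<Longrightarrow> dec ns \<Longrightarrow> x_cr m w = Some (s, ns)"
proof (induction ns arbitrary: m s w)
  case (Cons n ns)
  show ?case
  proof (cases "n = m")
    case True then show ?thesis using Cons.prems by (cases ns) auto
  next
    case False
    then obtain w' where w': "w = (n + 1) # w'" "Om_cr (m + 1) ns = Some (- s, w')"
      using Cons.prems(1) False by (auto simp: neg_cons_Some)
    then have "\<not> (\<forall>x\<in>set ns. x < m + 1)" using Om_cr_None[of ns "m + 1"] by auto
    then have "m + 1 \<le> n" using Cons.prems(2) by auto
    then show ?thesis using Cons.IH[OF w'(2)] Cons.prems(2) w'(1) False by (simp add: neg_cons_Some)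
  qed
qed simp

text \<open>Conversely, if \<open>e\<close> does not occur in \<open>b\<close>, then multiplying by \<open>e\<close> and contracting with \<open>e\<close> gives \<open>b\<close>
back.\<close>

lemma Om_cr_x_cr: "x_cr m ns = Some (s, w) \<Longrightarrow> Om_cr m w = Some (s, ns)"
proof (induction ns arbitrary: m s w)
  case (Cons n ns)
  show ?case
  proof (cases "n \<le> m")
    case True then show ?thesis using Cons.prems by auto
  next
    case False
    then have "n \<noteq> m + 1" using Cons.prems by auto
    then obtain w' where w': "w = (n - 1) # w'" "x_cr (m + 1) ns = Some (- s, w')"
      using Cons.prems(1) False by (auto simp: neg_cons_Some)
    then show ?thesis using Cons.IH[OF w'(2)] \<open>n \<noteq> m + 1\<close> by (simp add: neg_cons_Some)
  qed
qed auto

lemma gen_mon_qcong: "dec ns \<Longrightarrow> nm_gen m * mon ns \<approx> (signed_mon (x_cr m ns) :: 'f::field_char_0 nm)"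
proof (induction ns arbitrary: m)
  case Nil show ?case by (simp add: signed_mon_def)
next
  case (Cons n ns)
  consider "n \<le> m" | "n = m + 1" | "n > m + 1" by linarith
  then show ?case
  proof cases
    case 1 then show ?thesis by (simp add: signed_mon_def)
  next
    case 2 then show ?thesis using gen_gen_qcong[OF nlat_mon, of m n ns] by (simp add: signed_mon_def)
  next
    case 3
    have "nm_gen m * (nm_gen n * mon ns :: 'f nm) \<approx> - (nm_gen (n - 1) * (nm_gen (m + 1) * mon ns))"
      using gen_gen_qcong[OF nlat_mon, of m n ns] 3 by simp
    also have "- (nm_gen (n - 1) * (nm_gen (m + 1) * mon ns)) \<approx> (- (nm_gen (n - 1) * signed_mon (x_cr (m + 1) ns)) :: 'f nm)"
      using Cons by (intro qcong_uminus qcong_gen) auto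
    finally show ?thesis using 3 by (simp add: signed_mon_neg_cons)
  qed
qed

text \<open>If the first letter is removed, the second term of the rule vanishes since the list is
decreasing.\<close>

lemma Omega_mon_qcong: "dec ns \<Longrightarrow> Omega_psi (- m) (mon ns) \<approx> (signed_mon (Om_cr m ns) :: 'f::field_char_0 nm)"
proof (induction ns arbitrary: m)
  case Nil show ?case by (simp add: signed_mon_def)
next
  case (Cons n ns)
  have "Omega_psi (- m) (nm_gen n * mon ns :: 'f nm) \<approx> (if - m = - n then mon ns else 0)
      - nm_gen (n + 1) * Omega_psi (- m - 1) (mon ns)"
    by (rule Omega_gen_qcong[OF nlat_mon])
  also have "(if - m = - n then mon ns else 0) - nm_gen (n + 1) * Omega_psi (- m - 1) (mon ns :: 'f nm)
     = (if - m = - n then mon ns else 0) + - (nm_gen (n + 1) * Omega_psi (- (m + 1)) (mon ns))"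
    by simp
  also have "\<dots> \<approx> (if - m = - n then mon ns else 0) + - (nm_gen (n + 1) * signed_mon (Om_cr (m + 1) ns))"
    using Cons.IH[of "m + 1"] Cons.prems by (intro qcong_add qcong_refl qcong_uminus qcong_gen) auto
  also have "\<dots> = signed_mon (Om_cr m (n # ns))"
  proof (cases "n = m")
    case True
    then have "Om_cr (m + 1) ns = None" using Cons.prems by (intro Om_cr_None) auto
    then show ?thesis using True by (simp add: signed_mon_def)
  qed (simp add: signed_mon_neg_cons)
  finally show ?case by simp
qed

section \<open>The ordered monomials form a basis\<close>

text \<open>The functional for \<open>ns\<close> removes the letters of \<open>ns\<close> one after the other by \<open>\<Omega>\<^sub>\<psi>\<close> and takes the
constant term. A removal that leaves \<open>w\<close> with sign \<open>s\<close> is undone by \<open>x_cr\<close>, so the outcome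
determines the monomial it started from.\<close>

lemma pbw_functional:
  obtains D :: "int list \<Rightarrow> 'f::field_char_0 nm \<Rightarrow> 'f rq" where
    "\<And>ns a b. D ns (a + b) = D ns a + D ns b" "\<And>ns c a. D ns (c *\<^sub>N a) = c * D ns a"
    "\<And>ns a. a \<in> nlat \<Longrightarrow> D ns a \<in> A0"
    "\<And>ns ms. dec ns \<Longrightarrow> dec ms \<Longrightarrow> A0_res (D ns (mon ms)) = (if ms = ns then 1 else 0)"
proof -
  obtain \<epsilon> :: "'f nm \<Rightarrow> 'f rq" where
    \<epsilon>: "\<And>a b. \<epsilon> (a + b) = \<epsilon> a + \<epsilon> b" "\<And>c a. \<epsilon> (c *\<^sub>N a) = c * \<epsilon> a" "\<epsilon> 1 = 1"
    "\<And>m a. \<epsilon> (nm_gen m * a) = 0" by (rule nm_augmentation) (rule that)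
  define D where "D = rec_list \<epsilon> (\<lambda>n ns f a. f (Omega_psi (- n) a))"
  have D: "D [] a = \<epsilon> a" "D (n # ns) a = D ns (Omega_psi (- n) a)" for n ns a
    by (simp_all add: D_def)
  have add: "D ns (a + b) = D ns a + D ns b" for ns a b
    by (induction ns arbitrary: a b) (simp_all add: D \<epsilon> lin_add[OF Omega_lin])
  have scl: "D ns (c *\<^sub>N a) = c * D ns a" for ns c a
    by (induction ns arbitrary: a) (simp_all add: D \<epsilon> lin_scl[OF Omega_lin])
  have \<epsilon>_mon: "\<epsilon> (mon ms) = (if ms = [] then 1 else 0)" for ms by (cases ms) (simp_all add: \<epsilon>)
  have \<epsilon>_A0: "\<epsilon> a \<in> A0" if "a \<in> nlat" for a
    using that by induction (use \<epsilon>(2)[of 0 0] in \<open>simp_all add: \<epsilon> \<epsilon>_mon\<close>)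
  have A0: "D ns a \<in> A0" if "a \<in> nlat" for ns a
    using that by (induction ns arbitrary: a) (simp_all add: D \<epsilon>_A0 nlat_Omega)
  have cong: "A0_res (D ns a) = A0_res (D ns b)" if ab: "a \<approx> b" and b: "b \<in> nlat" for ns a b
  proof -
    obtain y where y: "y \<in> nlat" "a = b + qh *\<^sub>N y"
      using ab by (auto simp: qcong_def algebra_simps)
    then show ?thesis using A0[OF b] A0[OF y(1)] by (simp add: add scl)
  qed
  have signed_mon_nlat: "signed_mon r \<in> nlat" for r
  proof -
    show ?thesis by (auto simp: signed_mon_def intro!: nlat.zero nlat.mon A0_of_int split: option.split)
  qed
  have "A0_res (D ns (mon ms)) = (if ms = ns then 1 else 0)" if "dec ns" "dec ms" for ns ms
    using that
  proof (induction ns arbitrary: ms)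
    case Nil then show ?case by (simp add: D \<epsilon>_mon)
  next
    case (Cons n ns)
    have eq: "A0_res (D (n # ns) (mon ms)) = A0_res (D ns (signed_mon (Om_cr n ms)))"
      using cong[OF Omega_mon_qcong signed_mon_nlat] Cons.prems by (simp add: D)
    show ?case
    proof (cases "Om_cr n ms")
      case None
      then have "ms \<noteq> n # ns" by auto
      moreover have "D ns 0 = 0" using scl[of ns 0 0] by simp
      ultimately show ?thesis using eq None by (simp add: signed_mon_def)
    next
      case (Some r)
      obtain s w where r: "Om_cr n ms = Some (s, w)" using Some by (cases r) auto
      have w: "dec w" "s \<in> {1, - 1}"
        using Om_cr_dec[OF r, of "Max (set ms)"] Cons.prems by auto
      have st: "x_cr n w = Some (s, ms)" using x_cr_Om_cr[OF r] Cons.prems by blast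
      have st': "x_cr n ns = Some (1, n # ns)" using Cons.prems by (cases ns) auto
      have "A0_res (D ns (mon w)) = (if w = ns then 1 else 0)"
        using Cons.IH w Cons.prems by simp
      moreover have "D ns (mon w) \<in> A0" by (simp add: A0 nlat_mon)
      ultimately have "A0_res (D (n # ns) (mon ms)) = of_int s * (if w = ns then 1 else 0)"
        using eq r w(2) by (auto simp: signed_mon_def scl)
      moreover have "w = ns \<longleftrightarrow> ms = n # ns" "w = ns \<Longrightarrow> s = 1" using r st st' by auto
      ultimately show ?thesis by auto
    qed
  qed
  then show thesis using that[of D] add scl A0 by blast
qed

definition ncomb :: "(int list \<Rightarrow>\<^sub>0 'f::field_char_0 rq) \<Rightarrow> 'f nm" where
  "ncomb c = (\<Sum>w\<in>keys c. lookup c w *\<^sub>N mon w)"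

lemma ncomb_superset:
  assumes "finite W" "keys c \<subseteq> W"
  shows "ncomb c = (\<Sum>w\<in>W. lookup c w *\<^sub>N mon w)"
  unfolding ncomb_def using assms
  by (intro sum.mono_neutral_left) (auto simp: in_keys_iff)

lemma ncomb_single: "ncomb (single w c) = c *\<^sub>N mon w"
  by (subst ncomb_superset[of "{w}"]) auto

lemma ncomb_0 [simp]: "ncomb 0 = 0"
  by (simp add: ncomb_def)

lemma ncomb_add: "ncomb (c + d) = ncomb c + ncomb d"
  by (subst (1 2 3) ncomb_superset[of "keys c \<union> keys d"])
     (use Poly_Mapping.keys_add[of c d] in
       \<open>auto simp: lookup_add N.scale_left_distrib sum.distrib\<close>)

lemma ncomb_scl:
  "ncomb (Poly_Mapping.map ((*) s) c) = s *\<^sub>N ncomb c"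
proof -
  have "ncomb (Poly_Mapping.map ((*) s) c) = (\<Sum>w\<in>keys c. lookup (Poly_Mapping.map ((*) s) c) w *\<^sub>N mon w)"
    by (rule ncomb_superset) (auto simp: in_keys_iff map.rep_eq when_def)
  also have "\<dots> = s *\<^sub>N ncomb c"
    by (auto simp: ncomb_def map.rep_eq when_def N.scale_sum_right in_keys_iff intro!: sum.cong)
  finally show ?thesis .
qed

lemma qh_powi_A0: "n \<ge> 0 \<Longrightarrow> (qh powi n :: 'f rq) \<in> A0 \<and> A0_res (qh powi n :: 'f::field_char_0 rq) = (if n = 0 then 1 else 0)"
  by (auto simp: power_int_def)

text \<open>If a coefficient were not in the local ring, scale by the power of \<open>q\<^sup>1\<^sup>/\<^sup>2\<close> that makes all of them regular
and one of them a unit. The element then lies in \<open>q\<^sup>1\<^sup>/\<^sup>2 nlat\<close>, but the functional of that monomial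
has a nonzero residue.\<close>

lemma ncomb_nlat_coeff:
  assumes keys: "keys c \<subseteq> Collect dec" and nl: "ncomb c \<in> nlat"
  shows "lookup c w \<in> (A0 :: 'f::field_char_0 rq set)"
proof (cases "c = 0")
  case False
  obtain D :: "int list \<Rightarrow> 'f nm \<Rightarrow> 'f rq" where D:
    "\<And>ns a b. D ns (a + b) = D ns a + D ns b" "\<And>ns c a. D ns (c *\<^sub>N a) = c * D ns a"
    "\<And>ns a. a \<in> nlat \<Longrightarrow> D ns a \<in> A0"
    "\<And>ns ms. dec ns \<Longrightarrow> dec ms \<Longrightarrow> A0_res (D ns (mon ms)) = (if ms = ns then 1 else 0)"
    by (rule pbw_functional) (rule that)
  have D_sum: "D ns (sum f A) = (\<Sum>x\<in>A. D ns (f x))" for ns f and A :: "int list set"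
    using D(2)[of ns 0 0] by (induction A rule: infinite_finite_induct) (simp_all add: D(1))
  let ?K = "keys c" and ?l = "lookup c"
  have "\<forall>w\<in>?K. \<exists>n u. ?l w = qh powi n * u \<and> u \<in> A0 \<and> A0_res u \<noteq> 0"
    by (metis in_keys_iff rq_unit_part)
  then obtain v u where vu: "\<And>w. w \<in> ?K \<Longrightarrow> ?l w = qh powi v w * u w"
      "\<And>w. w \<in> ?K \<Longrightarrow> u w \<in> A0" "\<And>w. w \<in> ?K \<Longrightarrow> A0_res (u w) \<noteq> 0" by metis
  (* The minimal valuation, attained at w0. *)
  define v0 where "v0 = Min (v ` ?K)"
  have K: "finite ?K" "?K \<noteq> {}" using False by auto
  have v0: "v0 \<le> v w" if "w \<in> ?K" for w using that K by (simp add: v0_def)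
  have "v0 \<in> v ` ?K" unfolding v0_def using K by (intro Min_in) auto
  then obtain w0 where w0: "w0 \<in> ?K" "v w0 = v0" by blast
  have "v0 \<ge> 0"
  proof (rule ccontr)
    assume "\<not> v0 \<ge> 0"
    then have neg: "- v0 > 0" by simp
    have e: "qh powi (- v0) * ?l w = qh powi (v w - v0) * u w" if "w \<in> ?K" for w
      using that vu(1) qh_nonzero[where 'f='f] by (simp add: power_int_diff power_int_minus field_simps)
    have "D w0 (qh powi (- v0) *\<^sub>N ncomb c) = (\<Sum>w\<in>?K. qh powi (v w - v0) * u w * D w0 (mon w))"
      by (simp add: ncomb_def N.scale_sum_right D_sum D(2) e)
    moreover have A: "qh powi (v w - v0) * u w * D w0 (mon w) \<in> A0 \<and>
        A0_res (qh powi (v w - v0) * u w * D w0 (mon w)) = (if w = w0 then A0_res (u w0) else 0)"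
      if "w \<in> ?K" for w
    proof -
      have "dec w" "dec w0" using keys that w0 by auto
      then have E: "D w0 (mon w) \<in> A0" "A0_res (D w0 (mon w)) = (if w = w0 then 1 else 0)"
        using D(3)[OF nlat_mon, of w0 w] D(4)[of w0 w] by simp_all
      have p: "qh powi (v w - v0) \<in> (A0 :: 'f rq set)"
        "w = w0 \<Longrightarrow> A0_res (qh powi (v w - v0) :: 'f rq) = 1"
        using qh_powi_A0[of "v w - v0", where 'f='f] v0[OF that] w0(2) by simp_all
      have pu: "qh powi (v w - v0) * u w \<in> A0" by (rule A0_arith(3)[OF p(1) vu(2)[OF that]])
      have "A0_res (qh powi (v w - v0) * u w * D w0 (mon w))
        = A0_res (qh powi (v w - v0)) * A0_res (u w) * A0_res (D w0 (mon w))"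
        using A0_arith(4)[OF pu E(1)] A0_arith(4)[OF p(1) vu(2)[OF that]] by simp
      then show ?thesis using A0_arith(3)[OF pu E(1)] E(2) p(2) by simp
    qed
    moreover have "sum f A \<in> A0 \<and> A0_res (sum f A) = (\<Sum>w\<in>A. A0_res (f w))"
      if "\<And>w. w \<in> A \<Longrightarrow> f w \<in> A0" for f :: "int list \<Rightarrow> 'f rq" and A
      using that by (induction A rule: infinite_finite_induct) auto
    ultimately have "A0_res (D w0 (qh powi (- v0) *\<^sub>N ncomb c)) = (\<Sum>w\<in>?K. if w = w0 then A0_res (u w0) else 0)"
      by simp
    also have "\<dots> = A0_res (u w0)" using w0 K by simp
    finally have "A0_res (D w0 (qh powi (- v0) *\<^sub>N ncomb c)) = A0_res (u w0)" .
    moreover have "A0_res (D w0 (qh powi (- v0) *\<^sub>N ncomb c)) = 0"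
      using qh_powi_A0[of "- v0", where 'f='f] neg D(3)[OF nl] by (simp add: D(2))
    ultimately show False using vu(3)[OF w0(1)] by simp
  qed
  show ?thesis
  proof (cases "w \<in> ?K")
    case True
    then show ?thesis using vu(1,2)[OF True] v0[OF True] \<open>v0 \<ge> 0\<close> qh_powi_A0[of "v w", where 'f='f] by simp
  qed (simp add: in_keys_iff)
qed simp

lemma A0_divisible_0:
  assumes "\<And>n::nat. inverse (qh ^ n) * c \<in> A0"
  shows "c = (0 :: 'f::field_char_0 rq)"
proof (rule ccontr)
  assume "c \<noteq> 0"
  then obtain n u where c: "c = qh powi n * u" "u \<in> A0" "A0_res u \<noteq> 0" by (rule rq_unit_part)
  show False
  proof (cases "n \<ge> 0")
    case True
    then have "u = qh * (inverse (qh ^ nat (n + 1)) * c)"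
      using c(1) qh_nonzero[where 'f='f] by (simp add: power_int_def nat_add_distrib)
    then have "A0_res u = 0" using assms[of "nat (n + 1)"] by (metis A0_arith(3,4) A0_qh mult_zero_left)
    then show False using c(3) by simp
  next
    case False
    define k where "k = nat (- n)"
    have "n = - int k" using False by (simp add: k_def)
    then have "u = qh ^ (nat (- n) + 1) * (inverse (qh ^ 1) * c)"
      using c(1) qh_nonzero[where 'f='f] by (simp add: power_int_minus field_simps)
    moreover have "A0_res (qh ^ (nat (- n) + 1) * (inverse (qh ^ 1) * c)) = 0"
      using assms[of 1] by simp
    ultimately show False using c(3) by simp
  qed
qed

text \<open>A relation may be divided by any power of \<open>q\<^sup>1\<^sup>/\<^sup>2\<close>, so its coefficients are infinitely divisible in
the local ring.\<close>

lemma ncomb_eq_0: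
  assumes "keys c \<subseteq> Collect dec" "ncomb c = 0"
  shows "c = (0 :: int list \<Rightarrow>\<^sub>0 'f::field_char_0 rq)"
proof (rule poly_mapping_eqI)
  fix w
  have "inverse (qh ^ n) * lookup c w \<in> A0" for n
  proof -
    let ?d = "Poly_Mapping.map ((*) (inverse (qh ^ n))) c"
    have "keys ?d \<subseteq> Collect dec"
      using assms(1) by (auto simp: in_keys_iff map.rep_eq when_def subset_iff)
    moreover have "ncomb ?d \<in> nlat" by (simp add: ncomb_scl assms nlat.zero)
    ultimately have "lookup ?d w \<in> A0" by (rule ncomb_nlat_coeff)
    then show ?thesis by (auto simp: map.rep_eq when_def split: if_splits)
  qed
  then have "lookup c w = 0" by (rule A0_divisible_0)
  then show "lookup c w = lookup 0 w" by simp
qed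

text \<open>The length \<open>L\<close> and the bound \<open>M\<close> on the letters are recorded because straightening preserves them, and
its termination depends on the bound.\<close>

inductive_set slat :: "nat \<Rightarrow> int \<Rightarrow> 'f::field_char_0 nm set" for L M where
  zero: "0 \<in> slat L M"
| mon: "c \<in> A0 \<Longrightarrow> dec ns \<Longrightarrow> length ns = L \<Longrightarrow> \<forall>x\<in>set ns. x \<le> M \<Longrightarrow> c *\<^sub>N mon ns \<in> slat L M"
| add: "a \<in> slat L M \<Longrightarrow> b \<in> slat L M \<Longrightarrow> a + b \<in> slat L M"

lemma slat_scl: "a \<in> slat L M \<Longrightarrow> c \<in> A0 \<Longrightarrow> c *\<^sub>N a \<in> slat L M"
  by (induction rule: slat.induct) (auto intro: slat.intros simp: N.scale_right_distrib)

lemma slat_diff: "a \<in> slat L M \<Longrightarrow> b \<in> slat L M \<Longrightarrow> a - b \<in> slat L M"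
  using slat.add[OF _ slat_scl[of b L M "- 1"], of a] by simp

text \<open>Straightening terminates: by \<open>gen_gen_swap\<close>, every product \<open>x\<^sub>m x\<^sub>n\<close> with \<open>m < n\<close> is a combination of products
with a larger first letter, and letters are bounded by \<open>M\<close>. The induction is on the
length and, inside, on the distance from \<open>m\<close> to \<open>M\<close>.\<close>

lemma slat_gen: "a \<in> slat L M \<Longrightarrow> m \<le> M \<Longrightarrow> nm_gen m * (a :: 'f::field_char_0 nm) \<in> slat (Suc L) M"
proof (induction L arbitrary: m a)
  case 0
  from 0 show ?case
  proof (induction rule: slat.induct)
    case (mon c ns)
    then show ?case using slat.mon[of c "[m]" "Suc 0" M] by simp
  qed (auto intro: slat.intros simp: distrib_left)
next
  case (Suc L)
  have "nm_gen m * a \<in> slat (Suc (Suc L)) M" if "nat (M - m) = d" "m \<le> M" "a \<in> slat (Suc L) M" for d m and a :: "'f nm"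
    using that
  proof (induction d arbitrary: m a rule: less_induct)
    case (less d)
    from less.prems(3,1,2) show ?case
    proof (induction rule: slat.induct)
      case zero show ?case by (simp add: slat.zero)
    next
      case (add a b) then show ?case by (simp add: distrib_left slat.add)
    next
      case (mon c ns)
      obtain n ns' where ns: "ns = n # ns'" using mon by (cases ns) auto
      have "nm_gen m * (mon ns :: 'f nm) \<in> slat (Suc (Suc L)) M"
      proof (cases "n \<le> m")
        case True
        then have "1 *\<^sub>N (mon (m # ns) :: 'f nm) \<in> slat (Suc (Suc L)) M"
          using mon ns by (intro slat.mon) fastforce+
        then show ?thesis by simp
      next
        case False
        have n: "n \<le> M" using mon ns by simp
        have ns': "(mon ns' :: 'f nm) \<in> slat L M" using slat.mon[of 1 ns' L M] mon ns by simp
        have two: "nm_gen a * (nm_gen b * mon ns' :: 'f nm) \<in> slat (Suc (Suc L)) M" if "m < a" "a \<le> n" "b \<le> n" for a b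
        proof (rule less.IH[OF _ refl])
          show "nat (M - a) < d" using that less.prems(1) n mon by linarith
          show "nm_gen b * (mon ns' :: 'f nm) \<in> slat (Suc L) M" using Suc.IH[OF ns', of b] that n by simp
        qed (use that n in auto)
        show ?thesis
        proof (cases "n = m + 1")
          case True
          show ?thesis unfolding ns mon_simps True gen_gen_swap_adjacent
            by (intro slat_scl two) (use True in \<open>simp_all add: A0_qq\<close>)
        next
          case F2: False
          have "m < n" "m + 1 < n" using False F2 by auto
          then show ?thesis unfolding ns mon_simps gen_gen_swap[of m n]
            by (intro slat_scl slat.add slat_diff two) (simp_all add: A0_qq)
        qed
      qed
      then show ?case using mon(1) by (simp add: slat_scl)
    qed
  qed
  then show ?case using Suc.prems by blast
qed

lemma mon_slat: "\<forall>x\<in>set ns. x \<le> M \<Longrightarrow> mon ns \<in> slat (length ns) M"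
proof (induction ns)
  case Nil show ?case using slat.mon[of 1 "[]" 0 M] by simp
qed (simp add: slat_gen)

lemma slat_ncomb:
  "a \<in> slat L M \<Longrightarrow> a \<in> ncomb ` coeffs_in A0 (Collect dec)"
proof (induction rule: slat.induct)
  case zero
  show ?case by (intro image_eqI[of _ _ 0]) (auto simp: coeffs_in_def)
next
  case (mon c ns)
  then show ?case
    by (intro image_eqI[of _ _ "single ns c"])
       (auto simp: coeffs_in_def ncomb_single lookup_single when_def split: if_splits)
next
  case (add a b)
  then obtain c d where "a = ncomb c" "b = ncomb d" "c \<in> coeffs_in A0 (Collect dec)" "d \<in> coeffs_in A0 (Collect dec)"
    by blast
  then show ?case using Poly_Mapping.keys_add[of c d]
    by (intro image_eqI[of _ _ "c + d"]) (auto simp: coeffs_in_def ncomb_add lookup_add image_subset_iff)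
qed

lemma coeffs_in_iff: "c \<in> coeffs_in R S \<longleftrightarrow> keys c \<subseteq> S \<and> (\<forall>x. lookup c x \<in> R)"
  by (auto simp: coeffs_in_def)

lemma nlat_eq: "nlat = ncomb ` coeffs_in A0 (Collect dec)"
proof (intro equalityI subsetI)
  fix a :: "'a nm" assume "a \<in> ncomb ` coeffs_in A0 (Collect dec)"
  then show "a \<in> nlat"
    by (auto simp: ncomb_def coeffs_in_iff intro!: nlat_sum nlat.mon)
next
  fix a :: "'a nm" assume "a \<in> nlat"
  then show "a \<in> ncomb ` coeffs_in A0 (Collect dec)"
  proof induction
    case zero show ?case by (intro image_eqI[of _ _ 0]) (auto simp: coeffs_in_def)
  next
    case (mon c ns)
    have "\<forall>x\<in>set ns. x \<le> Max (set ns)" by simp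
    from slat_scl[OF mon_slat[OF this] mon] show ?case by (rule slat_ncomb)
  next
    case (add a b)
    then obtain c d where "a = ncomb c" "b = ncomb d" "c \<in> coeffs_in A0 (Collect dec)" "d \<in> coeffs_in A0 (Collect dec)"
      by blast
    then show ?case using Poly_Mapping.keys_add[of c d]
      by (intro image_eqI[of _ _ "c + d"]) (auto simp: coeffs_in_def ncomb_add lookup_add image_subset_iff)
  qed
qed

lemma ncomb_bij: "bij_betw ncomb {c. keys c \<subseteq> Collect dec} (UNIV :: 'f::field_char_0 nm set)"
proof (rule bij_betw_imageI)
  show "inj_on (ncomb :: _ \<Rightarrow> 'f nm) {c. keys c \<subseteq> Collect dec}"
  proof (rule inj_onI)
    fix c d :: "int list \<Rightarrow>\<^sub>0 'f rq"
    assume "c \<in> {c. keys c \<subseteq> Collect dec}" "d \<in> {c. keys c \<subseteq> Collect dec}" "ncomb c = ncomb d"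
    moreover have "ncomb c = ncomb (c - d) + ncomb d" by (simp flip: ncomb_add)
    moreover have "keys (c - d) \<subseteq> keys c \<union> keys d"
      by (auto simp: in_keys_iff lookup_minus)
    ultimately have "keys (c - d) \<subseteq> Collect dec" "ncomb (c - d) = 0" by auto
    then have "c - d = 0" by (rule ncomb_eq_0)
    then show "c = d" by simp
  qed
  have "a \<in> ncomb ` {c. keys c \<subseteq> Collect dec}" for a :: "'f nm"
  proof (induction a rule: nm_span_induct)
    case zero show ?case by (intro image_eqI[of _ _ 0]) auto
  next
    case (mon c ns)
    obtain d where d: "(mon ns :: 'f nm) = ncomb d" "d \<in> coeffs_in A0 (Collect dec)"
      using nlat_mon[of ns, where 'a='f] unfolding nlat_eq by blast
    then show ?case
      by (intro image_eqI[of _ _ "Poly_Mapping.map ((*) c) d"])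
         (auto simp: ncomb_scl coeffs_in_iff in_keys_iff map.rep_eq when_def subset_iff)
  next
    case (add a b)
    then obtain c d where "a = ncomb c" "b = ncomb d" "keys c \<subseteq> Collect dec" "keys d \<subseteq> Collect dec"
      by blast
    then show ?case using Poly_Mapping.keys_add[of c d]
      by (intro image_eqI[of _ _ "c + d"]) (auto simp: ncomb_add)
  qed
  then show "(ncomb :: _ \<Rightarrow> 'f nm) ` {c. keys c \<subseteq> Collect dec} = UNIV" by blast
qed

section \<open>Operators on \<open>\<N>\<close> for the Drinfeld generators\<close>

text \<open>The structure constant of \<open>[h\<^sub>k, x\<^sup>\<plusminus>\<^sub>l]\<close> at \<open>\<gamma> = 1\<close>. For \<open>k = 0\<close> it is 0, which fits the relation that
sets the superfluous generator to 0.\<close>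

definition hcoef :: "int \<Rightarrow> 'f::field_char_0 rq" where
  "hcoef k = qint (2 * k) / of_int k"

abbreviation qeta :: "'f::field_char_0 rq" where
  "qeta \<equiv> qq - inverse qq"

lemma hcoef_0 [simp]: "hcoef 0 = 0"
  by (simp add: hcoef_def)

lemma hcoef_minus: "hcoef (- k) = hcoef k"
  by (simp add: hcoef_def qint_def divide_simps)

lemma hcoef_eq: "k > 0 \<Longrightarrow> of_nat k * (qeta * hcoef (int k)) = (qq powi (2 * int k) - qq powi (- 2 * int k) :: 'f::field_char_0 rq)"
  using of_nat_rq_nonzero[of k, where 'f='f] qq_diff_nonzero[where 'f='f]
  by (simp add: hcoef_def qint_def)

text \<open>A derivation is the second component of an action of \<open>\<N>\<close> on pairs \<open>(a, b)\<close>. The relations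
survive because each of them is mapped to a sum of two relations with one index shifted.\<close>

lemma derivation_exists:
  "\<exists>f. lin f \<and> f 1 = 0 \<and> (\<forall>m a. f (nm_gen m * a) = nm_gen m * f a - c *\<^sub>N (nm_gen (m + k) * (a :: 'f::field_char_0 nm)))"
proof -
  define s :: "'f rq \<Rightarrow> 'f nm \<times> 'f nm \<Rightarrow> 'f nm \<times> 'f nm" where "s = (\<lambda>c (a, b). (c *\<^sub>N a, c *\<^sub>N b))"
  define T where "T = (\<lambda>m (a, b). (nm_gen m * a, nm_gen m * b - c *\<^sub>N (nm_gen (m + k) * a)))"
  have act: "free_action UNIV s T"
    by standard (auto simp: s_def T_def split_beta N.scale_left_distrib N.scale_right_distrib
        algebra_simps N.scale_right_diff_distrib)
  have rel: "T l (T (n + 1) y) - s (qq ^ 2) (T (n + 1) (T l y))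
      - (s (qq ^ 2) (T (l + 1) (T n y)) - T n (T (l + 1) y)) = 0" for l n y
  proof (cases y)
    case (Pair a b)
    let ?R = "\<lambda>l n a. nm_gen l * (nm_gen (n + 1) * a) - qq ^ 2 *\<^sub>N (nm_gen (n + 1) * (nm_gen l * a))
      - (qq ^ 2 *\<^sub>N (nm_gen (l + 1) * (nm_gen n * a)) - nm_gen n * (nm_gen (l + 1) * a)) :: 'f nm"
    have "T l (T (n + 1) y) - s (qq ^ 2) (T (n + 1) (T l y))
      - (s (qq ^ 2) (T (l + 1) (T n y)) - T n (T (l + 1) y))
      = (?R l n a, ?R l n b - c *\<^sub>N (?R (l + k) n a + ?R l (n + k) a))"
      by (simp add: Pair s_def T_def algebra_simps N.scale_right_distrib N.scale_right_diff_distrib)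
    also have "\<dots> = 0" unfolding nm_rel by (simp add: zero_prod_def)
    finally show ?thesis .
  qed
  obtain f where f: "\<And>a b. f (a + b) = f a + f b" "\<And>c a. f (c *\<^sub>N a) = s c (f a)"
    "f 1 = (1, 0)" "\<And>m a. f (nm_gen m * a) = T m (f a)"
    by (rule nm_recursor[OF act UNIV_I rel, of "(1, 0)"]) (rule that)
  have fst: "fst (f a) = a" for a
    by (induction a rule: nm_induct) (simp_all add: f s_def T_def split_beta)
  show ?thesis
    by (rule exI[of _ "snd \<circ> f"]) (simp add: lin_def f s_def T_def split_beta fst)
qed

definition Hop :: "int \<Rightarrow> 'f::field_char_0 nm \<Rightarrow> 'f nm" where
  "Hop k = (SOME f. lin f \<and> f 1 = 0 \<and> (\<forall>m a. f (nm_gen m * a) = nm_gen m * f a - hcoef k *\<^sub>N (nm_gen (m + k) * a)))"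

lemma Hop_lin: "lin (Hop k)" and Hop_one [simp]: "Hop k 1 = 0"
  and Hop_gen: "Hop k (nm_gen m * a) = nm_gen m * Hop k a - hcoef k *\<^sub>N (nm_gen (m + k) * a)"
  using someI_ex[OF derivation_exists[of "hcoef k" k]] unfolding Hop_def by blast+

lemma grading_exists:
  assumes w: "w \<noteq> 0"
  shows "\<exists>f. lin f \<and> f 1 = 1 \<and> (\<forall>m a. f (nm_gen m * a) = (z * w powi m) *\<^sub>N (nm_gen m * (f a :: 'f::field_char_0 nm)))"
proof -
  define T where "T = (\<lambda>m (a :: 'f nm). (z * w powi m) *\<^sub>N (nm_gen m * a))"
  have act: "free_action UNIV scl T"
    by standard (auto simp: T_def N.scale_left_distrib N.scale_right_distrib algebra_simps)
  have rel: "T l (T (n + 1) y) - (qq ^ 2) *\<^sub>N (T (n + 1) (T l y))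
      - ((qq ^ 2) *\<^sub>N (T (l + 1) (T n y)) - T n (T (l + 1) y)) = 0" for l n y
  proof -
    have "T l (T (n + 1) y) - (qq ^ 2) *\<^sub>N (T (n + 1) (T l y))
      - ((qq ^ 2) *\<^sub>N (T (l + 1) (T n y)) - T n (T (l + 1) y))
     = (z * w powi l * z * w powi n * w) *\<^sub>N (nm_gen l * (nm_gen (n + 1) * y) - (qq ^ 2) *\<^sub>N (nm_gen (n + 1) * (nm_gen l * y))
      - ((qq ^ 2) *\<^sub>N (nm_gen (l + 1) * (nm_gen n * y)) - nm_gen n * (nm_gen (l + 1) * y)))"
      using w by (simp add: T_def power_int_add N.scale_right_diff_distrib mult_ac)
    then show ?thesis by (simp only: nm_rel N.scale_zero_right)
  qed
  show ?thesis using nm_recursor[OF act UNIV_I rel, of 1] unfolding lin_def T_def by metis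
qed

text \<open>The automorphism \<open>x\<^sup>-\<^sub>m \<mapsto> z w\<^sup>m x\<^sup>-\<^sub>m\<close>; up to scalars both \<open>K\<close> and \<open>D\<close> are of this form.\<close>

definition grading :: "'f::field_char_0 rq \<Rightarrow> 'f rq \<Rightarrow> 'f nm \<Rightarrow> 'f nm" where
  "grading z w = (SOME f. lin f \<and> f 1 = 1 \<and> (\<forall>m a. f (nm_gen m * a) = (z * w powi m) *\<^sub>N (nm_gen m * f a)))"

lemma grading_lin: "w \<noteq> 0 \<Longrightarrow> lin (grading z w)" and grading_one [simp]: "w \<noteq> 0 \<Longrightarrow> grading z w 1 = 1"
  and grading_gen: "w \<noteq> 0 \<Longrightarrow> grading z w (nm_gen m * a) = (z * w powi m) *\<^sub>N (nm_gen m * grading z w a)"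
  using someI_ex[OF grading_exists[of w z]] unfolding grading_def by blast+

lemma grading_grading:
  assumes w: "w \<noteq> 0" "w' \<noteq> (0 :: 'f::field_char_0 rq)"
  shows "grading z w (grading z' w' a) = grading (z * z') (w * w') a"
  by (induction a rule: nm_induct)
     (use w in \<open>simp_all add: grading_gen lin_rules[OF grading_lin] power_int_mult_distrib mult_ac\<close>)

lemma grading_id [simp]: "grading 1 1 a = a"
  by (induction a rule: nm_induct) (simp_all add: grading_gen lin_rules[OF grading_lin])

lemma grading_Hop: "w \<noteq> 0 \<Longrightarrow> grading z w (Hop k a) = w powi k *\<^sub>N Hop k (grading z w a)"
  by (induction a rule: nm_induct)
     (simp_all add: grading_gen lin_rules[OF grading_lin] lin_rules[OF Hop_lin] Hop_gen power_int_add
       N.scale_right_diff_distrib N.scale_right_distrib mult_ac)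

lemma Hop_Hop: "Hop k (Hop l a) = Hop l (Hop k a)"
  by (induction a rule: nm_induct)
     (simp_all add: lin_rules[OF Hop_lin] Hop_gen N.scale_right_diff_distrib mult_ac add_ac)

lemma Hop_0: "Hop 0 a = 0"
  by (induction a rule: nm_induct) (simp_all add: lin_rules[OF Hop_lin] Hop_gen)

subsection \<open>Exponentials of commuting operators\<close>

text \<open>The coefficients \<open>E\<^sub>n\<close> of \<open>exp (\<Sum>\<^sub>j Hs\<^sub>j t\<^sup>j)\<close> for commuting \<open>Hs\<^sub>j\<close>, defined by the recursion that the
differential equation of the exponential series gives. Agreement with the composition of power series is
shown in \<open>U_act_exp\<close>.\<close>

fun expop :: "(nat \<Rightarrow> 'f::field_char_0 nm \<Rightarrow> 'f nm) \<Rightarrow> nat \<Rightarrow> 'f nm \<Rightarrow> 'f nm" where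
  "expop Hs 0 a = a"
| "expop Hs (Suc n) a = inverse (of_nat (Suc n)) *\<^sub>N (\<Sum>k\<le>n. of_nat (Suc k) *\<^sub>N Hs (Suc k) (expop Hs (n - k) a))"

lemma expop_ode: "of_nat (Suc n) *\<^sub>N expop Hs (Suc n) (a :: 'f::field_char_0 nm)
    = (\<Sum>k\<le>n. of_nat (Suc k) *\<^sub>N Hs (Suc k) (expop Hs (n - k) a))"
  using of_nat_rq_nonzero[of "Suc n", where 'f='f] by (simp del: of_nat_Suc)

declare expop.simps(2) [simp del]

lemma expop_lin:
  assumes "\<And>j. lin (Hs j)"
  shows "lin (expop Hs n)"
proof (induction n rule: less_induct)
  case (less n)
  have IH: "expop Hs (m - k) (a + b) = expop Hs (m - k) a + expop Hs (m - k) b"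
    "expop Hs (m - k) (c *\<^sub>N a) = c *\<^sub>N expop Hs (m - k) a" if "n = Suc m" for m k a b c
    using less[of "m - k"] that by (simp_all add: lin_def)
  show ?case
    by (cases n; intro linI)
       (simp_all add: expop.simps IH lin_rules[OF assms] N.scale_right_distrib sum.distrib N.scale_sum_right mult_ac)
qed

lemma expop_twist:
  assumes H: "\<And>j. lin (Hs j)" and f: "lin f" and fH: "\<And>j a. f (Hs j a) = z ^ j *\<^sub>N Hs j (f a)"
  shows "f (expop Hs n a) = z ^ n *\<^sub>N expop Hs n (f a)"
proof (induction n rule: less_induct)
  case (less n)
  show ?case
  proof (cases n)
    case (Suc m)
    have "f (expop Hs (m - k) a) = z ^ (m - k) *\<^sub>N expop Hs (m - k) (f a)" for k
      using less[of "m - k"] Suc by simp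
    moreover have "z ^ (m - k) * z ^ k = z ^ m" if "k \<le> m" for k
      using that by (simp flip: power_add)
    ultimately show ?thesis using Suc
      by (auto simp: expop.simps lin_rules[OF f] fH lin_rules[OF H] N.scale_sum_right mult_ac intro!: sum.cong)
  qed simp
qed

lemma expop_commute:
  assumes "\<And>j. lin (Hs j)" "lin f" "\<And>j a. f (Hs j a) = Hs j (f a)"
  shows "f (expop Hs n a) = expop Hs n (f a)"
  using expop_twist[of Hs f 1 n a] assms by simp

lemma triangle_swap:
  "(\<Sum>k\<le>n. \<Sum>r\<le>n - k. f k r) = (\<Sum>r\<le>n. \<Sum>k\<le>n - r. f k (r::nat) :: 'b::comm_monoid_add)"
proof -
  have e: "(\<Sum>r\<le>n - k. g r) = (\<Sum>r | r \<in> {..n} \<and> k + r \<le> n. g r)" if "k \<le> n" for k and g :: "nat \<Rightarrow> 'b"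
    using that by (intro sum.cong) auto
  have "(\<Sum>k\<le>n. \<Sum>r\<le>n - k. f k r) = (\<Sum>k\<le>n. \<Sum>r | r \<in> {..n} \<and> k + r \<le> n. f k r)"
    by (intro sum.cong e) auto
  also have "\<dots> = (\<Sum>r\<le>n. \<Sum>k | k \<in> {..n} \<and> k + r \<le> n. f k r)"
    by (rule sum.swap_restrict) auto
  also have "\<dots> = (\<Sum>r\<le>n. \<Sum>k\<le>n - r. f k r)"
    using e[where g = "\<lambda>k. f k r" for r] by (intro sum.cong) (auto simp: add.commute)
  finally show ?thesis .
qed

lemma triangle_diag:
  "(\<Sum>k\<le>n. \<Sum>r\<le>n - k. f k (r::nat)) = (\<Sum>s\<le>n. \<Sum>k\<le>s. f k (s - k) :: 'b::comm_monoid_add)"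
proof -
  have "(\<Sum>k\<le>n. \<Sum>r\<le>n - k. f k r) = (\<Sum>(i, j)\<in>Sigma {..n} (\<lambda>k. {..n - k}). f i j)"
    by (rule sum.Sigma) auto
  also have "Sigma {..n} (\<lambda>k. {..n - k}) = {(i, j). i + j \<le> n}" by auto
  finally show ?thesis by (simp add: sum.triangle_reindex_eq)
qed

text \<open>If the \<open>Hs\<^sub>j\<close> shift a family \<open>Y\<^sub>l\<close> by commutation, then conjugation by the exponential multiplies the
current of \<open>Y\<close> by a scalar series \<open>G\<close>, the exponential of the structure constants. By strong induction on
\<open>n\<close>, both sides satisfy the same differential equation.\<close>

lemma expop_current:
  assumes H: "\<And>j. lin (Hs j)" and Y: "\<And>l. lin (Y l)"
    and HY: "\<And>j l a. Hs (Suc j) (Y l a) = Y l (Hs (Suc j) a) + e j *\<^sub>N Y (l + \<delta> * int (Suc j)) a"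
    and G0: "G 0 = 1" and G: "\<And>n. of_nat (Suc n) * G (Suc n) = (\<Sum>k\<le>n. of_nat (Suc k) * e k * G (n - k))"
  shows "expop Hs n (Y l a) = (\<Sum>r\<le>n. G r *\<^sub>N Y (l + \<delta> * int r) (expop Hs (n - r) (a :: 'f::field_char_0 nm)))"
proof (induction n rule: less_induct)
  case (less n)
  show ?case
  proof (cases n)
    case 0 then show ?thesis by (simp add: G0)
  next
    case (Suc m)
    let ?E = "\<lambda>n. expop Hs n a" and ?Y = "\<lambda>r. Y (l + \<delta> * int r)"
    have HY': "Hs (Suc k) (?Y r b) = ?Y r (Hs (Suc k) b) + e k *\<^sub>N ?Y (r + Suc k) b" for k r b
    proof -
      have "l + \<delta> * int r + \<delta> * int (Suc k) = l + \<delta> * int (r + Suc k)" by (simp add: algebra_simps)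
      then show ?thesis by (simp only: HY)
    qed
    have "of_nat (Suc m) *\<^sub>N expop Hs (Suc m) (Y l a)
      = (\<Sum>k\<le>m. of_nat (Suc k) *\<^sub>N Hs (Suc k) (expop Hs (m - k) (Y l a)))" by (rule expop_ode)
    also have "\<dots> = (\<Sum>k\<le>m. of_nat (Suc k) *\<^sub>N Hs (Suc k) (\<Sum>r\<le>m - k. G r *\<^sub>N ?Y r (?E (m - k - r))))"
      using less Suc by (intro sum.cong) auto
    also have "\<dots> = (\<Sum>k\<le>m. \<Sum>r\<le>m - k. (of_nat (Suc k) * G r) *\<^sub>N ?Y r (Hs (Suc k) (?E (m - k - r))))
       + (\<Sum>k\<le>m. \<Sum>r\<le>m - k. (of_nat (Suc k) * G r * e k) *\<^sub>N ?Y (r + Suc k) (?E (m - k - r)))"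
      by (simp add: lin_rules[OF H] HY' N.scale_sum_right N.scale_right_distrib sum.distrib mult_ac
          del: of_nat_Suc add_Suc_right)
    also have "(\<Sum>k\<le>m. \<Sum>r\<le>m - k. (of_nat (Suc k) * G r) *\<^sub>N ?Y r (Hs (Suc k) (?E (m - k - r))))
       = (\<Sum>r\<le>m. \<Sum>k\<le>m - r. (of_nat (Suc k) * G r) *\<^sub>N ?Y r (Hs (Suc k) (?E (m - k - r))))"
      by (rule triangle_swap)
    also have "\<dots> = (\<Sum>r\<le>m. G r *\<^sub>N ?Y r (of_nat (Suc (m - r)) *\<^sub>N ?E (Suc (m - r))))"
      by (simp only: expop_ode) (auto simp: lin_rules[OF Y] N.scale_sum_right algebra_simps intro!: sum.cong simp del: of_nat_Suc)
    also have "(\<Sum>k\<le>m. \<Sum>r\<le>m - k. (of_nat (Suc k) * G r * e k) *\<^sub>N ?Y (r + Suc k) (?E (m - k - r)))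
       = (\<Sum>s\<le>m. \<Sum>k\<le>s. (of_nat (Suc k) * G (s - k) * e k) *\<^sub>N ?Y (s - k + Suc k) (?E (m - k - (s - k))))"
      by (rule triangle_diag)
    also have "\<dots> = (\<Sum>s\<le>m. (of_nat (Suc s) * G (Suc s)) *\<^sub>N ?Y (Suc s) (?E (m - s)))"
      unfolding G N.scale_sum_left
      by (intro sum.cong refl) (auto simp del: of_nat_Suc simp: mult_ac)
    also have "(\<Sum>r\<le>m. G r *\<^sub>N ?Y r (of_nat (Suc (m - r)) *\<^sub>N ?E (Suc (m - r))))
       = (\<Sum>r\<le>Suc m. (of_nat (Suc m - r) * G r) *\<^sub>N ?Y r (?E (Suc m - r)))"
      by (auto simp: lin_rules[OF Y] Suc_diff_le mult.commute simp del: of_nat_Suc of_nat_diff intro!: sum.cong)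
    also have "(\<Sum>s\<le>m. (of_nat (Suc s) * G (Suc s)) *\<^sub>N ?Y (Suc s) (?E (m - s)))
       = (\<Sum>r\<le>Suc m. (of_nat r * G r) *\<^sub>N ?Y r (?E (Suc m - r)))"
      by (subst sum.atMost_Suc_shift) simp
    also have "(\<Sum>r\<le>Suc m. (of_nat (Suc m - r) * G r) *\<^sub>N ?Y r (?E (Suc m - r))) + \<dots>
       = of_nat (Suc m) *\<^sub>N (\<Sum>r\<le>Suc m. G r *\<^sub>N ?Y r (?E (Suc m - r)))"
      unfolding N.scale_sum_right sum.distrib[symmetric] N.scale_scale N.scale_left_distrib[symmetric]
        distrib_right[symmetric]
      by (intro sum.cong refl) (simp del: of_nat_Suc flip: of_nat_add)
    finally show ?thesis using Suc of_nat_rq_nonzero[of "Suc m", where 'f='f]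
      by (simp del: of_nat_Suc sum.atMost_Suc)
  qed
qed

text \<open>For the structure constants at hand \<open>G(t) = (1 - \<kappa> t) / (1 - \<kappa>\<^sup>-\<^sup>1 t)\<close>. Clearing the denominator
leaves a relation with two terms on each side, in which no infinite sum occurs.\<close>

lemma expop_current_two_term:
  assumes H: "\<And>j. lin (Hs j)" and Y: "\<And>l. lin (Y l)" and \<kappa>: "\<kappa> \<noteq> 0"
    and HY: "\<And>j l a. Hs (Suc j) (Y l a) = Y l (Hs (Suc j) a) + e j *\<^sub>N Y (l + \<delta> * int (Suc j)) a"
    and e: "\<And>j. of_nat (Suc j) * e j = inverse \<kappa> ^ Suc j - \<kappa> ^ Suc j"
  shows "expop Hs n (Y (l + \<delta>) a) - \<kappa> *\<^sub>N expop Hs (Suc n) (Y l a)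
    = \<kappa> ^ 2 *\<^sub>N Y (l + \<delta>) (expop Hs n a) - \<kappa> *\<^sub>N Y l (expop Hs (Suc n) (a :: 'f::field_char_0 nm))"
proof -
  (* The Taylor coefficients of (1 - \<kappa> t) / (1 - t / \<kappa>). *)
  define G where "G = (\<lambda>r::nat. if r = 0 then 1 else inverse \<kappa> ^ r * (1 - \<kappa> ^ 2))"
  have G: "of_nat (Suc n) * G (Suc n) = (\<Sum>k\<le>n. of_nat (Suc k) * e k * G (n - k))" for n
  proof -
    have s1: "(\<Sum>k<n. (inverse \<kappa> ^ Suc k - \<kappa> ^ Suc k) * (inverse \<kappa> ^ (n - k) * (1 - \<kappa> ^ 2)))
       = of_nat n * inverse \<kappa> ^ Suc n * (1 - \<kappa> ^ 2) - inverse \<kappa> ^ Suc n * (\<kappa> ^ 2 - \<kappa> ^ (2 * Suc n))"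
    proof -
      have "(inverse \<kappa> ^ Suc k - \<kappa> ^ Suc k) * (inverse \<kappa> ^ (n - k) * (1 - \<kappa> ^ 2))
        = inverse \<kappa> ^ Suc n * (1 - \<kappa> ^ 2) - inverse \<kappa> ^ Suc n * (\<kappa> ^ (2 * Suc k) - \<kappa> ^ (2 * Suc (Suc k)))"
        if "k < n" for k
      proof -
        have sq: "\<kappa> ^ (2 * i) = \<kappa> ^ i * \<kappa> ^ i" for i by (simp add: power_even_eq power2_eq_square)
        have "inverse \<kappa> ^ Suc n = inverse \<kappa> ^ Suc k * inverse \<kappa> ^ (n - k)"
          using that by (simp flip: power_add)
        moreover have "\<kappa> ^ Suc k * inverse \<kappa> ^ Suc k = 1"
          using \<kappa> by (simp del: power_Suc flip: power_mult_distrib)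
        moreover have "\<kappa> ^ (2 * Suc k) = \<kappa> ^ Suc k * \<kappa> ^ Suc k" "\<kappa> ^ (2 * Suc (Suc k)) = \<kappa> ^ Suc k * \<kappa> ^ Suc k * \<kappa> ^ 2"
          unfolding sq by (simp_all add: power2_eq_square mult_ac)
        moreover have "(p - P) * (r * (1 - t)) = p * r * (1 - t) - p * r * (P * P - P * P * t)"
          if "P * p = 1" for p P r t :: "'f rq"
        proof -
          have "p * r * (P * P - P * P * t) = (P * p) * (r * (P * (1 - t)))" by (simp add: algebra_simps)
          then show ?thesis unfolding that by (simp add: algebra_simps)
        qed
        ultimately show ?thesis by metis
      qed
      then have "(\<Sum>k<n. (inverse \<kappa> ^ Suc k - \<kappa> ^ Suc k) * (inverse \<kappa> ^ (n - k) * (1 - \<kappa> ^ 2)))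
        = (\<Sum>k<n. inverse \<kappa> ^ Suc n * (1 - \<kappa> ^ 2) - inverse \<kappa> ^ Suc n * (\<kappa> ^ (2 * Suc k) - \<kappa> ^ (2 * Suc (Suc k))))"
        by (intro sum.cong) auto
      also have "\<dots> = of_nat n * inverse \<kappa> ^ Suc n * (1 - \<kappa> ^ 2)
          - inverse \<kappa> ^ Suc n * (\<Sum>k<n. \<kappa> ^ (2 * Suc k) - \<kappa> ^ (2 * Suc (Suc k)))"
        by (simp only: sum_subtractf sum_distrib_left[symmetric] sum_constant card_lessThan mult.assoc) (simp only: right_diff_distrib mult_ac mult_1_right)
      also have "(\<Sum>k<n. \<kappa> ^ (2 * Suc k) - \<kappa> ^ (2 * Suc (Suc k))) = \<kappa> ^ 2 - \<kappa> ^ (2 * Suc n)"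
        using sum_lessThan_telescope'[of "\<lambda>k. \<kappa> ^ (2 * Suc k)" n] by simp
      finally show ?thesis .
    qed
    have s2: "(\<Sum>k\<le>n. of_nat (Suc k) * e k * G (n - k))
      = (inverse \<kappa> ^ Suc n - \<kappa> ^ Suc n) + (\<Sum>k<n. (inverse \<kappa> ^ Suc k - \<kappa> ^ Suc k) * (inverse \<kappa> ^ (n - k) * (1 - \<kappa> ^ 2)))"
      unfolding e lessThan_Suc_atMost[symmetric] sum.lessThan_Suc by (simp add: G_def)
    have s3: "inverse \<kappa> ^ Suc n * \<kappa> ^ (2 * Suc n) = \<kappa> ^ Suc n"
    proof -
      have "\<kappa> ^ (2 * Suc n) = \<kappa> ^ Suc n * \<kappa> ^ Suc n" unfolding mult_2 power_add ..
      then show ?thesis using \<kappa> by (simp add: power_inverse del: power_Suc)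
    qed
    have s4: "p - P + (of_nat n * p * (1 - t) - p * (t - u)) = of_nat (Suc n) * (p * (1 - t))"
      if "p * u = P" for p P t u :: "'f rq"
      using that by (simp add: algebra_simps)
    have s5: "G (Suc n) = inverse \<kappa> ^ Suc n * (1 - \<kappa> ^ 2)" by (simp add: G_def)
    show ?thesis unfolding s2 s1 s5 by (rule s4[OF s3, symmetric])
  qed
  have G0: "G 0 = 1" by (simp add: G_def)
  note cur = expop_current[where Hs = Hs and Y = Y and e = e and \<delta> = \<delta> and G = G, OF H Y HY G0 G]
  let ?Z = "\<lambda>r. Y (l + \<delta> * int (Suc r)) (expop Hs (n - r) a)"
  have 1: "expop Hs n (Y (l + \<delta>) a) = (\<Sum>r\<le>n. G r *\<^sub>N ?Z r)"
    unfolding cur by (simp add: algebra_simps)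
  have 2: "expop Hs (Suc n) (Y l a) = Y l (expop Hs (Suc n) a) + (\<Sum>r\<le>n. G (Suc r) *\<^sub>N ?Z r)"
    unfolding cur by (subst sum.atMost_Suc_shift) (simp add: G0)
  have "(\<Sum>r\<le>n. G r *\<^sub>N ?Z r) - \<kappa> *\<^sub>N (\<Sum>r\<le>n. G (Suc r) *\<^sub>N ?Z r)
    = (\<Sum>r\<le>n. (G r - \<kappa> * G (Suc r)) *\<^sub>N ?Z r)"
    by (simp add: N.scale_sum_right N.scale_left_diff_distrib sum_subtractf)
  also have "\<dots> = (\<Sum>r\<le>n. if r = 0 then \<kappa> ^ 2 *\<^sub>N ?Z 0 else 0)"
    using \<kappa> by (intro sum.cong) (auto simp: G_def field_simps)
  also have "\<dots> = \<kappa> ^ 2 *\<^sub>N Y (l + \<delta>) (expop Hs n a)" by simp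
  finally show ?thesis unfolding 1 2 by (simp add: N.scale_right_distrib algebra_simps)
qed

subsection \<open>The currents\<close>

definition Kop :: "int \<Rightarrow> 'f::field_char_0 nm \<Rightarrow> 'f nm" where
  "Kop h a = qq powi h *\<^sub>N grading (qq powi (- 2)) 1 a"

definition Kop' :: "int \<Rightarrow> 'f::field_char_0 nm \<Rightarrow> 'f nm" where
  "Kop' h a = qq powi (- h) *\<^sub>N grading (qq powi 2) 1 a"

lemma Kop_lin: "lin (Kop h)" and Kop'_lin: "lin (Kop' h)"
  by (rule linI; simp add: Kop_def Kop'_def lin_rules[OF grading_lin] N.scale_right_distrib mult_ac)+

definition psi_op :: "int \<Rightarrow> int \<Rightarrow> 'f::field_char_0 nm \<Rightarrow> 'f nm" where
  "psi_op h n a = (if n \<ge> 0 then Kop h (expop (\<lambda>j a. qeta *\<^sub>N Hop (int j) a) (nat n) a) else 0)"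

definition phi_op :: "int \<Rightarrow> int \<Rightarrow> 'f::field_char_0 nm \<Rightarrow> 'f nm" where
  "phi_op h n a = (if n \<le> 0 then Kop' h (expop (\<lambda>j a. (- qeta) *\<^sub>N Hop (- int j) a) (nat (- n)) a) else 0)"

definition Theta :: "int \<Rightarrow> int \<Rightarrow> 'f::field_char_0 nm \<Rightarrow> 'f nm" where
  "Theta h n a = inverse qeta *\<^sub>N (psi_op h n a - phi_op h n a)"

lemma scaled_Hop_lin: "lin (\<lambda>a. c *\<^sub>N Hop k a)"
  by (rule linI) (simp_all add: lin_rules[OF Hop_lin] N.scale_right_distrib mult_ac)

lemma psi_op_lin: "lin (psi_op h n)"
  unfolding psi_op_def
  by (rule linI) (auto simp: lin_rules[OF Kop_lin] lin_rules[OF expop_lin[OF scaled_Hop_lin]])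

lemma phi_op_lin: "lin (phi_op h n)"
  unfolding phi_op_def
  by (rule linI) (auto simp: lin_rules[OF Kop'_lin] lin_rules[OF expop_lin[OF scaled_Hop_lin]])

lemma Theta_lin: "lin (Theta h n)"
  unfolding Theta_def
  by (rule linI) (auto simp: lin_rules[OF psi_op_lin] lin_rules[OF phi_op_lin] N.scale_right_distrib
      N.scale_right_diff_distrib mult_ac)

text \<open>The family \<open>Y\<close> is \<open>x\<^sup>-\<close> for \<open>\<kappa> = q\<^sup>2\<close> and \<open>x\<^sup>+\<close> for \<open>\<kappa> = q\<^sup>-\<^sup>2\<close>. Both \<open>\<psi>\<close> and \<open>\<phi>\<close> satisfy the relation, since they
  are expansions of the same rational function at \<open>\<infinity>\<close> and at 0. So does their difference \<open>Theta\<close>.\<close>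

lemma Theta_current:
  assumes Y: "\<And>l. lin (Y l)" and \<kappa>: "\<kappa> = qq powi (2 * \<sigma>)" and \<sigma>: "\<sigma> = 1 \<or> \<sigma> = - 1"
    and HY: "\<And>k l a. Hop k (Y l a) = Y l (Hop k a) - (of_int \<sigma> * hcoef k) *\<^sub>N Y (l + k) a"
    and KY: "\<And>l a. Kop h (Y l a) = inverse \<kappa> *\<^sub>N Y l (Kop h a)" "\<And>l a. Kop' h (Y l a) = \<kappa> *\<^sub>N Y l (Kop' h a)"
  shows "Theta h n (Y (l + 1) a) - \<kappa> *\<^sub>N Theta h (n + 1) (Y l a)
     + Y l (Theta h (n + 1) a) - \<kappa> *\<^sub>N Y (l + 1) (Theta h n (a :: 'f::field_char_0 nm)) = 0"
proof -
  have \<kappa>0: "\<kappa> \<noteq> 0" using qq_nonzero[where 'f='f] by (simp add: \<kappa>)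
  define z where "z = (qq powi 2 :: 'f rq)"
  have hcoef: "of_nat (Suc j) * (qeta * hcoef (int (Suc j))) = z ^ Suc j - inverse z ^ Suc j" for j
  proof -
    have "qq powi (2 * int (Suc j)) = z ^ Suc j" "qq powi (- 2 * int (Suc j)) = inverse z ^ Suc j"
      unfolding z_def power_int_mult by (simp_all only: power_int_of_nat power_int_minus)
    then show ?thesis using hcoef_eq[of "Suc j", where 'f='f] by simp
  qed
  have \<kappa>_cases: "\<sigma> = 1 \<and> \<kappa> = z \<or> \<sigma> = - 1 \<and> \<kappa> = inverse z"
    using \<sigma> by (auto simp: \<kappa> z_def power_int_minus)
  have e: "of_nat (Suc j) * (- (qeta * of_int \<sigma> * hcoef (int (Suc j)))) = inverse \<kappa> ^ Suc j - \<kappa> ^ Suc j" for j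
  proof -
    have "of_nat (Suc j) * (- (qeta * of_int \<sigma> * hcoef (int (Suc j))))
      = - of_int \<sigma> * (of_nat (Suc j) * (qeta * hcoef (int (Suc j))))" by (simp only: mult_ac mult_minus_left mult_minus_right)
    also have "\<dots> = inverse \<kappa> ^ Suc j - \<kappa> ^ Suc j" unfolding hcoef using \<kappa>_cases by auto
    finally show ?thesis .
  qed
  have e': "of_nat (Suc j) * (qeta * of_int \<sigma> * hcoef (- int (Suc j))) = inverse (inverse \<kappa>) ^ Suc j - inverse \<kappa> ^ Suc j" for j
  proof -
    have "of_nat (Suc j) * (qeta * of_int \<sigma> * hcoef (- int (Suc j)))
      = of_int \<sigma> * (of_nat (Suc j) * (qeta * hcoef (int (Suc j))))" by (simp only: mult_ac hcoef_minus)
    also have "\<dots> = inverse (inverse \<kappa>) ^ Suc j - inverse \<kappa> ^ Suc j" unfolding hcoef using \<kappa>_cases by auto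
    finally show ?thesis .
  qed
  let ?E = "expop (\<lambda>j a. qeta *\<^sub>N Hop (int j) (a :: 'f nm))"
  let ?F = "expop (\<lambda>j a. (- qeta) *\<^sub>N Hop (- int j) (a :: 'f nm))"
  have E: "?E n (Y (l + 1) a) - \<kappa> *\<^sub>N ?E (Suc n) (Y l a)
    = \<kappa> ^ 2 *\<^sub>N Y (l + 1) (?E n a) - \<kappa> *\<^sub>N Y l (?E (Suc n) a)" for n l a
    by (rule expop_current_two_term[OF scaled_Hop_lin Y \<kappa>0 _ e])
       (simp add: HY lin_rules[OF Y] N.scale_right_diff_distrib mult_ac)
  have F: "?F n (Y (l + - 1) a) - inverse \<kappa> *\<^sub>N ?F (Suc n) (Y l a)
    = inverse \<kappa> ^ 2 *\<^sub>N Y (l + - 1) (?F n a) - inverse \<kappa> *\<^sub>N Y l (?F (Suc n) a)" for n l a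
  proof (rule expop_current_two_term[OF scaled_Hop_lin Y _ _ e'])
    show "inverse \<kappa> \<noteq> 0" using \<kappa>0 by simp
    show "(- qeta) *\<^sub>N Hop (- int (Suc j)) (Y l a) = Y l ((- qeta) *\<^sub>N Hop (- int (Suc j)) a)
        + (qeta * of_int \<sigma> * hcoef (- int (Suc j))) *\<^sub>N Y (l + - 1 * int (Suc j)) a" for j l a
      by (simp only: HY lin_rules[OF Y] N.scale_right_diff_distrib N.scale_scale mult_1_left mult_minus_left
          N.scale_minus_left diff_minus_eq_add mult.assoc)
  qed
  have psi: "psi_op h n (Y (l + 1) a) - \<kappa> *\<^sub>N psi_op h (n + 1) (Y l a)
     + Y l (psi_op h (n + 1) a) - \<kappa> *\<^sub>N Y (l + 1) (psi_op h n a) = 0"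
  proof -
    consider "n \<ge> 0" | "n = - 1" | "n < - 1" by linarith
    then show ?thesis
    proof cases
      case 1
      then have p: "psi_op h n b = Kop h (?E (nat n) b)" "psi_op h (n + 1) b = Kop h (?E (Suc (nat n)) b)" for b
        by (simp_all add: psi_op_def nat_add_distrib)
      show ?thesis using arg_cong[OF E[of "nat n" l a], of "Kop h"] \<kappa>0
        unfolding p by (simp add: lin_rules[OF Kop_lin] KY lin_rules[OF Y] power2_eq_square algebra_simps)
    next
      case 2 then show ?thesis using \<kappa>0 by (simp add: psi_op_def KY lin_rules[OF Y])
    next
      case 3 then show ?thesis by (simp add: psi_op_def lin_rules[OF Y])
    qed
  qed
  have phi: "phi_op h n (Y (l + 1) a) - \<kappa> *\<^sub>N phi_op h (n + 1) (Y l a)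
     + Y l (phi_op h (n + 1) a) - \<kappa> *\<^sub>N Y (l + 1) (phi_op h n a) = 0"
  proof -
    consider "n < 0" | "n = 0" | "n > 0" by linarith
    then show ?thesis
    proof cases
      case 1
      have \<kappa>1: "\<kappa> * (\<kappa> * (inverse \<kappa> * inverse \<kappa>)) = 1" using \<kappa>0 by (simp add: field_simps)
      have "nat (- n) = Suc (nat (- n - 1))" using 1 by simp
      with 1 have p: "phi_op h n b = Kop' h (?F (Suc (nat (- n - 1))) b)" "phi_op h (n + 1) b = Kop' h (?F (nat (- n - 1)) b)" for b
        by (simp_all add: phi_op_def)
      show ?thesis using arg_cong[OF F[of "nat (- n - 1)" "l + 1" a], of "\<lambda>b. \<kappa> *\<^sub>N Kop' h b"] \<kappa>0 \<kappa>1
        unfolding p by (simp add: lin_rules[OF Kop'_lin] KY lin_rules[OF Y] power2_eq_square N.scale_right_diff_distrib algebra_simps)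
    next
      case 2 then show ?thesis using \<kappa>0 by (simp add: phi_op_def KY lin_rules[OF Y])
    next
      case 3 then show ?thesis by (simp add: phi_op_def lin_rules[OF Y])
    qed
  qed
  have "Theta h n (Y (l + 1) a) - \<kappa> *\<^sub>N Theta h (n + 1) (Y l a)
     + Y l (Theta h (n + 1) a) - \<kappa> *\<^sub>N Y (l + 1) (Theta h n a)
    = inverse qeta *\<^sub>N ((psi_op h n (Y (l + 1) a) - \<kappa> *\<^sub>N psi_op h (n + 1) (Y l a)
     + Y l (psi_op h (n + 1) a) - \<kappa> *\<^sub>N Y (l + 1) (psi_op h n a))
     - (phi_op h n (Y (l + 1) a) - \<kappa> *\<^sub>N phi_op h (n + 1) (Y l a)
     + Y l (phi_op h (n + 1) a) - \<kappa> *\<^sub>N Y (l + 1) (phi_op h n a)))"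
    by (simp add: Theta_def lin_rules[OF Y] N.scale_right_diff_distrib N.scale_right_distrib mult_ac)
  then show ?thesis unfolding psi phi by simp
qed

lemma grading_commute: "w \<noteq> 0 \<Longrightarrow> w' \<noteq> 0 \<Longrightarrow> grading z w (grading z' w' a) = grading z' w' (grading z w a)"
  by (simp add: grading_grading mult.commute)

lemma psi_op_Hop: "Hop k (psi_op h n a) = psi_op h n (Hop k a)"
  by (simp add: psi_op_def Kop_def lin_rules[OF Hop_lin] lin_rules[OF scaled_Hop_lin] Hop_Hop
      expop_commute[OF scaled_Hop_lin Hop_lin] flip: grading_Hop[where w = 1, simplified])

lemma phi_op_Hop: "Hop k (phi_op h n a) = phi_op h n (Hop k a)"
  by (simp add: phi_op_def Kop'_def lin_rules[OF Hop_lin] lin_rules[OF scaled_Hop_lin] Hop_Hop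
      expop_commute[OF scaled_Hop_lin Hop_lin] flip: grading_Hop[where w = 1, simplified])

lemma Theta_Hop: "Hop k (Theta h n a) = Theta h n (Hop k a)"
  by (simp add: Theta_def lin_rules[OF Hop_lin] psi_op_Hop phi_op_Hop)

lemma psi_op_grading:
  assumes w: "w \<noteq> 0"
  shows "grading z w (psi_op h n a) = w powi n *\<^sub>N psi_op h n (grading z w (a :: 'f::field_char_0 nm))"
proof (cases "n \<ge> 0")
  case True
  let ?E = "expop (\<lambda>j a. qeta *\<^sub>N Hop (int j) (a :: 'f nm))"
  have "grading z w (?E m a) = w ^ m *\<^sub>N ?E m (grading z w a)" for m
    by (rule expop_twist[OF scaled_Hop_lin grading_lin[OF w]])
       (simp only: lin_rules[OF grading_lin[OF w]] grading_Hop[OF w] N.scale_scale power_int_of_nat mult.commute)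
  moreover have "grading z w (Kop h b) = Kop h (grading z w b)" for b
    by (simp only: Kop_def lin_rules[OF grading_lin[OF w]] grading_commute[OF w one_neq_zero])
  ultimately show ?thesis using True by (simp only: psi_op_def if_True lin_rules[OF Kop_lin] power_int_def)
qed (simp add: psi_op_def lin_rules[OF grading_lin[OF w]])

lemma phi_op_grading:
  assumes w: "w \<noteq> 0"
  shows "grading z w (phi_op h n a) = w powi n *\<^sub>N phi_op h n (grading z w (a :: 'f::field_char_0 nm))"
proof (cases "n \<le> 0")
  case True
  let ?E = "expop (\<lambda>j a. (- qeta) *\<^sub>N Hop (- int j) (a :: 'f nm))"
  have "grading z w (?E m a) = inverse w ^ m *\<^sub>N ?E m (grading z w a)" for m
    by (rule expop_twist[OF scaled_Hop_lin grading_lin[OF w]])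
       (simp only: lin_rules[OF grading_lin[OF w]] grading_Hop[OF w] N.scale_scale power_int_of_nat power_int_minus
          power_inverse mult.commute)
  moreover have "grading z w (Kop' h b) = Kop' h (grading z w b)" for b
    by (simp only: Kop'_def lin_rules[OF grading_lin[OF w]] grading_commute[OF w one_neq_zero])
  moreover have "w powi n = inverse w ^ nat (- n)" using True by (simp add: power_int_def)
  ultimately show ?thesis using True by (simp only: phi_op_def if_True lin_rules[OF Kop'_lin])
qed (simp add: phi_op_def lin_rules[OF grading_lin[OF w]])

lemma Theta_grading: "w \<noteq> 0 \<Longrightarrow> grading z w (Theta h n a) = w powi n *\<^sub>N Theta h n (grading z w a)"
  by (simp add: Theta_def lin_rules[OF grading_lin] psi_op_grading phi_op_grading N.scale_right_diff_distrib mult_ac)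

lemma gen_lin: "lin (\<lambda>a. nm_gen m * a)"
  by (rule linI) (simp_all add: distrib_left)

lemma Kop_gen: "Kop h (nm_gen l * a) = inverse (qq ^ 2) *\<^sub>N (nm_gen l * Kop h a)"
  and Kop'_gen: "Kop' h (nm_gen l * a) = qq ^ 2 *\<^sub>N (nm_gen l * Kop' h a)"
  by (simp_all add: Kop_def Kop'_def grading_gen power_int_minus mult_ac)

lemma Theta_gen:
  "Theta h n (nm_gen (l + 1) * a) - qq ^ 2 *\<^sub>N Theta h (n + 1) (nm_gen l * a)
     + nm_gen l * Theta h (n + 1) a - qq ^ 2 *\<^sub>N (nm_gen (l + 1) * Theta h n a) = 0"
  by (rule Theta_current[where Y = "\<lambda>l a. nm_gen l * a" and \<sigma> = 1])
     (simp_all add: gen_lin Hop_gen Kop_gen Kop'_gen)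

text \<open>The operator \<open>x\<^sup>+\<^sub>k\<close> is again a second component of an action on pairs: it kills 1 and its commutator with
\<open>x\<^sup>-\<^sub>m\<close> is \<open>Theta (k + m)\<close>. The relations hold because of \<open>Theta_gen\<close>.\<close>

lemma raising_exists:
  "\<exists>f. lin f \<and> f 1 = 0 \<and> (\<forall>m a. f (nm_gen m * a) = nm_gen m * f a + Theta h (k + m) (a :: 'f::field_char_0 nm))"
proof -
  define s :: "'f rq \<Rightarrow> 'f nm \<times> 'f nm \<Rightarrow> 'f nm \<times> 'f nm" where "s = (\<lambda>c (a, b). (c *\<^sub>N a, c *\<^sub>N b))"
  define T where "T = (\<lambda>m (a, b). (nm_gen m * a, nm_gen m * b + Theta h (k + m) (a :: 'f nm)))"
  have act: "free_action UNIV s T"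
    by standard (auto simp: s_def T_def split_beta N.scale_left_distrib N.scale_right_distrib
        algebra_simps lin_rules[OF Theta_lin])
  have rel: "T l (T (n + 1) y) - s (qq ^ 2) (T (n + 1) (T l y))
      - (s (qq ^ 2) (T (l + 1) (T n y)) - T n (T (l + 1) y)) = 0" for l n y
  proof (cases y)
    case (Pair a b)
    let ?R = "\<lambda>l n a. nm_gen l * (nm_gen (n + 1) * a) - qq ^ 2 *\<^sub>N (nm_gen (n + 1) * (nm_gen l * a))
      - (qq ^ 2 *\<^sub>N (nm_gen (l + 1) * (nm_gen n * a)) - nm_gen n * (nm_gen (l + 1) * a)) :: 'f nm"
    let ?C = "\<lambda>n l. Theta h n (nm_gen (l + 1) * a) - qq ^ 2 *\<^sub>N Theta h (n + 1) (nm_gen l * a)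
     + nm_gen l * Theta h (n + 1) a - qq ^ 2 *\<^sub>N (nm_gen (l + 1) * Theta h n a)"
    have "T l (T (n + 1) y) - s (qq ^ 2) (T (n + 1) (T l y))
      - (s (qq ^ 2) (T (l + 1) (T n y)) - T n (T (l + 1) y))
      = (?R l n a, ?R l n b + (?C (k + l) n + ?C (k + n) l))"
      by (simp add: Pair s_def T_def algebra_simps N.scale_right_distrib N.scale_right_diff_distrib)
    also have "\<dots> = 0" unfolding nm_rel Theta_gen by (simp add: zero_prod_def)
    finally show ?thesis .
  qed
  obtain f where f: "\<And>a b. f (a + b) = f a + f b" "\<And>c a. f (c *\<^sub>N a) = s c (f a)"
    "f 1 = (1, 0)" "\<And>m a. f (nm_gen m * a) = T m (f a)"
    by (rule nm_recursor[OF act UNIV_I rel, of "(1, 0)"]) (rule that)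
  have fst: "fst (f a) = a" for a
    by (induction a rule: nm_induct) (simp_all add: f s_def T_def split_beta)
  show ?thesis
    by (rule exI[of _ "snd \<circ> f"]) (simp add: lin_def f s_def T_def split_beta fst)
qed

definition Pop :: "int \<Rightarrow> int \<Rightarrow> 'f::field_char_0 nm \<Rightarrow> 'f nm" where
  "Pop h k = (SOME f. lin f \<and> f 1 = 0 \<and> (\<forall>m a. f (nm_gen m * a) = nm_gen m * f a + Theta h (k + m) a))"

lemma Pop_lin: "lin (Pop h k)" and Pop_one [simp]: "Pop h k 1 = 0"
  and Pop_gen: "Pop h k (nm_gen m * a) = nm_gen m * Pop h k a + Theta h (k + m) a"
  using someI_ex[OF raising_exists[of h k]] unfolding Pop_def by blast+

lemma Pop_Hop: "Hop k (Pop h l a) = Pop h l (Hop k a) + hcoef k *\<^sub>N Pop h (l + k) a"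
  by (induction a rule: nm_induct)
     (simp_all add: lin_rules[OF Hop_lin] lin_rules[OF Pop_lin] Hop_gen Pop_gen Theta_Hop
       algebra_simps N.scale_right_distrib)

lemma Pop_grading: "z \<noteq> 0 \<Longrightarrow> w \<noteq> 0 \<Longrightarrow> grading z w (Pop h k a) = (inverse z * w powi k) *\<^sub>N Pop h k (grading z w a)"
  by (induction a rule: nm_induct)
     (simp_all add: lin_rules[OF grading_lin] lin_rules[OF Pop_lin] grading_gen Pop_gen Theta_grading
       N.scale_right_distrib power_int_add field_simps)

lemma Theta_Pop:
  "Theta h n (Pop h' (l + 1) a) - inverse (qq ^ 2) *\<^sub>N Theta h (n + 1) (Pop h' l a)
     + Pop h' l (Theta h (n + 1) a) - inverse (qq ^ 2) *\<^sub>N Pop h' (l + 1) (Theta h n (a :: 'f::field_char_0 nm)) = 0"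
  by (rule Theta_current[where Y = "Pop h'" and \<sigma> = "- 1"])
     (use qq_nonzero[where 'f='f] in \<open>simp_all add: Pop_lin Pop_Hop Kop_def Kop'_def Pop_grading lin_rules[OF Pop_lin] power_int_minus mult_ac\<close>)

text \<open>The relation between the \<open>x\<^sup>+\<^sub>k\<close> holds on 1, where both sides vanish, and it propagates, because its
commutator with \<open>x\<^sup>-\<^sub>m\<close> is a sum of two instances of \<open>Theta_Pop\<close>.\<close>

lemma Pop_Pop:
  "Pop h (k + 1) (Pop h l a) - qq ^ 2 *\<^sub>N Pop h l (Pop h (k + 1) a)
    - (qq ^ 2 *\<^sub>N Pop h k (Pop h (l + 1) a) - Pop h (l + 1) (Pop h k (a :: 'f::field_char_0 nm))) = 0"
proof (induction a rule: nm_induct)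
  case one show ?case by (simp add: lin_rules[OF Pop_lin])
next
  case (scl c a)
  have "Pop h (k + 1) (Pop h l (c *\<^sub>N a)) - qq ^ 2 *\<^sub>N Pop h l (Pop h (k + 1) (c *\<^sub>N a))
    - (qq ^ 2 *\<^sub>N Pop h k (Pop h (l + 1) (c *\<^sub>N a)) - Pop h (l + 1) (Pop h k (c *\<^sub>N a)))
   = c *\<^sub>N (Pop h (k + 1) (Pop h l a) - qq ^ 2 *\<^sub>N Pop h l (Pop h (k + 1) a)
    - (qq ^ 2 *\<^sub>N Pop h k (Pop h (l + 1) a) - Pop h (l + 1) (Pop h k a)))"
    by (simp add: lin_rules[OF Pop_lin] N.scale_right_diff_distrib N.scale_right_distrib mult_ac)
  then show ?case using scl by simp
next
  case (add a b)
  then show ?case by (simp add: lin_rules[OF Pop_lin] N.scale_right_distrib) (simp add: algebra_simps add_eq_0_iff)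
next
  case (gen m a)
  let ?C = "\<lambda>n l. Theta h n (Pop h (l + 1) a) - inverse (qq ^ 2) *\<^sub>N Theta h (n + 1) (Pop h l a)
     + Pop h l (Theta h (n + 1) a) - inverse (qq ^ 2) *\<^sub>N Pop h (l + 1) (Theta h n a)"
  have "Pop h (k + 1) (Pop h l (nm_gen m * a)) - qq ^ 2 *\<^sub>N Pop h l (Pop h (k + 1) (nm_gen m * a))
    - (qq ^ 2 *\<^sub>N Pop h k (Pop h (l + 1) (nm_gen m * a)) - Pop h (l + 1) (Pop h k (nm_gen m * a)))
    = nm_gen m * (Pop h (k + 1) (Pop h l a) - qq ^ 2 *\<^sub>N Pop h l (Pop h (k + 1) a)
    - (qq ^ 2 *\<^sub>N Pop h k (Pop h (l + 1) a) - Pop h (l + 1) (Pop h k a)))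
    - qq ^ 2 *\<^sub>N (?C (k + m) l + ?C (l + m) k)"
    using qq_nonzero[where 'f='f]
    by (simp add: Pop_gen lin_rules[OF Pop_lin] N.scale_right_distrib N.scale_right_diff_distrib algebra_simps)
  also have "\<dots> = 0" unfolding Theta_Pop gen by simp
  finally show ?case .
qed

section \<open>The action of the quantum affine algebra on \<open>\<N>\<close>\<close>

fun Uop :: "weight \<Rightarrow> ugen \<Rightarrow> 'f::field_char_0 nm \<Rightarrow> 'f nm" where
  "Uop \<mu> (Xp k) = Pop (at_h \<mu>) k"
| "Uop \<mu> (Xm k) = (\<lambda>a. nm_gen k * a)"
| "Uop \<mu> (Hh k) = Hop k"
| "Uop \<mu> Kp = Kop (at_h \<mu>)"
| "Uop \<mu> Km = Kop' (at_h \<mu>)"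
| "Uop \<mu> Dp = (\<lambda>a. qq powi at_d \<mu> *\<^sub>N grading 1 qq a)"
| "Uop \<mu> Dm = (\<lambda>a. qq powi (- at_d \<mu>) *\<^sub>N grading 1 (inverse qq) a)"
| "Uop \<mu> Gp = (\<lambda>a. a)"
| "Uop \<mu> Gm = (\<lambda>a. a)"

lemma Uop_lin: "lin (Uop \<mu> g :: 'f::field_char_0 nm \<Rightarrow> 'f nm)"
  using qq_nonzero[where 'f='f]
  by (cases g)
     (auto simp: Pop_lin gen_lin Hop_lin Kop_lin Kop'_lin intro!: linI
       simp: lin_rules[OF grading_lin] N.scale_right_distrib mult_ac)

interpretation U: free_action UNIV scl "Uop \<mu> :: ugen \<Rightarrow> 'f::field_char_0 nm \<Rightarrow> 'f nm" for \<mu>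
  by standard (simp_all add: lin_rules[OF Uop_lin] N.scale_left_distrib N.scale_right_distrib)

lemma U_act_sum: "U.act \<mu> (sum f A) y = (\<Sum>i\<in>A. U.act \<mu> (f i) y)"
  by (induction A rule: infinite_finite_induct) (simp_all add: U.act_zero U.act_add)

text \<open>Let \<open>C i n\<close> be the coefficient of \<open>t\<^sup>n\<close> in the \<open>i\<close>-th power of the exponent. The rule for the derivative of
a power (\<open>P\<close> in the proof), valid because the \<open>Hs\<^sub>j\<close> commute, shows that the exponential series satisfies the
recursion of \<open>expop\<close>.\<close>

lemma U_act_exp:
  assumes B0: "B $ 0 = 0" and B: "\<And>j a. U.act \<mu> (B $ j) a = Hs j a"
    and H: "\<And>j. lin (Hs j)" and HH: "\<And>i j a. Hs i (Hs j a) = Hs j (Hs i a)"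
  shows "U.act \<mu> ((fps_exp_series oo B) $ n) a = expop Hs n (a :: 'f::field_char_0 nm)"
proof -
  define C where "C = (\<lambda>i n. U.act \<mu> ((B ^ i) $ n) a)"
  have C0: "C 0 n = (if n = 0 then a else 0)" for n
    by (simp add: C_def U.act_zero U.act_one)
  have CS: "C (Suc i) n = (\<Sum>j\<le>n. Hs j (C i (n - j)))" for i n
    by (simp add: C_def fps_mult_nth U_act_sum U.act_mult B atLeast0AtMost)
  have Hs0: "Hs 0 b = 0" for b using B[of 0 b] by (simp add: B0 U.act_zero)
  have C_big: "C i n = 0" if "n < i" for i n
    using that
  proof (induction i arbitrary: n)
    case (Suc i)
    have "Hs j (C i (n - j)) = 0" if "j \<le> n" for j
      using Suc.prems Suc.IH[of "n - j"] that by (cases "j = 0") (auto simp: Hs0 lin_zero[OF H])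
    then show ?case by (simp add: CS)
  qed simp
  have P: "of_nat n *\<^sub>N C (Suc i) n = of_nat (Suc i) *\<^sub>N (\<Sum>j\<le>n. of_nat j *\<^sub>N Hs j (C i (n - j)))" for i n
  proof (induction i arbitrary: n)
    case 0
    have "Hs j (C 0 (n - j)) = (if j = n then Hs n a else 0)" if "j \<le> n" for j
      using that by (simp add: C0 lin_zero[OF H])
    then have "C (Suc 0) n = Hs n a" "(\<Sum>j\<le>n. of_nat j *\<^sub>N Hs j (C 0 (n - j))) = of_nat n *\<^sub>N Hs n a"
      by (simp_all add: CS cong: sum.cong_simp) (simp add: if_distrib cong: if_cong)
    then show ?case by simp
  next
    case (Suc i)
    have "of_nat n *\<^sub>N C (Suc (Suc i)) n = (\<Sum>j\<le>n. of_nat n *\<^sub>N Hs j (C (Suc i) (n - j)))"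
      by (simp add: CS[of "Suc i"] N.scale_sum_right)
    also have "\<dots> = (\<Sum>j\<le>n. of_nat j *\<^sub>N Hs j (C (Suc i) (n - j)) + Hs j (of_nat (n - j) *\<^sub>N C (Suc i) (n - j)))"
    proof (intro sum.cong refl)
      fix j assume "j \<in> {..n}"
      then have "of_nat n = (of_nat j + of_nat (n - j) :: 'f rq)" by (simp flip: of_nat_add)
      then show "of_nat n *\<^sub>N Hs j (C (Suc i) (n - j)) = of_nat j *\<^sub>N Hs j (C (Suc i) (n - j)) + Hs j (of_nat (n - j) *\<^sub>N C (Suc i) (n - j))"
        by (simp only: N.scale_left_distrib lin_rules[OF H])
    qed
    also have "\<dots> = (\<Sum>j\<le>n. of_nat j *\<^sub>N Hs j (C (Suc i) (n - j))) + (\<Sum>j\<le>n. Hs j (of_nat (n - j) *\<^sub>N C (Suc i) (n - j)))"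
      by (rule sum.distrib)
    also have "(\<Sum>j\<le>n. Hs j (of_nat (n - j) *\<^sub>N C (Suc i) (n - j)))
      = of_nat (Suc i) *\<^sub>N (\<Sum>j\<le>n. \<Sum>l\<le>n - j. of_nat l *\<^sub>N Hs l (Hs j (C i (n - j - l))))"
      unfolding Suc.IH by (simp only: lin_rules[OF H] N.scale_sum_right N.scale_scale mult.commute HH)
    also have "(\<Sum>j\<le>n. \<Sum>l\<le>n - j. of_nat l *\<^sub>N Hs l (Hs j (C i (n - j - l))))
      = (\<Sum>l\<le>n. \<Sum>j\<le>n - l. of_nat l *\<^sub>N Hs l (Hs j (C i (n - j - l))))" by (rule triangle_swap)
    also have "\<dots> = (\<Sum>l\<le>n. of_nat l *\<^sub>N Hs l (C (Suc i) (n - l)))"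
      by (simp only: CS lin_rules[OF H] N.scale_sum_right diff_commute)
    finally show ?case by (simp only: of_nat_Suc[of "Suc i"] N.scale_left_distrib N.scale_one)
  qed
  define Z where "Z = (\<lambda>n. \<Sum>i\<le>n. inverse (of_nat (fact i)) *\<^sub>N C i n)"
  have Z_big: "(\<Sum>i\<le>m. inverse (of_nat (fact i)) *\<^sub>N C i n) = Z n" if "n \<le> m" for n m
    unfolding Z_def using that C_big by (intro sum.mono_neutral_right) auto
  have Z_ode: "of_nat (Suc n) *\<^sub>N Z (Suc n) = (\<Sum>k\<le>n. of_nat (Suc k) *\<^sub>N Hs (Suc k) (Z (n - k)))" for n
  proof -
    have "of_nat (Suc n) *\<^sub>N Z (Suc n)
      = (\<Sum>i\<le>n. inverse (of_nat (fact (Suc i))) *\<^sub>N (of_nat (Suc n) *\<^sub>N C (Suc i) (Suc n)))"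
      unfolding Z_def by (subst sum.atMost_Suc_shift) (simp add: C0 N.scale_sum_right mult.commute del: of_nat_Suc fact_Suc)
    also have "\<dots> = (\<Sum>i\<le>n. inverse (of_nat (fact i)) *\<^sub>N (\<Sum>j\<le>Suc n. of_nat j *\<^sub>N Hs j (C i (Suc n - j))))"
    proof (intro sum.cong refl)
      fix i
      have "inverse (of_nat (fact (Suc i))) * of_nat (Suc i) = (inverse (of_nat (fact i)) :: 'f rq)"
        using of_nat_rq_nonzero[of "Suc i", where 'f='f]
        by (simp only: fact_Suc of_nat_mult of_nat_id inverse_mult_distrib) (simp del: of_nat_Suc)
      then show "inverse (of_nat (fact (Suc i))) *\<^sub>N (of_nat (Suc n) *\<^sub>N C (Suc i) (Suc n))
        = inverse (of_nat (fact i)) *\<^sub>N (\<Sum>j\<le>Suc n. of_nat j *\<^sub>N Hs j (C i (Suc n - j)))"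
        unfolding P by (simp only: N.scale_scale)
    qed
    also have "\<dots> = (\<Sum>i\<le>n. \<Sum>k\<le>n. inverse (of_nat (fact i)) *\<^sub>N (of_nat (Suc k) *\<^sub>N Hs (Suc k) (C i (n - k))))"
      by (subst sum.atMost_Suc_shift) (simp add: N.scale_sum_right del: of_nat_Suc)
    also have "\<dots> = (\<Sum>k\<le>n. \<Sum>i\<le>n. inverse (of_nat (fact i)) *\<^sub>N (of_nat (Suc k) *\<^sub>N Hs (Suc k) (C i (n - k))))"
      by (rule sum.swap)
    also have "\<dots> = (\<Sum>k\<le>n. of_nat (Suc k) *\<^sub>N Hs (Suc k) (\<Sum>i\<le>n. inverse (of_nat (fact i)) *\<^sub>N C i (n - k)))"
      by (simp add: lin_rules[OF H] N.scale_sum_right mult.commute del: of_nat_Suc)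
    also have "\<dots> = (\<Sum>k\<le>n. of_nat (Suc k) *\<^sub>N Hs (Suc k) (Z (n - k)))"
      by (simp add: Z_big del: of_nat_Suc)
    finally show ?thesis .
  qed
  have "Z n = expop Hs n a" for n
  proof (induction n rule: less_induct)
    case (less n)
    show ?case
    proof (cases n)
      case 0 then show ?thesis by (simp add: Z_def C0)
    next
      case (Suc m)
      have "of_nat (Suc m) *\<^sub>N Z (Suc m) = of_nat (Suc m) *\<^sub>N expop Hs (Suc m) a"
        unfolding Z_ode expop_ode using less Suc by (intro sum.cong) auto
      then show ?thesis using of_nat_rq_nonzero[of "Suc m", where 'f='f] Suc by (simp del: of_nat_Suc)
    qed
  qed
  moreover have "U.act \<mu> ((fps_exp_series oo B) $ n) a = Z n"
    by (simp add: fps_compose_nth fps_exp_series_def Z_def C_def U_act_sum U.act_mult U.act_fconst atLeast0AtMost)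
  ultimately show ?thesis by simp
qed

lemma U_act_psi: "U.act \<mu> (psi_el n) a = psi_op (at_h \<mu>) n a"
proof (cases "n \<ge> 0")
  case True
  have "U.act \<mu> (psi_series $ m) a = Kop (at_h \<mu>) (expop (\<lambda>j a. qeta *\<^sub>N Hop (int j) a) m a)" for m
    unfolding psi_series_def fps_mult_left_const_nth U.act_mult[OF UNIV_I]
    by (subst U_act_exp[where Hs = "\<lambda>j a. qeta *\<^sub>N Hop (int j) a"])
       (auto simp: scaled_Hop_lin Hop_Hop Hop_0 lin_rules[OF Hop_lin] U.act_zero U.act_mult U.act_fconst U.act_fgen mult.commute)
  then show ?thesis using True by (simp add: psi_el_def psi_op_def)
qed (simp add: psi_el_def psi_op_def U.act_zero)

lemma U_act_phi: "U.act \<mu> (phi_el n) a = phi_op (at_h \<mu>) n a"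
proof (cases "n \<le> 0")
  case True
  have "U.act \<mu> (phi_series $ m) a = Kop' (at_h \<mu>) (expop (\<lambda>j a. (- qeta) *\<^sub>N Hop (- int j) a) m a)" for m
    unfolding phi_series_def fps_mult_left_const_nth U.act_mult[OF UNIV_I]
    by (subst U_act_exp[where Hs = "\<lambda>j a. (- qeta) *\<^sub>N Hop (- int j) a"])
       (auto simp: scaled_Hop_lin Hop_Hop Hop_0 lin_rules[OF Hop_lin] U.act_zero U.act_mult U.act_uminus U.act_fconst U.act_fgen mult.commute
         simp del: minus_diff_eq simp flip: N.scale_minus_left)
  then show ?thesis using True by (simp add: phi_el_def phi_op_def)
qed (simp add: phi_el_def phi_op_def U.act_zero)

lemma U_act_gam: "U.act \<mu> (gam n) a = a"
proof -
  have "U.act \<mu> (fgen Gp ^ k) a = a" "U.act \<mu> (fgen Gm ^ k) a = a" for k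
    by (induction k) (simp_all add: U.act_one U.act_mult U.act_fgen)
  then show ?thesis by (simp add: gam_def)
qed

lemma U_act_rels:
  assumes "r \<in> uq_rels"
  shows "U.act \<mu> r (y :: 'f::field_char_0 nm) = 0"
proof -
  have q0: "qq \<noteq> (0 :: 'f rq)" "qq powi n \<noteq> (0 :: 'f rq)" for n using qq_nonzero[where 'f='f] by auto
  note act = U.act_diff U.act_add U.act_mult U.act_fgen U.act_fconst U.act_one U_act_gam U_act_psi U_act_phi
    U.act_zero UNIV_I
  note L = lin_rules[OF grading_lin[OF q0(1)]] lin_rules[OF grading_lin[OF one_neq_zero]] lin_rules[OF Hop_lin] lin_rules[OF Pop_lin]
    lin_rules[OF Kop_lin] lin_rules[OF Kop'_lin]
  have K: "Kop h (Kop' h a) = a" "Kop' h (Kop h a) = a" for h and a :: "'f nm"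
  proof -
    have "qq powi h * qq powi (- h) = (1 :: 'f rq)" "qq powi 2 * qq powi (- 2) = (1 :: 'f rq)" for h
      using q0(1) by (simp_all add: power_int_minus)
    then show "Kop h (Kop' h a) = a" "Kop' h (Kop h a) = a" for h and a :: "'f nm"
      by (simp_all only: Kop_def Kop'_def L grading_grading[OF one_neq_zero one_neq_zero] N.scale_scale mult.commute
          mult_1 grading_id N.scale_one)
  qed
  have D: "(qq powi n) *\<^sub>N grading 1 qq ((qq powi - n) *\<^sub>N grading 1 (inverse qq) a) = a"
    "(qq powi - n) *\<^sub>N grading 1 (inverse qq) ((qq powi n) *\<^sub>N grading 1 qq a) = a" for n and a :: "'f nm"
    using q0 by (simp_all add: L lin_rules[OF grading_lin[of "inverse qq"]] grading_grading power_int_minus)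
  from assms show ?thesis
  proof cases
    case H_zero then show ?thesis by (simp add: act Hop_0)
  next
    case DD' then show ?thesis by (simp add: act D)
  next
    case D'D then show ?thesis by (simp add: act D)
  next
    case KK' then show ?thesis by (simp add: act K)
  next
    case K'K then show ?thesis by (simp add: act K)
  next
    case GG' then show ?thesis by (simp add: act)
  next
    case (G_central g) then show ?thesis by (simp add: act)
  next
    case (G'_central g) then show ?thesis by (simp add: act)
  next
    case (HH k l) then show ?thesis by (simp add: act Hop_Hop)
  next
    case (HK k) then show ?thesis by (simp add: act Kop_def L grading_Hop)
  next
    case DK then show ?thesis by (simp add: act Kop_def L grading_commute[OF q0(1)] mult.commute)
  next
    case (DH k)
    have "qq powi n *\<^sub>N grading 1 qq (Hop k a) = qq powi k *\<^sub>N Hop k (qq powi n *\<^sub>N grading 1 qq a)" for n and a :: "'f nm"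
      using q0 by (simp add: L grading_Hop mult.commute)
    with DH show ?thesis by (simp add: act D)
  next
    case (DXp k)
    have "qq powi n *\<^sub>N grading 1 qq (Pop h k a) = qq powi k *\<^sub>N Pop h k (qq powi n *\<^sub>N grading 1 qq a)" for n h and a :: "'f nm"
      using q0 by (simp add: L Pop_grading mult.commute)
    with DXp show ?thesis by (simp add: act D)
  next
    case (DXm k)
    have "qq powi n *\<^sub>N grading 1 qq (nm_gen k * a) = qq powi k *\<^sub>N (nm_gen k * (qq powi n *\<^sub>N grading 1 qq a))" for n and a :: "'f nm"
      using q0 by (simp add: grading_gen mult.commute)
    with DXm show ?thesis using D(1) by (simp add: act del: scl_mult)
  next
    case (KXp k)
    have "Kop h (Pop h k a) = qq powi 2 *\<^sub>N Pop h k (Kop h a)" for h and a :: "'f nm"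
      using q0 by (simp add: Kop_def L Pop_grading power_int_minus mult_ac)
    with KXp show ?thesis by (simp add: act K)
  next
    case (KXm k)
    then show ?thesis by (simp add: act Kop_gen K power_int_minus)
  next
    case (HXp k l)
    then show ?thesis by (simp add: act Pop_Hop hcoef_def add.commute)
  next
    case (HXm k l)
    then show ?thesis by (simp add: act Hop_gen hcoef_def add.commute)
  next
    case (XpXp k l)
    then show ?thesis using Pop_Pop[of "at_h \<mu>" k l y] by (simp add: act)
  next
    case (XmXm k l)
    have "inverse (qq ^ 2) *\<^sub>N (nm_gen l * (nm_gen (k + 1) * y) - qq ^ 2 *\<^sub>N (nm_gen (k + 1) * (nm_gen l * y))
      - (qq ^ 2 *\<^sub>N (nm_gen (l + 1) * (nm_gen k * y)) - nm_gen k * (nm_gen (l + 1) * y))) = 0"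
      unfolding nm_rel by simp
    then show ?thesis using q0(1) unfolding XmXm by (simp add: act power_int_minus N.scale_right_diff_distrib algebra_simps)
  next
    case (XpXm k l)
    then show ?thesis by (simp add: act Pop_gen Theta_def)
  qed
qed

definition uact :: "weight \<Rightarrow> 'f::field_char_0 uq \<Rightarrow> 'f nm \<Rightarrow> 'f nm" where
  "uact \<mu> u a = U.act \<mu> (rep_uq u) a"

lemma uact_abs: "uact \<mu> (abs_uq p) a = U.act \<mu> p a"
proof -
  have "rep_uq (abs_uq p) - p \<in> two_sided_ideal uq_rels"
    using Quotient3_rep_abs[OF Quotient3_uq, of p] by (simp add: two_sided_ideal.zero)
  from U.act_ideal[OF U_act_rels this UNIV_I] show ?thesis by (simp add: uact_def U.act_diff)
qed

lemma uact_add: "uact \<mu> (u + v) a = uact \<mu> u a + uact \<mu> v a"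
  and uact_mult: "uact \<mu> (u * v) a = uact \<mu> u (uact \<mu> v a)"
  by (induction u rule: uq.abs_induct, induction v rule: uq.abs_induct,
      simp add: plus_uq.abs_eq times_uq.abs_eq uact_abs U.act_add U.act_mult)+

lemma uact_gen: "uact \<mu> (uq_gen g) a = Uop \<mu> g a"
  by (simp add: uq_gen_def uact_abs U.act_fgen)

lemma uact_const: "uact \<mu> (uq_const c) a = c *\<^sub>N a"
  by (simp add: uq_const_def uact_abs U.act_fconst)

lemma uact_lin: "lin (uact \<mu> u)"
  by (rule linI) (simp_all add: uact_def U.act_right_add U.act_right_s)

lemma uact_zero: "uact \<mu> 0 a = 0" using uact_add[of \<mu> 0 0 a] by simp
lemma uact_one: "uact \<mu> 1 a = a" by (simp add: one_uq_def uact_abs U.act_one)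
lemma uact_uminus: "uact \<mu> (- u) a = - uact \<mu> u a"
  using uact_add[of \<mu> "- u" u a] by (simp add: uact_zero eq_neg_iff_add_eq_0)
lemma uact_diff: "uact \<mu> (u - v) a = uact \<mu> u a - uact \<mu> v a"
  using uact_add[of \<mu> u "- v" a] by (simp add: uact_uminus)

section \<open>The reduced imaginary Verma module as \<open>\<N>\<close>\<close>

lemma nm_to_uq_add: "nm_to_uq (a + b) = nm_to_uq a + nm_to_uq b"
  and nm_to_uq_mult: "nm_to_uq (a * b) = nm_to_uq a * nm_to_uq b"
proof -
  interpret h: free_lift_hom "uq_const :: 'a rq \<Rightarrow> 'a uq" "\<lambda>n. uq_gen (Xm n)"
    by (rule uq_free_lift_hom)
  show "nm_to_uq (a + b) = nm_to_uq a + nm_to_uq b" for a b :: "'a nm"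
    by (induction a rule: nm.abs_induct, induction b rule: nm.abs_induct)
       (simp add: plus_nm.abs_eq nm_to_uq.abs_eq h.free_lift_add)
  show "nm_to_uq (a * b) = nm_to_uq a * nm_to_uq b" for a b :: "'a nm"
    by (induction a rule: nm.abs_induct, induction b rule: nm.abs_induct)
       (simp add: times_nm.abs_eq nm_to_uq.abs_eq h.free_lift_mult)
qed

lemma nm_to_uq_gen: "nm_to_uq (nm_gen n :: 'a::field_char_0 nm) = uq_gen (Xm n)"
  and nm_to_uq_const: "nm_to_uq (nm_const c :: 'a nm) = uq_const c"
proof -
  interpret h: free_lift_hom "uq_const :: 'a rq \<Rightarrow> 'a uq" "\<lambda>n. uq_gen (Xm n)"
    by (rule uq_free_lift_hom)
  show "nm_to_uq (nm_gen n :: 'a nm) = uq_gen (Xm n)"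
    by (simp add: nm_gen_def nm_to_uq.abs_eq h.free_lift_fgen)
  show "nm_to_uq (nm_const c :: 'a nm) = uq_const c"
    by (simp add: nm_const_def nm_to_uq.abs_eq h.free_lift_fconst)
qed

lemma uq_const_hom:
  "uq_const (c + d) = uq_const c + uq_const d"
  "uq_const (c * d) = uq_const c * uq_const d"
  "uq_const 1 = 1"
  "uq_const c * u = u * uq_const c"
  using uq_free_lift_hom unfolding free_lift_hom_def by blast+

lemma nm_to_uq_one: "nm_to_uq 1 = 1"
  using nm_to_uq_const[of 1] by (simp add: nm_const_hom uq_const_hom)

lemma nm_to_uq_scl: "nm_to_uq (c *\<^sub>N a) = uq_const c * nm_to_uq a"
  by (simp add: scl_def nm_to_uq_mult nm_to_uq_const)

lemma nm_to_uq_zero: "nm_to_uq 0 = 0"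
  using nm_to_uq_add[of 0 0] by simp

lemma nm_to_uq_diff: "nm_to_uq (a - b) = nm_to_uq a - nm_to_uq b"
  using nm_to_uq_add[of "a - b" b] by (simp add: algebra_simps)

lemma uact_nm_to_uq: "uact \<mu> (nm_to_uq a) b = a * b"
  by (induction a rule: nm_induct)
     (simp_all add: nm_to_uq_one uact_one nm_to_uq_mult nm_to_uq_gen nm_to_uq_scl nm_to_uq_add
       uact_mult uact_add uact_gen uact_const mult.assoc distrib_right)

abbreviation Jid :: "weight \<Rightarrow> 'f::field_char_0 uq set" where
  "Jid \<mu> \<equiv> left_ideal (J_gens \<mu>)"

lemma left_ideal_mult: "x \<in> left_ideal S \<Longrightarrow> a * x \<in> left_ideal S"
proof (induction rule: left_ideal.induct)
  case (gen s b) then show ?case using left_ideal.gen[of s S "a * b"] by (simp add: mult.assoc)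
qed (auto intro: left_ideal.intros simp: distrib_left)

lemma left_ideal_uminus: "x \<in> left_ideal S \<Longrightarrow> - x \<in> left_ideal S"
  using left_ideal_mult[of x S "- 1"] by simp

lemma left_ideal_gen: "s \<in> S \<Longrightarrow> s \<in> left_ideal S"
  using left_ideal.gen[of s S 1] by simp

text \<open>The vector 1 of \<open>\<N>\<close> satisfies the defining conditions of \<open>v\<^sub>\<lambda>\<close>, so an element of the left ideal
acts on it by 0.\<close>

lemma Jid_kills: "u \<in> Jid \<mu> \<Longrightarrow> uact \<mu> u 1 = 0"
proof (induction rule: left_ideal.induct)
  case zero show ?case by (rule uact_zero)
next
  case (add x y) then show ?case by (simp add: uact_add)
next
  case (gen s a)
  have "uact \<mu> s 1 = 0"
    using gen qq_nonzero[where 'f='a] unfolding J_gens_def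
    by (auto simp: uact_gen uact_diff uact_const uact_one Kop_def Kop'_def)
  then show ?case by (simp add: uact_mult lin_zero[OF uact_lin])
qed

text \<open>Adaptedness is demanded on all of \<open>\<N>\<close>, not on 1 only, so that it passes to products.\<close>

definition adapted :: "weight \<Rightarrow> 'f::field_char_0 uq set" where
  "adapted \<mu> = {u. \<forall>a. u * nm_to_uq a - nm_to_uq (uact \<mu> u a) \<in> Jid \<mu>}"

lemma adapted_zero: "0 \<in> adapted \<mu>"
  by (auto simp: adapted_def uact_zero nm_to_uq_zero left_ideal.zero)

lemma adapted_add: "u \<in> adapted \<mu> \<Longrightarrow> v \<in> adapted \<mu> \<Longrightarrow> u + v \<in> adapted \<mu>"
  unfolding adapted_def
proof clarsimp
  fix a
  assume "\<forall>a. u * nm_to_uq a - nm_to_uq (uact \<mu> u a) \<in> Jid \<mu>" "\<forall>a. v * nm_to_uq a - nm_to_uq (uact \<mu> v a) \<in> Jid \<mu>"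
  then have "(u * nm_to_uq a - nm_to_uq (uact \<mu> u a)) + (v * nm_to_uq a - nm_to_uq (uact \<mu> v a)) \<in> Jid \<mu>"
    by (blast intro: left_ideal.add)
  then show "(u + v) * nm_to_uq a - nm_to_uq (uact \<mu> (u + v) a) \<in> Jid \<mu>"
    by (simp add: uact_add nm_to_uq_add algebra_simps)
qed

lemma adapted_mult: "u \<in> adapted \<mu> \<Longrightarrow> v \<in> adapted \<mu> \<Longrightarrow> u * v \<in> adapted \<mu>"
  unfolding adapted_def
proof clarsimp
  fix a
  assume u: "\<forall>a. u * nm_to_uq a - nm_to_uq (uact \<mu> u a) \<in> Jid \<mu>" and v: "\<forall>a. v * nm_to_uq a - nm_to_uq (uact \<mu> v a) \<in> Jid \<mu>"
  have "u * (v * nm_to_uq a - nm_to_uq (uact \<mu> v a)) + (u * nm_to_uq (uact \<mu> v a) - nm_to_uq (uact \<mu> u (uact \<mu> v a))) \<in> Jid \<mu>"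
    using u v by (blast intro: left_ideal.add left_ideal_mult)
  then show "u * v * nm_to_uq a - nm_to_uq (uact \<mu> (u * v) a) \<in> Jid \<mu>"
    by (simp add: uact_mult algebra_simps)
qed

lemma adapted_const: "uq_const c \<in> adapted \<mu>"
  by (simp add: adapted_def uact_const nm_to_uq_scl left_ideal.zero)

lemma adapted_Xm: "uq_gen (Xm m) \<in> adapted \<mu>"
  by (simp add: adapted_def uact_gen nm_to_uq_mult nm_to_uq_gen left_ideal.zero)

lemma adapted_one: "1 \<in> adapted \<mu>"
  using adapted_const[of 1] by (simp add: uq_const_hom)

lemma adapted_uminus: "u \<in> adapted \<mu> \<Longrightarrow> - u \<in> adapted \<mu>"
proof -
  have "uq_const 0 = (0 :: 'a uq)" using uq_const_hom(1)[of "0 :: 'a rq" 0] by simp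
  then have "uq_const (- 1) = (- 1 :: 'a uq)"
    using uq_const_hom(1)[of "- 1 :: 'a rq" 1] by (simp add: uq_const_hom(3) eq_neg_iff_add_eq_0)
  moreover assume "u \<in> adapted \<mu>"
  ultimately show ?thesis using adapted_mult[OF adapted_const[of "- 1"], of u \<mu>] by simp
qed

lemma adapted_diff: "u \<in> adapted \<mu> \<Longrightarrow> v \<in> adapted \<mu> \<Longrightarrow> u - v \<in> adapted \<mu>"
  using adapted_add[OF _ adapted_uminus, of u \<mu> v] by simp

lemma adapted_sum: "(\<And>i. i \<in> A \<Longrightarrow> f i \<in> adapted \<mu>) \<Longrightarrow> sum f A \<in> adapted \<mu>"
  by (induction A rule: infinite_finite_induct) (auto intro: adapted_zero adapted_add)

text \<open>The criterion for adaptedness: an element whose action on the generating vector is right and that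
  can be moved past the \<open>x\<^sup>-\<^sub>m\<close> up to adapted elements.\<close>

lemma adaptedI:
  assumes base: "u - nm_to_uq (uact \<mu> u 1) \<in> Jid \<mu>"
    and step: "\<And>m. \<exists>c w. w \<in> adapted \<mu> \<and> u * uq_gen (Xm m) = uq_const c * uq_gen (Xm m) * u + w"
  shows "u \<in> adapted \<mu>"
proof -
  have "u * nm_to_uq a - nm_to_uq (uact \<mu> u a) \<in> Jid \<mu>" for a
  proof (induction a rule: nm_induct)
    case one show ?case using base by (simp add: nm_to_uq_one)
  next
    case (scl c a)
    have "uq_const c * (u * nm_to_uq a - nm_to_uq (uact \<mu> u a)) \<in> Jid \<mu>" by (rule left_ideal_mult[OF scl])
    moreover have "u * (uq_const c * nm_to_uq a) = uq_const c * (u * nm_to_uq a)"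
      by (metis mult.assoc uq_const_hom(4))
    ultimately show ?case by (simp add: lin_scl[OF uact_lin] nm_to_uq_scl right_diff_distrib)
  next
    case (add a b)
    have "(u * nm_to_uq a - nm_to_uq (uact \<mu> u a)) + (u * nm_to_uq b - nm_to_uq (uact \<mu> u b)) \<in> Jid \<mu>"
      by (rule left_ideal.add[OF add])
    then show ?case by (simp add: lin_add[OF uact_lin] nm_to_uq_add algebra_simps)
  next
    case (gen m a)
    obtain c w where w: "w \<in> adapted \<mu>" "u * uq_gen (Xm m) = uq_const c * uq_gen (Xm m) * u + w"
      using step by blast
    have "uact \<mu> u (nm_gen m * a) = uact \<mu> (u * uq_gen (Xm m)) a" by (simp add: uact_mult uact_gen)
    also have "\<dots> = c *\<^sub>N (nm_gen m * uact \<mu> u a) + uact \<mu> w a"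
      by (simp add: w(2) uact_add uact_mult uact_gen uact_const)
    finally have "u * nm_to_uq (nm_gen m * a) - nm_to_uq (uact \<mu> u (nm_gen m * a))
      = uq_const c * uq_gen (Xm m) * (u * nm_to_uq a - nm_to_uq (uact \<mu> u a)) + (w * nm_to_uq a - nm_to_uq (uact \<mu> w a))"
      by (simp add: nm_to_uq_mult nm_to_uq_gen nm_to_uq_add nm_to_uq_scl mult.assoc[symmetric] w(2))
         (simp add: algebra_simps)
    moreover have "w * nm_to_uq a - nm_to_uq (uact \<mu> w a) \<in> Jid \<mu>" using w(1) by (simp add: adapted_def)
    ultimately show ?case using gen by (auto intro: left_ideal.add left_ideal_mult)
  qed
  then show ?thesis by (simp add: adapted_def)
qed

lemma uq_rel_0: "r \<in> uq_rels \<Longrightarrow> abs_uq r = 0"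
  unfolding abs_uq_eq_0 using two_sided_ideal.gen[of r uq_rels 1 1] by simp

lemma adapted_Gp: "uq_gen Gp \<in> (adapted \<mu> :: 'a::field_char_0 uq set)"
  and adapted_Gm: "uq_gen Gm \<in> (adapted \<mu> :: 'a uq set)"
proof -
  have "uq_gen Gp - nm_to_uq (uact \<mu> (uq_gen Gp) 1) \<in> (Jid \<mu> :: 'a uq set)" "uq_gen Gm - nm_to_uq (uact \<mu> (uq_gen Gm) 1) \<in> (Jid \<mu> :: 'a uq set)"
    by (auto simp: uact_gen nm_to_uq_one J_gens_def intro!: left_ideal_gen)
  moreover have "uq_gen Gp * uq_gen (Xm m) = uq_const 1 * uq_gen (Xm m) * uq_gen Gp + (0 :: 'a uq)"
    "uq_gen Gm * uq_gen (Xm m) = uq_const 1 * uq_gen (Xm m) * uq_gen Gm + (0 :: 'a uq)" for m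
    using uq_rel_0[OF uq_rels.G_central[of "Xm m"]] uq_rel_0[OF uq_rels.G'_central[of "Xm m"]]
    by (simp_all add: uq_gen_def minus_uq.abs_eq[symmetric] times_uq.abs_eq[symmetric] uq_const_hom)
  ultimately show "uq_gen Gp \<in> (adapted \<mu> :: 'a uq set)" "uq_gen Gm \<in> (adapted \<mu> :: 'a uq set)"
    by (blast intro: adaptedI adapted_zero)+
qed

text \<open>For \<open>K\<close> and \<open>D\<close> only the conjugation relation is given; the relation for the inverse element follows
by multiplying with it on both sides.\<close>

lemma adapted_torus:
  assumes rel: "\<And>m. uq_gen g * uq_gen (Xm m) * uq_gen g' = uq_const (c m) * (uq_gen (Xm m) :: 'f uq)"
    and inv: "uq_gen g * uq_gen g' = (1 :: 'f uq)" "uq_gen g' * uq_gen g = (1 :: 'f uq)" and c: "\<And>m. c m \<noteq> (0 :: 'f::field_char_0 rq)"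
    and base: "uq_gen g - nm_to_uq (uact \<mu> (uq_gen g) 1) \<in> (Jid \<mu> :: 'f uq set)"
       "uq_gen g' - nm_to_uq (uact \<mu> (uq_gen g') 1) \<in> (Jid \<mu> :: 'f uq set)"
  shows "uq_gen g \<in> (adapted \<mu> :: 'f uq set)" "uq_gen g' \<in> (adapted \<mu> :: 'f uq set)"
proof -
  have 1: "uq_gen g * uq_gen (Xm m) = uq_const (c m) * uq_gen (Xm m) * (uq_gen g :: 'f uq)" for m
  proof -
    have "uq_gen g * uq_gen (Xm m) = uq_gen g * uq_gen (Xm m) * (uq_gen g' * uq_gen g :: 'f uq)" by (simp add: inv)
    also have "\<dots> = uq_const (c m) * uq_gen (Xm m) * uq_gen g" by (simp only: mult.assoc[symmetric] rel)
    finally show ?thesis .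
  qed
  have 2: "uq_gen g' * uq_gen (Xm m) = uq_const (inverse (c m)) * uq_gen (Xm m) * (uq_gen g' :: 'f uq)" for m
  proof -
    have "uq_gen (Xm m) * uq_gen g' = (uq_gen g' * uq_gen g) * (uq_gen (Xm m) * uq_gen g' :: 'f uq)" by (simp add: inv)
    also have "\<dots> = uq_gen g' * (uq_gen g * uq_gen (Xm m) * uq_gen g')" by (simp add: mult.assoc)
    also have "\<dots> = uq_const (c m) * (uq_gen g' * uq_gen (Xm m))"
      unfolding rel by (metis mult.assoc uq_const_hom(4))
    finally have "uq_const (inverse (c m)) * (uq_gen (Xm m) * uq_gen g')
      = (uq_const (inverse (c m)) * uq_const (c m)) * (uq_gen g' * uq_gen (Xm m) :: 'f uq)" by (simp add: mult.assoc)
    also have "uq_const (inverse (c m)) * uq_const (c m) = (1 :: 'f uq)"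
      using c[of m] by (simp flip: uq_const_hom(2) add: uq_const_hom(3))
    finally show ?thesis by (simp add: mult.assoc)
  qed
  show "uq_gen g \<in> (adapted \<mu> :: 'f uq set)"
    by (rule adaptedI[OF base(1)]) (metis 1 add_0_right adapted_zero)
  show "uq_gen g' \<in> (adapted \<mu> :: 'f uq set)"
    by (rule adaptedI[OF base(2)]) (metis 2 add_0_right adapted_zero)
qed

lemma uq_gen_rel:
  shows "uq_gen Kp * uq_gen Km = (1 :: 'f::field_char_0 uq)" "uq_gen Km * uq_gen Kp = (1 :: 'f uq)"
    "uq_gen Dp * uq_gen Dm = (1 :: 'f uq)" "uq_gen Dm * uq_gen Dp = (1 :: 'f uq)"
    "uq_gen Kp * uq_gen (Xm m) * uq_gen Km = uq_const (qq powi (- 2)) * (uq_gen (Xm m) :: 'f uq)"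
    "uq_gen Dp * uq_gen (Xm m) * uq_gen Dm = uq_const (qq powi m) * (uq_gen (Xm m) :: 'f uq)"
    "uq_gen (Hh 0) = (0 :: 'f uq)"
  using uq_rel_0[OF uq_rels.KK'] uq_rel_0[OF uq_rels.K'K] uq_rel_0[OF uq_rels.DD'] uq_rel_0[OF uq_rels.D'D]
    uq_rel_0[OF uq_rels.KXm[of m]] uq_rel_0[OF uq_rels.DXm[of m]] uq_rel_0[OF uq_rels.H_zero]
  by (simp_all add: uq_gen_def uq_const_def minus_uq.abs_eq[symmetric] times_uq.abs_eq[symmetric] flip: one_uq_def)

lemma nm_to_uq_scl_one: "nm_to_uq (c *\<^sub>N 1) = uq_const c"
  by (simp add: nm_to_uq_scl nm_to_uq_one)

lemma adapted_K: "uq_gen Kp \<in> (adapted \<mu> :: 'f::field_char_0 uq set)" "uq_gen Km \<in> (adapted \<mu> :: 'f uq set)"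
  by (rule adapted_torus[where c = "\<lambda>_. qq powi (- 2)", OF uq_gen_rel(5,1,2)];
      use qq_nonzero[where 'f='f] in \<open>auto simp: uact_gen Kop_def Kop'_def nm_to_uq_scl_one J_gens_def intro!: left_ideal_gen\<close>)+

lemma adapted_D: "uq_gen Dp \<in> (adapted \<mu> :: 'f::field_char_0 uq set)" "uq_gen Dm \<in> (adapted \<mu> :: 'f uq set)"
  by (rule adapted_torus[where c = "\<lambda>m. qq powi m", OF uq_gen_rel(6,3,4)];
      use qq_nonzero[where 'f='f] in \<open>auto simp: uact_gen nm_to_uq_scl_one J_gens_def intro!: left_ideal_gen\<close>)+

lemma abs_uq_mult: "abs_uq (p * r) = abs_uq p * abs_uq r" by (simp add: times_uq.abs_eq)
lemma abs_uq_add: "abs_uq (p + r) = abs_uq p + abs_uq r" by (simp add: plus_uq.abs_eq)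
lemma abs_uq_diff: "abs_uq (p - r) = abs_uq p - abs_uq r" by (simp add: minus_uq.abs_eq)
lemma abs_uq_one: "abs_uq 1 = 1" by (simp add: one_uq_def)
lemma abs_uq_zero: "abs_uq 0 = 0" by (simp add: zero_uq_def)
lemma abs_uq_sum: "abs_uq (sum f A) = (\<Sum>i\<in>A. abs_uq (f i))"
  by (induction A rule: infinite_finite_induct) (simp_all add: abs_uq_zero abs_uq_add)

lemma adapted_gam: "abs_uq (gam n) \<in> (adapted \<mu> :: 'f::field_char_0 uq set)"
proof -
  have "abs_uq (fgen Gp ^ k) \<in> (adapted \<mu> :: 'f uq set)" "abs_uq (fgen Gm ^ k) \<in> (adapted \<mu> :: 'f uq set)" for k
    by (induction k) (auto simp: abs_uq_one abs_uq_mult adapted_one intro!: adapted_mult adapted_Gp[unfolded uq_gen_def] adapted_Gm[unfolded uq_gen_def])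
  then show ?thesis by (simp add: gam_def)
qed

lemma adapted_Hh: "uq_gen (Hh k) \<in> adapted \<mu>"
proof (cases "k = 0")
  case True then show ?thesis by (simp add: uq_gen_rel adapted_zero)
next
  case False
  show ?thesis
  proof (rule adaptedI)
    show "uq_gen (Hh k) - nm_to_uq (uact \<mu> (uq_gen (Hh k)) 1) \<in> Jid \<mu>"
      using False by (auto simp: uact_gen nm_to_uq_zero J_gens_def intro!: left_ideal_gen)
    fix m
    let ?w = "uq_const (qint (2 * k) / of_int k) * abs_uq (gam \<bar>k\<bar>) * uq_gen (Xm (k + m))"
    have "uq_gen (Hh k) * uq_gen (Xm m) = uq_const 1 * uq_gen (Xm m) * uq_gen (Hh k) + - ?w"
      using uq_rel_0[OF uq_rels.HXm[OF False, of m]]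
      by (simp add: abs_uq_mult abs_uq_add abs_uq_diff uq_gen_def uq_const_hom uq_const_def[symmetric])
         (simp add: algebra_simps)
    moreover have "- ?w \<in> adapted \<mu>" by (intro adapted_uminus adapted_mult adapted_const adapted_gam adapted_Xm)
    ultimately show "\<exists>c w. w \<in> adapted \<mu> \<and> uq_gen (Hh k) * uq_gen (Xm m) = uq_const c * uq_gen (Xm m) * uq_gen (Hh k) + w"
      by blast
  qed
qed

lemma adapted_exp:
  assumes "\<And>j. abs_uq (B $ j) \<in> adapted \<mu>"
  shows "abs_uq ((fps_exp_series oo B) $ n) \<in> adapted \<mu>"
proof -
  have "abs_uq ((B ^ i) $ n) \<in> adapted \<mu>" for i n
    by (induction i arbitrary: n)
       (auto simp: fps_mult_nth abs_uq_one abs_uq_zero abs_uq_mult abs_uq_sum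
         intro!: adapted_one adapted_zero adapted_sum adapted_mult assms)
  then show ?thesis
    by (auto simp: fps_compose_nth fps_exp_series_def abs_uq_mult abs_uq_sum
       intro!: adapted_sum adapted_mult adapted_const[unfolded uq_const_def])
qed

lemma adapted_psi: "abs_uq (psi_el n) \<in> (adapted \<mu> :: 'f::field_char_0 uq set)"
  and adapted_phi: "abs_uq (phi_el n) \<in> (adapted \<mu> :: 'f uq set)"
  unfolding psi_el_def phi_el_def psi_series_def phi_series_def
  by (auto simp: abs_uq_mult abs_uq_zero abs_uq_diff
      intro!: adapted_exp adapted_mult adapted_zero adapted_const[unfolded uq_const_def] adapted_diff
        adapted_K[unfolded uq_gen_def] adapted_Hh[unfolded uq_gen_def] adapted_uminus
      simp flip: uminus_uq.abs_eq)

lemma adapted_Xp: "uq_gen (Xp k) \<in> adapted \<mu>"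
proof (rule adaptedI)
  show "uq_gen (Xp k) - nm_to_uq (uact \<mu> (uq_gen (Xp k)) 1) \<in> Jid \<mu>"
    by (auto simp: uact_gen nm_to_uq_zero J_gens_def intro!: left_ideal_gen)
  fix m
  let ?w = "uq_const (inverse qeta) * (abs_uq (gam (k - m)) * abs_uq (psi_el (k + m)) - abs_uq (gam (m - k)) * abs_uq (phi_el (k + m)))"
  have "uq_gen (Xp k) * uq_gen (Xm m) = uq_const 1 * uq_gen (Xm m) * uq_gen (Xp k) + ?w"
    using uq_rel_0[OF uq_rels.XpXm[of k m]]
    by (simp add: abs_uq_mult abs_uq_add abs_uq_diff uq_gen_def uq_const_hom uq_const_def[symmetric] algebra_simps)
  moreover have "?w \<in> adapted \<mu>" by (intro adapted_mult adapted_diff adapted_const adapted_gam adapted_psi adapted_phi)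
  ultimately show "\<exists>c w. w \<in> adapted \<mu> \<and> uq_gen (Xp k) * uq_gen (Xm m) = uq_const c * uq_gen (Xm m) * uq_gen (Xp k) + w"
    by blast
qed

text \<open>The adapted elements form a subalgebra that contains all generators.\<close>

lemma adapted_all: "u \<in> adapted \<mu>"
proof (induction u rule: uq.abs_induct)
  case (1 p)
  show ?case
  proof (induction p rule: free_alg_induct)
    case 1 show ?case by (simp add: abs_uq_zero adapted_zero)
  next
    case (3 a b) then show ?case by (simp add: abs_uq_add adapted_add)
  next
    case (2 w c)
    have gens: "uq_gen g \<in> (adapted \<mu> :: 'a uq set)" for g
      by (cases g) (auto intro: adapted_Xp adapted_Xm adapted_Hh adapted_K adapted_D adapted_Gp adapted_Gm)
    have "abs_uq (single (FWord l) c) \<in> (adapted \<mu> :: 'a uq set)" for l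
    proof (induction l arbitrary: c)
      case Nil
      show ?case using adapted_const[of c] by (simp add: uq_const_def fconst_def zero_fword_def)
    next
      case (Cons g l)
      have "single (FWord (g # l)) c = (fgen g * single (FWord l) c :: 'a ufree)"
        by (simp add: fgen_def mult_single plus_fword_def)
      then show ?case using Cons gens[of g] by (simp add: abs_uq_mult adapted_mult uq_gen_def)
    qed
    from this[of "letters w"] show ?case by simp
  qed
qed

lemma uq_mod_J: "u - nm_to_uq (uact \<mu> u 1) \<in> Jid \<mu>"
  using adapted_all[of u \<mu>] unfolding adapted_def by (auto dest: spec[of _ 1] simp: nm_to_uq_one)

text \<open>The left ideal is the annihilator of 1, so \<open>Mbar \<mu>\<close> is isomorphic to \<open>\<N>\<close>.\<close>

lemma Jid_iff: "u \<in> Jid \<mu> \<longleftrightarrow> uact \<mu> u 1 = 0"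
  using uq_mod_J[of u \<mu>] Jid_kills[of u \<mu>] by (auto simp: nm_to_uq_zero)

definition Jcos :: "weight \<Rightarrow> 'f::field_char_0 uq \<Rightarrow> 'f uq set" where
  "Jcos \<mu> x = (\<lambda>j. j + x) ` Jid \<mu>"

lemma regular_r_coset: "Jid \<mu> +>\<^bsub>regular_module\<^esub> x = Jcos \<mu> x"
  by (auto simp: a_r_coset_def' regular_module_def Jcos_def)

lemma Jcos_eq_iff: "Jcos \<mu> x = Jcos \<mu> y \<longleftrightarrow> x - y \<in> Jid \<mu>"
proof
  assume "Jcos \<mu> x = Jcos \<mu> y"
  moreover have "x \<in> Jcos \<mu> x" unfolding Jcos_def by (rule image_eqI[of _ _ 0]) (auto intro: left_ideal.zero)
  ultimately obtain j where "j \<in> Jid \<mu>" "x = j + y" by (auto simp: Jcos_def)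
  then show "x - y \<in> Jid \<mu>" by simp
next
  have *: "Jcos \<mu> x \<subseteq> Jcos \<mu> y" if "x - y \<in> Jid \<mu>" for x y :: "'a uq"
    unfolding Jcos_def
  proof clarsimp
    fix j :: "'a uq" assume "j \<in> Jid \<mu>"
    then show "j + x \<in> (\<lambda>j. j + y) ` Jid \<mu>"
      using that by (intro image_eqI[of _ _ "j + (x - y)"]) (auto intro: left_ideal.add)
  qed
  assume "x - y \<in> Jid \<mu>"
  then show "Jcos \<mu> x = Jcos \<mu> y" using *[of x y] *[of y x] left_ideal_uminus[of "x - y"] by auto
qed

lemma Mbar_smult: "u \<odot>\<^bsub>Mbar \<mu>\<^esub> Jcos \<mu> x = Jcos \<mu> (u * x)"
proof -
  have "u \<odot>\<^bsub>Mbar \<mu>\<^esub> Jcos \<mu> x = (\<Union>y\<in>Jcos \<mu> x. Jcos \<mu> (u * y))"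
    by (simp add: Mbar_def quot_module_def regular_r_coset) (simp add: regular_module_def)
  moreover have "Jcos \<mu> (u * y) = Jcos \<mu> (u * x)" if "y \<in> Jcos \<mu> x" for y
    using that by (auto simp: Jcos_def[of _ x] Jcos_eq_iff distrib_left left_ideal_mult)
  moreover have "Jcos \<mu> x \<noteq> {}" using left_ideal.zero by (auto simp: Jcos_def)
  ultimately show ?thesis by auto
qed

lemma Mbar_add: "Jcos \<mu> x \<oplus>\<^bsub>Mbar \<mu>\<^esub> Jcos \<mu> y = Jcos \<mu> (x + y)"
proof -
  have "Jcos \<mu> x \<oplus>\<^bsub>Mbar \<mu>\<^esub> Jcos \<mu> y = {a + b | a b. a \<in> Jcos \<mu> x \<and> b \<in> Jcos \<mu> y}"
    by (auto simp: Mbar_def quot_module_def set_add_def' regular_module_def)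
  also have "\<dots> = Jcos \<mu> (x + y)"
  proof (intro equalityI subsetI)
    fix z assume "z \<in> Jcos \<mu> (x + y)"
    then obtain j where j: "j \<in> Jid \<mu>" "z = (j + x) + (0 + y)" by (auto simp: Jcos_def add.assoc)
    then have "j + x \<in> Jcos \<mu> x" "0 + y \<in> Jcos \<mu> y" by (auto simp: Jcos_def intro: left_ideal.zero)
    then show "z \<in> {a + b | a b. a \<in> Jcos \<mu> x \<and> b \<in> Jcos \<mu> y}" using j(2) by blast
  next
    fix z assume "z \<in> {a + b | a b. a \<in> Jcos \<mu> x \<and> b \<in> Jcos \<mu> y}"
    then obtain i j where "i \<in> Jid \<mu>" "j \<in> Jid \<mu>" "z = (i + x) + (j + y)" by (auto simp: Jcos_def)
    then show "z \<in> Jcos \<mu> (x + y)"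
      unfolding Jcos_def by (intro image_eqI[of _ _ "i + j"]) (auto simp: algebra_simps intro: left_ideal.add)
  qed
  finally show ?thesis .
qed

lemma hw_map_Jcos: "hw_map \<mu> a = Jcos \<mu> (nm_to_uq a)"
  by (simp add: hw_map_def hw_vec_def regular_r_coset Mbar_smult)

lemma Jcos_hw_map: "Jcos \<mu> u = hw_map \<mu> (uact \<mu> u 1)"
  by (simp add: hw_map_Jcos Jcos_eq_iff uq_mod_J)

lemma hw_map_add: "hw_map \<mu> a \<oplus>\<^bsub>Mbar \<mu>\<^esub> hw_map \<mu> b = hw_map \<mu> (a + b)"
  by (simp add: hw_map_Jcos Mbar_add nm_to_uq_add)

lemma hw_map_smult: "u \<odot>\<^bsub>Mbar \<mu>\<^esub> hw_map \<mu> a = hw_map \<mu> (uact \<mu> u a)"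
  using adapted_all[of u \<mu>] by (simp add: hw_map_Jcos Mbar_smult Jcos_eq_iff adapted_def)

lemma hw_map_zero: "\<zero>\<^bsub>Mbar \<mu>\<^esub> = hw_map \<mu> 0"
  by (simp add: Mbar_def quot_module_def hw_map_Jcos nm_to_uq_zero Jcos_def)

lemma hw_map_inj: "inj (hw_map \<mu>)"
proof (rule injI)
  fix a b assume "hw_map \<mu> a = hw_map \<mu> b"
  then have "uact \<mu> (nm_to_uq (a - b)) 1 = 0" by (simp add: hw_map_Jcos Jcos_eq_iff Jid_iff nm_to_uq_diff)
  then show "a = b" by (simp add: uact_nm_to_uq)
qed

lemma hw_map_eq_iff [simp]: "hw_map \<mu> a = hw_map \<mu> b \<longleftrightarrow> a = b"
  using hw_map_inj by (auto dest: injD)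

lemma Mbar_carrier: "carrier (Mbar \<mu>) = range (hw_map \<mu>)"
proof -
  have "carrier (Mbar \<mu>) = range (Jcos \<mu>)"
    by (auto simp: Mbar_def quot_module_def A_RCOSETS_def' regular_r_coset) (auto simp: regular_module_def)
  also have "\<dots> = range (hw_map \<mu>)"
  proof (intro equalityI subsetI)
    fix X assume "X \<in> range (Jcos \<mu>)"
    then show "X \<in> range (hw_map \<mu>)" by (auto simp: Jcos_hw_map)
  next
    fix X assume "X \<in> range (hw_map \<mu>)"
    then show "X \<in> range (Jcos \<mu>)" by (auto simp: hw_map_Jcos)
  qed
  finally show ?thesis .
qed

section \<open>Modules with coordinates\<close>

text \<open>Surjective additive images inherit the group axioms; this serves the quotients and lattices below,
each of which is the image of a group of coefficient functions.\<close>

lemma abelian_group_transport: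
  fixes f :: "'c::ab_group_add \<Rightarrow> 'v"
  assumes S: "0 \<in> S" "\<And>c d. c \<in> S \<Longrightarrow> d \<in> S \<Longrightarrow> c + d \<in> S" "\<And>c. c \<in> S \<Longrightarrow> - c \<in> S"
    and f: "f ` S = carrier V" "\<And>c d. c \<in> S \<Longrightarrow> d \<in> S \<Longrightarrow> f (c + d) = f c \<oplus>\<^bsub>V\<^esub> f d" "f 0 = \<zero>\<^bsub>V\<^esub>"
  shows "abelian_group V"
proof (rule abelian_groupI)
  fix x y z assume "x \<in> carrier V" "y \<in> carrier V" "z \<in> carrier V"
  then obtain c d e where c: "c \<in> S" "x = f c" "d \<in> S" "y = f d" "e \<in> S" "z = f e"
    unfolding f(1)[symmetric] by blast
  have e: "x \<oplus>\<^bsub>V\<^esub> y = f (c + d)" using c f(2) by simp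
  then show "x \<oplus>\<^bsub>V\<^esub> y \<in> carrier V" using S(2)[OF c(1,3)] f(1) by auto
  have "y \<oplus>\<^bsub>V\<^esub> z = f (d + e)" "y \<oplus>\<^bsub>V\<^esub> x = f (d + c)" using c f(2) by simp_all
  then show "x \<oplus>\<^bsub>V\<^esub> y \<oplus>\<^bsub>V\<^esub> z = x \<oplus>\<^bsub>V\<^esub> (y \<oplus>\<^bsub>V\<^esub> z)" "x \<oplus>\<^bsub>V\<^esub> y = y \<oplus>\<^bsub>V\<^esub> x"
    using e c f(2)[of "c + d" e] f(2)[of c "d + e"] by (simp_all add: S(2) add.assoc add.commute[of d c])
next
  show "\<zero>\<^bsub>V\<^esub> \<in> carrier V" using imageI[OF S(1), of f] f(1,3) by simp
next
  fix x assume "x \<in> carrier V"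
  then obtain c where c: "c \<in> S" "x = f c" unfolding f(1)[symmetric] by blast
  then show "\<zero>\<^bsub>V\<^esub> \<oplus>\<^bsub>V\<^esub> x = x" using f(2)[OF S(1) c(1)] f(3) by simp
  have "f (- c) \<oplus>\<^bsub>V\<^esub> x = \<zero>\<^bsub>V\<^esub>" using f(2)[OF S(3)[OF c(1)] c(1)] c(2) f(3) by simp
  then show "\<exists>y\<in>carrier V. y \<oplus>\<^bsub>V\<^esub> x = \<zero>\<^bsub>V\<^esub>" using S(3)[OF c(1)] f(1) by auto
qed

lemma lookup_map_times: "lookup (Poly_Mapping.map ((*) s) c) t = s * (lookup c t :: 'k::comm_ring_1)"
  by (simp add: map.rep_eq when_def)

text \<open>An \<open>R\<close>-module with coordinates in \<open>R\<close> indexed by \<open>T\<close>. The base \<open>R\<close> may be a proper subring of the scalars: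
below it is the whole field, the local ring, or the residue field. Then the images of the unit
vectors form a basis in the sense of \<open>is_basis\<close>, whose coefficient functions live on the
module itself and have to be reindexed.\<close>

locale coord =
  fixes V :: "('k::comm_ring_1, 'v) module" and R :: "'k set" and T :: "'t set" and \<Phi> :: "('t \<Rightarrow>\<^sub>0 'k) \<Rightarrow> 'v"
  assumes R: "0 \<in> R" "1 \<in> R" "\<And>a b. a \<in> R \<Longrightarrow> b \<in> R \<Longrightarrow> a + b \<in> R" "\<And>a. a \<in> R \<Longrightarrow> - a \<in> R"
      "\<And>a b. a \<in> R \<Longrightarrow> b \<in> R \<Longrightarrow> a * b \<in> R"
    and bij: "bij_betw \<Phi> (coeffs_in R T) (carrier V)"
    and \<Phi>_add: "\<And>c d. c \<in> coeffs_in R T \<Longrightarrow> d \<in> coeffs_in R T \<Longrightarrow> \<Phi> (c + d) = \<Phi> c \<oplus>\<^bsub>V\<^esub> \<Phi> d"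
    and \<Phi>_scl: "\<And>s c. s \<in> R \<Longrightarrow> c \<in> coeffs_in R T \<Longrightarrow> \<Phi> (Poly_Mapping.map ((*) s) c) = s \<odot>\<^bsub>V\<^esub> \<Phi> c"
    and \<Phi>_zero: "\<Phi> 0 = \<zero>\<^bsub>V\<^esub>"
begin

lemma C_zero: "0 \<in> coeffs_in R T" using R by (simp add: coeffs_in_iff)
lemma C_add: "c \<in> coeffs_in R T \<Longrightarrow> d \<in> coeffs_in R T \<Longrightarrow> c + d \<in> coeffs_in R T"
  using R Poly_Mapping.keys_add[of c d] by (auto simp: coeffs_in_iff lookup_add)
lemma C_uminus: "c \<in> coeffs_in R T \<Longrightarrow> - c \<in> coeffs_in R T"
  using R by (auto simp: coeffs_in_iff)
lemma C_sum: "(\<And>i. i \<in> A \<Longrightarrow> f i \<in> coeffs_in R T) \<Longrightarrow> sum f A \<in> coeffs_in R T"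
  by (induction A rule: infinite_finite_induct) (auto intro: C_zero C_add)
lemma C_single: "t \<in> T \<Longrightarrow> a \<in> R \<Longrightarrow> single t a \<in> coeffs_in R T"
  using R by (auto simp: coeffs_in_iff lookup_single when_def)

sublocale abelian_group V
  by (rule abelian_group_transport[where S = "coeffs_in R T" and f = \<Phi>])
     (use bij in \<open>auto simp: C_zero C_add C_uminus \<Phi>_add \<Phi>_zero bij_betw_def\<close>)

lemma \<Phi>_closed: "c \<in> coeffs_in R T \<Longrightarrow> \<Phi> c \<in> carrier V"
  using bij by (auto simp: bij_betw_def)

lemma \<Phi>_sum:
  "finite A \<Longrightarrow> (\<And>i. i \<in> A \<Longrightarrow> f i \<in> coeffs_in R T) \<Longrightarrow> (\<Oplus>\<^bsub>V\<^esub>i\<in>A. \<Phi> (f i)) = \<Phi> (sum f A)"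
proof (induction A rule: finite_induct)
  case empty show ?case by (simp add: \<Phi>_zero)
next
  case (insert x A)
  have "(\<lambda>i. \<Phi> (f i)) \<in> A \<rightarrow> carrier V" using insert by (auto intro: \<Phi>_closed)
  then show ?case using insert by (simp add: \<Phi>_closed \<Phi>_add C_sum)
qed

definition basis_vec :: "'t \<Rightarrow> 'v" where "basis_vec t = \<Phi> (single t 1)"

lemma basis_vec_closed: "t \<in> T \<Longrightarrow> basis_vec t \<in> carrier V"
  unfolding basis_vec_def by (intro \<Phi>_closed C_single R)

lemma basis_vec_inj: assumes "(0::'k) \<noteq> 1" shows "inj_on basis_vec T"
proof (rule inj_onI)
  fix s t assume st: "s \<in> T" "t \<in> T" "basis_vec s = basis_vec t"
  then have "single s (1::'k) = single t 1"
    using bij C_single[OF _ R(2)] unfolding basis_vec_def bij_betw_def by (metis inj_onD)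
  then have "lookup (single s (1::'k)) s = lookup (single t 1) s" by simp
  then show "s = t" using assms by (auto simp: lookup_single when_def split: if_splits)
qed

definition pull :: "('v \<Rightarrow>\<^sub>0 'k) \<Rightarrow> 't \<Rightarrow>\<^sub>0 'k" where
  "pull c = Abs_poly_mapping (\<lambda>t. if t \<in> T then lookup c (basis_vec t) else 0)"

definition push :: "('t \<Rightarrow>\<^sub>0 'k) \<Rightarrow> 'v \<Rightarrow>\<^sub>0 'k" where
  "push d = Abs_poly_mapping (\<lambda>x. if x \<in> basis_vec ` T then lookup d (the_inv_into T basis_vec x) else 0)"

context
  assumes nontriv: "(0::'k) \<noteq> 1"
begin

lemma lookup_pull: "lookup (pull c) t = (if t \<in> T then lookup c (basis_vec t) else 0)"
proof -
  have "finite (basis_vec -` keys c \<inter> T)" by (intro finite_vimage_IntI basis_vec_inj nontriv) auto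
  then have "finite {t. (if t \<in> T then lookup c (basis_vec t) else 0) \<noteq> 0}"
    by (rule rev_finite_subset) (auto simp: in_keys_iff)
  then show ?thesis unfolding pull_def by (simp add: Abs_poly_mapping_inverse)
qed

lemma lookup_push: "lookup (push d) x = (if x \<in> basis_vec ` T then lookup d (the_inv_into T basis_vec x) else 0)"
proof -
  have "{x. (if x \<in> basis_vec ` T then lookup d (the_inv_into T basis_vec x) else 0) \<noteq> 0} \<subseteq> basis_vec ` keys d"
    by (auto simp: in_keys_iff the_inv_into_f_f[OF basis_vec_inj[OF nontriv]] split: if_splits)
  then have "finite {x. (if x \<in> basis_vec ` T then lookup d (the_inv_into T basis_vec x) else 0) \<noteq> 0}"
    by (rule finite_subset) simp
  then show ?thesis unfolding push_def by (simp add: Abs_poly_mapping_inverse)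
qed

lemma pull_push: "keys d \<subseteq> T \<Longrightarrow> pull (push d) = d"
  by (rule poly_mapping_eqI) (auto simp: lookup_pull lookup_push the_inv_into_f_f[OF basis_vec_inj[OF nontriv]] in_keys_iff)

lemma keys_pull: "keys c \<subseteq> basis_vec ` T \<Longrightarrow> keys c = basis_vec ` keys (pull c) \<and> keys (pull c) \<subseteq> T"
  by (auto simp: in_keys_iff lookup_pull split: if_splits)

lemma pull_coeffs: "c \<in> coeffs_in R' (basis_vec ` T) \<Longrightarrow> 0 \<in> R' \<Longrightarrow> pull c \<in> coeffs_in R' T"
  using keys_pull[of c] by (auto simp: coeffs_in_iff lookup_pull)

lemma push_coeffs: "d \<in> coeffs_in R' T \<Longrightarrow> 0 \<in> R' \<Longrightarrow> push d \<in> coeffs_in R' (basis_vec ` T)"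
  by (auto simp: coeffs_in_iff lookup_push in_keys_iff split: if_splits)

lemma lincomb_pull:
  assumes c: "c \<in> coeffs_in R (basis_vec ` T)"
  shows "lincomb V c = \<Phi> (pull c)"
proof -
  let ?K = "keys (pull c)"
  have K: "keys c = basis_vec ` ?K" "?K \<subseteq> T" using c keys_pull by (auto simp: coeffs_in_iff)
  have pc: "pull c \<in> coeffs_in R T" by (rule pull_coeffs[OF c R(1)])
  have inj: "inj_on basis_vec ?K" using basis_vec_inj[OF nontriv] K(2) by (rule inj_on_subset)
  have summand: "lookup c (basis_vec t) \<odot>\<^bsub>V\<^esub> basis_vec t = \<Phi> (single t (lookup (pull c) t))"
    if "t \<in> ?K" for t
  proof -
    have t: "t \<in> T" using that K by auto
    have "lookup c (basis_vec t) \<in> R" using c by (simp add: coeffs_in_iff)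
    then have "lookup c (basis_vec t) \<odot>\<^bsub>V\<^esub> basis_vec t = \<Phi> (Poly_Mapping.map ((*) (lookup c (basis_vec t))) (single t 1))"
      unfolding basis_vec_def by (rule \<Phi>_scl[OF _ C_single[OF t R(2)], symmetric])
    also have "Poly_Mapping.map ((*) (lookup c (basis_vec t))) (single t 1)
      = single t (lookup (pull c) t)"
      using t by (intro poly_mapping_eqI) (auto simp: lookup_map_times lookup_single when_def lookup_pull)
    finally show ?thesis .
  qed
  have single: "single t (lookup (pull c) t) \<in> coeffs_in R T" if "t \<in> ?K" for t
    using that K pc by (intro C_single) (auto simp: coeffs_in_iff)
  have "lincomb V c = (\<Oplus>\<^bsub>V\<^esub>t\<in>?K. lookup c (basis_vec t) \<odot>\<^bsub>V\<^esub> basis_vec t)"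
    unfolding lincomb_def K(1)
    by (rule finsum_reindex[OF _ inj]) (auto simp: summand single \<Phi>_closed)
  also have "\<dots> = (\<Oplus>\<^bsub>V\<^esub>t\<in>?K. \<Phi> (single t (lookup (pull c) t)))"
    by (rule finsum_cong') (auto simp: summand single \<Phi>_closed)
  also have "\<dots> = \<Phi> (\<Sum>t\<in>?K. single t (lookup (pull c) t))"
    by (rule \<Phi>_sum) (auto simp: single)
  also have "(\<Sum>t\<in>?K. single t (lookup (pull c) t)) = pull c"
    by (rule poly_mapping_eqI) (simp add: Poly_Mapping.lookup_sum lookup_single when_def in_keys_iff)
  finally show ?thesis .
qed

lemma lincomb_image:
  assumes "R' \<subseteq> R" "0 \<in> R'"
  shows "lincomb V ` coeffs_in R' (basis_vec ` T) = \<Phi> ` coeffs_in R' T"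
proof -
  have sub: "c \<in> coeffs_in R (basis_vec ` T)" if "c \<in> coeffs_in R' (basis_vec ` T)" for c
    using that assms by (auto simp: coeffs_in_iff)
  have "\<Phi> d \<in> lincomb V ` coeffs_in R' (basis_vec ` T)" if "d \<in> coeffs_in R' T" for d
    using that push_coeffs[OF that assms(2)] lincomb_pull[OF sub, of "push d"] pull_push[of d]
    by (intro image_eqI[of _ _ "push d"]) (auto simp: coeffs_in_iff)
  then show ?thesis using lincomb_pull[OF sub] pull_coeffs[OF _ assms(2)] by auto
qed

lemma is_basis_basis_vec: "is_basis R V (basis_vec ` T)"
  unfolding is_basis_def
proof (intro conjI ballI impI)
  show "basis_vec ` T \<subseteq> carrier V" by (auto intro: basis_vec_closed)
  fix x assume "x \<in> carrier V"
  then have "x \<in> lincomb V ` coeffs_in R (basis_vec ` T)"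
    using bij lincomb_image[OF subset_refl R(1)] by (simp add: bij_betw_def)
  then show "\<exists>c\<in>coeffs_in R (basis_vec ` T). x = lincomb V c" by blast
next
  fix c assume c: "c \<in> coeffs_in R (basis_vec ` T)" "lincomb V c = \<zero>\<^bsub>V\<^esub>"
  then have "\<Phi> (pull c) = \<Phi> 0" by (simp add: lincomb_pull \<Phi>_zero)
  then have "pull c = 0" using bij pull_coeffs[OF c(1) R(1)] C_zero by (auto simp: bij_betw_def dest: inj_onD)
  then have "keys c = {}" using keys_pull[of c] c(1) by (simp add: coeffs_in_iff)
  then show "c = 0" by simp
qed

end

end

section \<open>The standard lattice and basis of one summand\<close>

lemma A0_subring: "0 \<in> A0" "1 \<in> A0" "\<And>a b. a \<in> A0 \<Longrightarrow> b \<in> A0 \<Longrightarrow> a + b \<in> A0" "\<And>a. a \<in> A0 \<Longrightarrow> - a \<in> A0"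
      "\<And>a b. a \<in> A0 \<Longrightarrow> b \<in> A0 \<Longrightarrow> a * b \<in> A0"
  by simp_all

lemma vs_simps [simp]:
  "carrier (vs M) = carrier M" "add (vs M) = add M" "zero (vs M) = zero M"
  "c \<odot>\<^bsub>vs M\<^esub> x = uq_const c \<odot>\<^bsub>M\<^esub> x"
  by (simp_all add: vs_def restrict_scalars_def)

interpretation Mb: coord "vs (Mbar \<mu>)" UNIV "Collect dec" "\<lambda>c. hw_map \<mu> (ncomb c)" for \<mu>
proof
  have "bij_betw (hw_map \<mu>) UNIV (carrier (Mbar \<mu>))"
    unfolding Mbar_carrier using hw_map_inj by (rule inj_on_imp_bij_betw)
  from bij_betw_trans[OF ncomb_bij this]
  show "bij_betw (\<lambda>c. hw_map \<mu> (ncomb c)) (coeffs_in UNIV (Collect dec)) (carrier (vs (Mbar \<mu>)))"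
    by (simp add: comp_def coeffs_in_def)
qed (auto simp: ncomb_add hw_map_add ncomb_scl hw_map_smult uact_const hw_map_zero)

lemma hw_vec_one: "hw_vec \<mu> = hw_map \<mu> 1"
  by (simp add: hw_vec_def regular_r_coset hw_map_Jcos nm_to_uq_one)

lemma foldr_hw:
  "foldr (\<lambda>n y. uq_gen (Xm n) \<odot>\<^bsub>Mbar \<mu>\<^esub> y) ns (hw_vec \<mu>) = hw_map \<mu> (mon ns)"
  by (induction ns) (simp_all add: hw_vec_one hw_map_smult uact_gen)

lemma tilde_summand_hw: "tilde_summand \<mu> T (hw_map \<mu> a) = hw_map \<mu> (T a)"
  by (simp add: tilde_summand_def inv_f_f[OF hw_map_inj])

lemma foldr_tilde_hw:
  "foldr (\<lambda>n. tilde_summand \<mu> (\<lambda>a. nm_gen n * a)) ns (hw_vec \<mu>) = hw_map \<mu> (mon ns)"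
  by (induction ns) (simp_all add: hw_vec_one tilde_summand_hw)

lemma std_lattice_summand_eq: "std_lattice_summand \<mu> = hw_map \<mu> ` (nlat :: 'f::field_char_0 nm set)"
proof -
  have "{foldr (\<lambda>n y. uq_gen (Xm n) \<odot>\<^bsub>Mbar \<mu>\<^esub> y) ns (hw_vec \<mu>) | ns. dec ns}
     = (Mb.basis_vec \<mu> ` Collect dec :: 'f uq set set)"
    unfolding foldr_hw by (auto simp: Mb.basis_vec_def ncomb_single)
  then have "std_lattice_summand \<mu> = lincomb (vs (Mbar \<mu>)) ` coeffs_in A0 (Mb.basis_vec \<mu> ` Collect dec :: 'f uq set set)"
    by (simp add: std_lattice_summand_def)
  also have "\<dots> = (\<lambda>c. hw_map \<mu> (ncomb c)) ` coeffs_in A0 (Collect dec)"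
    by (rule Mb.lincomb_image) auto
  finally show ?thesis by (simp add: nlat_eq image_image)
qed

lemma residue_class_Mbar:
  "residue_class (Mbar \<mu>) (std_lattice_summand \<mu>) (hw_map \<mu> a) = hw_map \<mu> ` {b. b \<approx> a}"
proof -
  have "residue_class (Mbar \<mu>) (std_lattice_summand \<mu>) (hw_map \<mu> a) = {hw_map \<mu> (qh *\<^sub>N y + a) | y. y \<in> nlat}"
    by (auto simp: residue_class_def a_r_coset_def' qh_mult_def std_lattice_summand_eq hw_map_smult uact_const hw_map_add)
  also have "\<dots> = hw_map \<mu> ` {b. b \<approx> a}"
  proof (intro equalityI subsetI)
    fix X assume "X \<in> {hw_map \<mu> (qh *\<^sub>N y + a) | y. y \<in> nlat}"
    then obtain y where "X = hw_map \<mu> (qh *\<^sub>N y + a)" "y \<in> nlat" by blast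
    then show "X \<in> hw_map \<mu> ` {b. b \<approx> a}"
      by (intro image_eqI[of _ _ "qh *\<^sub>N y + a"]) (auto simp: qcong_def)
  next
    fix X assume "X \<in> hw_map \<mu> ` {b. b \<approx> a}"
    then obtain b y where "X = hw_map \<mu> b" "y \<in> nlat" "b - a = qh *\<^sub>N y" by (auto simp: qcong_def)
    moreover from this have "b = qh *\<^sub>N y + a" by (simp add: algebra_simps)
    ultimately show "X \<in> {hw_map \<mu> (qh *\<^sub>N y + a) | y. y \<in> nlat}" by blast
  qed
  finally show ?thesis .
qed

lemma std_basis_summand_eq:
  "std_basis_summand \<mu> = (\<lambda>ns. hw_map \<mu> ` {b. b \<approx> mon ns}) ` Collect dec"
  by (auto simp: std_basis_summand_def foldr_tilde_hw residue_class_Mbar)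

section \<open>A module with a decomposition\<close>

definition fsupp :: "'i set \<Rightarrow> ('i \<Rightarrow> 'f::field_char_0 nm) set" where
  "fsupp I = {p. finite {i. p i \<noteq> 0} \<and> (\<forall>i. i \<notin> I \<longrightarrow> p i = 0)}"

lemma fsupp_add: "p \<in> fsupp I \<Longrightarrow> r \<in> fsupp I \<Longrightarrow> (\<lambda>i. p i + r i) \<in> fsupp I"
proof -
  assume a: "p \<in> fsupp I" "r \<in> fsupp I"
  have "{i. p i + r i \<noteq> 0} \<subseteq> {i. p i \<noteq> 0} \<union> {i. r i \<noteq> 0}" by auto
  then show ?thesis using a by (auto simp: fsupp_def intro: finite_subset)
qed

lemma fsupp_map: "p \<in> fsupp I \<Longrightarrow> (\<And>i. F i 0 = 0) \<Longrightarrow> (\<lambda>i. F i (p i)) \<in> fsupp I"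
proof -
  assume a: "p \<in> fsupp I" "\<And>i. F i 0 = 0"
  have "{i. F i (p i) \<noteq> 0} \<subseteq> {i. p i \<noteq> 0}" using a(2) by (auto intro: ccontr)
  then show ?thesis using a by (auto simp: fsupp_def intro: finite_subset)
qed

lemma fsupp_zero: "(\<lambda>i. 0) \<in> fsupp I" by (simp add: fsupp_def)

definition at_summand :: "'i \<Rightarrow> 'f::field_char_0 nm \<Rightarrow> 'i \<Rightarrow> 'f nm" where
  "at_summand i a = (\<lambda>j. if j = i then a else 0)"

lemma at_summand_fsupp: "i \<in> I \<Longrightarrow> at_summand i a \<in> fsupp I"
  by (auto simp: fsupp_def at_summand_def)

text \<open>The decomposition of \<open>M\<close> identifies it with a direct sum of copies of \<open>\<N>\<close> (the map \<open>\<Psi>\<close>), on which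
\<open>u\<close> in \<open>U\<^sub>q\<close> acts on the \<open>i\<close>-th summand by \<open>uact (lam i) u\<close>.\<close>

locale decomposed =
  fixes M :: "('f::field_char_0 uq, 'm) module" and I :: "'i set" and lam :: "'i \<Rightarrow> weight"
    and \<theta> :: "('i \<Rightarrow> 'f uq set) \<Rightarrow> 'm"
  assumes left_module: "left_module M" and decomposes: "decomposes M I lam \<theta>"
begin

abbreviation D :: "('f uq, 'i \<Rightarrow> 'f uq set) module" where "D \<equiv> dsum I (\<lambda>i. Mbar (lam i))"

definition emb :: "('i \<Rightarrow> 'f nm) \<Rightarrow> 'i \<Rightarrow> 'f uq set" where
  "emb p = (\<lambda>i\<in>I. hw_map (lam i) (p i))"

definition \<Psi> :: "('i \<Rightarrow> 'f nm) \<Rightarrow> 'm" where "\<Psi> p = \<theta> (emb p)"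

lemma emb_bij: "bij_betw emb (fsupp I) (carrier D)"
proof (rule bij_betw_imageI)
  show "inj_on emb (fsupp I)"
  proof (rule inj_onI)
    fix p r assume pr: "p \<in> fsupp I" "r \<in> fsupp I" "emb p = emb r"
    show "p = r"
    proof
      fix i
      show "p i = r i"
      proof (cases "i \<in> I")
        case True
        then show ?thesis using fun_cong[OF pr(3), of i] by (simp add: emb_def)
      qed (use pr in \<open>simp add: fsupp_def\<close>)
    qed
  qed
  have zero: "{i \<in> I. hw_map (lam i) (p i) \<noteq> hw_map (lam i) 0} = {i. p i \<noteq> 0}" if "p \<in> fsupp I" for p :: "'i \<Rightarrow> 'f nm"
    using that by (auto simp: fsupp_def)
  show "emb ` fsupp I = carrier D"
  proof (intro equalityI subsetI)
    fix g assume "g \<in> emb ` fsupp I"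
    then obtain p where p: "p \<in> fsupp I" "g = emb p" by blast
    have "{i \<in> I. emb p i \<noteq> \<zero>\<^bsub>Mbar (lam i)\<^esub>} = {i \<in> I. hw_map (lam i) (p i) \<noteq> hw_map (lam i) 0}"
      by (auto simp: emb_def hw_map_zero)
    then have "finite {i \<in> I. emb p i \<noteq> \<zero>\<^bsub>Mbar (lam i)\<^esub>}"
      using p(1) unfolding zero[OF p(1)] by (simp add: fsupp_def)
    then show "g \<in> carrier D" using p(2) by (auto simp: dsum_def emb_def Mbar_carrier)
  next
    fix g assume g: "g \<in> carrier D"
    have "\<forall>i\<in>I. \<exists>a. g i = hw_map (lam i) a" using g by (auto simp: dsum_def Mbar_carrier PiE_iff)
    then obtain p where p: "\<And>i. i \<in> I \<Longrightarrow> g i = hw_map (lam i) (p i)" by metis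
    let ?p = "\<lambda>i. if i \<in> I then p i else 0"
    have "{i. ?p i \<noteq> 0} = {i \<in> I. g i \<noteq> \<zero>\<^bsub>Mbar (lam i)\<^esub>}" by (auto simp: p hw_map_zero)
    then have "?p \<in> fsupp I" using g by (simp add: fsupp_def dsum_def)
    moreover have "g = emb ?p" using g by (auto simp: dsum_def emb_def p PiE_iff extensional_def fun_eq_iff)
    ultimately show "g \<in> emb ` fsupp I" by blast
  qed
qed

lemma \<theta>: "bij_betw \<theta> (carrier D) (carrier M)"
  "x \<in> carrier D \<Longrightarrow> y \<in> carrier D \<Longrightarrow> \<theta> (x \<oplus>\<^bsub>D\<^esub> y) = \<theta> x \<oplus>\<^bsub>M\<^esub> \<theta> y"
  "x \<in> carrier D \<Longrightarrow> \<theta> (u \<odot>\<^bsub>D\<^esub> x) = u \<odot>\<^bsub>M\<^esub> \<theta> x"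
  using decomposes by (auto simp: decomposes_def module_iso_def)

lemma emb_D: "p \<in> fsupp I \<Longrightarrow> emb p \<in> carrier D"
  using emb_bij by (auto simp: bij_betw_def)

lemma \<Psi>_bij: "bij_betw \<Psi> (fsupp I) (carrier M)"
  using bij_betw_trans[OF emb_bij \<theta>(1)] by (simp add: \<Psi>_def comp_def cong: bij_betw_cong)

lemma \<Psi>_inj: "p \<in> fsupp I \<Longrightarrow> r \<in> fsupp I \<Longrightarrow> \<Psi> p = \<Psi> r \<longleftrightarrow> p = r"
  using \<Psi>_bij by (auto simp: bij_betw_def dest: inj_onD)

lemma \<Psi>_closed: "p \<in> fsupp I \<Longrightarrow> \<Psi> p \<in> carrier M"
  using \<Psi>_bij by (auto simp: bij_betw_def)

lemma \<Psi>_add: "p \<in> fsupp I \<Longrightarrow> r \<in> fsupp I \<Longrightarrow> \<Psi> p \<oplus>\<^bsub>M\<^esub> \<Psi> r = \<Psi> (\<lambda>i. p i + r i)"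
proof -
  assume "p \<in> fsupp I" "r \<in> fsupp I"
  moreover have "emb p \<oplus>\<^bsub>D\<^esub> emb r = emb (\<lambda>i. p i + r i)"
    by (auto simp: dsum_def emb_def hw_map_add intro!: restrict_ext)
  ultimately show ?thesis by (simp add: \<Psi>_def emb_D flip: \<theta>(2))
qed

lemma \<Psi>_smult: "p \<in> fsupp I \<Longrightarrow> u \<odot>\<^bsub>M\<^esub> \<Psi> p = \<Psi> (\<lambda>i. uact (lam i) u (p i))"
proof -
  assume "p \<in> fsupp I"
  moreover have "u \<odot>\<^bsub>D\<^esub> emb p = emb (\<lambda>i. uact (lam i) u (p i))"
    by (auto simp: dsum_def emb_def hw_map_smult intro!: restrict_ext)
  ultimately show ?thesis by (simp add: \<Psi>_def emb_D flip: \<theta>(3))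
qed

lemma abelian_group_M: "abelian_group M"
  using left_module by (simp add: left_module_def)

lemma \<Psi>_zero: "\<Psi> (\<lambda>i. 0) = \<zero>\<^bsub>M\<^esub>"
proof -
  interpret abelian_group M by (rule abelian_group_M)
  have "\<Psi> (\<lambda>i. 0) \<oplus>\<^bsub>M\<^esub> \<Psi> (\<lambda>i. 0) = \<Psi> (\<lambda>i. 0)" using \<Psi>_add[OF fsupp_zero fsupp_zero] by simp
  then show ?thesis using \<Psi>_closed[OF fsupp_zero] by (metis add.l_cancel_one')
qed

lemma \<Psi>_const: "p \<in> fsupp I \<Longrightarrow> uq_const c \<odot>\<^bsub>M\<^esub> \<Psi> p = \<Psi> (\<lambda>i. c *\<^sub>N p i)"
  by (simp add: \<Psi>_smult uact_const)

lemma tilde_op_\<Psi>: "p \<in> fsupp I \<Longrightarrow> tilde_op I lam \<theta> T (\<Psi> p) = \<Psi> (\<lambda>i. T (p i))"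
proof -
  assume "p \<in> fsupp I"
  then have inv: "inv_into (carrier D) \<theta> (\<theta> (emb p)) = emb p"
    using \<theta>(1) emb_D by (auto simp: bij_betw_def intro!: inv_into_f_f)
  show ?thesis unfolding tilde_op_def \<Psi>_def inv
    by (rule arg_cong[of _ _ \<theta>]) (auto simp: emb_def tilde_summand_hw intro!: restrict_ext)
qed

definition lat :: "'m set" where "lat = \<Psi> ` {p \<in> fsupp I. \<forall>i. p i \<in> nlat}"

lemma std_lattice_lat: "std_lattice I lam \<theta> = lat"
proof -
  have "{f \<in> carrier D. \<forall>i\<in>I. f i \<in> std_lattice_summand (lam i)} = emb ` {p \<in> fsupp I. \<forall>i. p i \<in> nlat}"
  proof (intro equalityI subsetI)
    fix g assume g: "g \<in> {f \<in> carrier D. \<forall>i\<in>I. f i \<in> std_lattice_summand (lam i)}"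
    then obtain p where p: "p \<in> fsupp I" "g = emb p" using emb_bij by (auto simp: bij_betw_def)
    have "p i \<in> nlat" for i
      using g p by (cases "i \<in> I") (auto simp: fsupp_def emb_def std_lattice_summand_eq nlat.zero)
    then show "g \<in> emb ` {p \<in> fsupp I. \<forall>i. p i \<in> nlat}" using p by blast
  next
    fix g assume "g \<in> emb ` {p \<in> fsupp I. \<forall>i. p i \<in> nlat}"
    then show "g \<in> {f \<in> carrier D. \<forall>i\<in>I. f i \<in> std_lattice_summand (lam i)}"
      using emb_D by (auto simp: std_lattice_summand_eq) (auto simp: emb_def)
  qed
  then show ?thesis unfolding std_lattice_def lat_def \<Psi>_def by (simp add: image_image)
qed

definition res_cls :: "('i \<Rightarrow> 'f nm) \<Rightarrow> 'm set" where
  "res_cls p = \<Psi> ` {p' \<in> fsupp I. \<forall>i. p' i \<approx> p i}"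

lemma qh_mult_lat: "qh_mult M lat = res_cls (\<lambda>i. 0)"
proof -
  have "qh_mult M lat = {\<Psi> (\<lambda>i. qh *\<^sub>N p i) | p. p \<in> fsupp I \<and> (\<forall>i. p i \<in> nlat)}"
  proof -
    have "qh_mult M lat = (\<lambda>p. \<Psi> (\<lambda>i. qh *\<^sub>N p i)) ` {p \<in> fsupp I. \<forall>i. p i \<in> nlat}"
      unfolding qh_mult_def lat_def image_image by (intro image_cong) (auto simp: \<Psi>_const)
    then show ?thesis by auto
  qed
  also have "\<dots> = res_cls (\<lambda>i. 0)"
  proof (intro equalityI subsetI)
    fix x assume "x \<in> {\<Psi> (\<lambda>i. qh *\<^sub>N p i) | p. p \<in> fsupp I \<and> (\<forall>i. p i \<in> nlat)}"
    then obtain p where p: "p \<in> fsupp I" "\<forall>i. p i \<in> nlat" "x = \<Psi> (\<lambda>i. qh *\<^sub>N p i)" by blast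
    then show "x \<in> res_cls (\<lambda>i. 0)" unfolding res_cls_def
      by (intro image_eqI[of _ _ "\<lambda>i. qh *\<^sub>N p i"]) (auto simp: fsupp_map[where F = "\<lambda>i a. qh *\<^sub>N a"] qcong_def)
  next
    fix x assume "x \<in> res_cls (\<lambda>i. 0)"
    then obtain p where p: "p \<in> fsupp I" "\<And>i. p i \<approx> 0" "x = \<Psi> p" by (auto simp: res_cls_def)
    let ?r = "\<lambda>i. inverse qh *\<^sub>N p i"
    have "?r i \<in> nlat" for i using p(2)[of i] qh_nonzero[where 'f='f] by (auto simp: qcong_def)
    moreover have "?r \<in> fsupp I" using p(1) by (rule fsupp_map) simp
    moreover have "x = \<Psi> (\<lambda>i. qh *\<^sub>N ?r i)" using p(3) qh_nonzero[where 'f='f] by simp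
    ultimately show "x \<in> {\<Psi> (\<lambda>i. qh *\<^sub>N p i) | p. p \<in> fsupp I \<and> (\<forall>i. p i \<in> nlat)}"
      by (intro CollectI exI[of _ ?r]) simp
  qed
  finally show ?thesis .
qed

lemma fsupp_minus: "p \<in> fsupp I \<Longrightarrow> r \<in> fsupp I \<Longrightarrow> (\<lambda>i. p i - r i) \<in> fsupp I"
  using fsupp_add[of p I "\<lambda>i. - r i"] fsupp_map[of r I "\<lambda>i a. - a"] by simp

lemma res_cls_coset: "p \<in> fsupp I \<Longrightarrow> res_cls (\<lambda>i. 0) +>\<^bsub>M\<^esub> \<Psi> p = res_cls p"
proof -
  assume p: "p \<in> fsupp I"
  have "res_cls (\<lambda>i. 0) +>\<^bsub>M\<^esub> \<Psi> p = {\<Psi> (\<lambda>i. r i + p i) | r. r \<in> fsupp I \<and> (\<forall>i. r i \<approx> 0)}"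
    using p by (auto simp: a_r_coset_def' res_cls_def \<Psi>_add)
  also have "\<dots> = res_cls p"
  proof (intro equalityI subsetI)
    fix x assume "x \<in> {\<Psi> (\<lambda>i. r i + p i) | r. r \<in> fsupp I \<and> (\<forall>i. r i \<approx> 0)}"
    then obtain r where r: "x = \<Psi> (\<lambda>i. r i + p i)" "r \<in> fsupp I" "\<And>i. r i \<approx> 0" by blast
    then show "x \<in> res_cls p" unfolding res_cls_def
      using fsupp_add[OF r(2) p] qcong_add[OF r(3) qcong_refl] by (intro image_eqI[of _ _ "\<lambda>i. r i + p i"]) auto
  next
    fix x assume "x \<in> res_cls p"
    then obtain r where r: "x = \<Psi> r" "r \<in> fsupp I" "\<And>i. r i \<approx> p i" by (auto simp: res_cls_def)
    then show "x \<in> {\<Psi> (\<lambda>i. r i + p i) | r. r \<in> fsupp I \<and> (\<forall>i. r i \<approx> 0)}"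
      using fsupp_minus[OF r(2) p] by (intro CollectI exI[of _ "\<lambda>i. r i - p i"]) (auto simp: qcong_def)
  qed
  finally show ?thesis .
qed

lemma residue_class_\<Psi>: "p \<in> fsupp I \<Longrightarrow> residue_class M lat (\<Psi> p) = res_cls p"
  by (simp add: residue_class_def qh_mult_lat res_cls_coset)

lemma res_cls_eq_iff: "p \<in> fsupp I \<Longrightarrow> res_cls p = res_cls r \<longleftrightarrow> (\<forall>i. p i \<approx> r i)"
proof
  assume p: "p \<in> fsupp I" "res_cls p = res_cls r"
  then have "\<Psi> p \<in> res_cls r" by (auto simp: res_cls_def)
  then show "\<forall>i. p i \<approx> r i" using p(1) by (auto simp: res_cls_def \<Psi>_inj)
next
  assume "\<forall>i. p i \<approx> r i"
  then show "res_cls p = res_cls r" unfolding res_cls_def by (metis qcong_sym qcong_trans)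
qed

lemma res_cls_add: "p \<in> fsupp I \<Longrightarrow> r \<in> fsupp I \<Longrightarrow> res_cls p <+>\<^bsub>M\<^esub> res_cls r = res_cls (\<lambda>i. p i + r i)"
proof -
  assume pr: "p \<in> fsupp I" "r \<in> fsupp I"
  have "res_cls p <+>\<^bsub>M\<^esub> res_cls r = {\<Psi> (\<lambda>i. a i + b i) | a b. a \<in> fsupp I \<and> (\<forall>i. a i \<approx> p i) \<and> b \<in> fsupp I \<and> (\<forall>i. b i \<approx> r i)}"
    by (auto simp: set_add_def' res_cls_def \<Psi>_add)
  also have "\<dots> = res_cls (\<lambda>i. p i + r i)"
  proof (intro equalityI subsetI)
    fix x assume "x \<in> {\<Psi> (\<lambda>i. a i + b i) | a b. a \<in> fsupp I \<and> (\<forall>i. a i \<approx> p i) \<and> b \<in> fsupp I \<and> (\<forall>i. b i \<approx> r i)}"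
    then obtain a b where ab: "x = \<Psi> (\<lambda>i. a i + b i)" "a \<in> fsupp I" "\<And>i. a i \<approx> p i" "b \<in> fsupp I" "\<And>i. b i \<approx> r i" by blast
    then show "x \<in> res_cls (\<lambda>i. p i + r i)" unfolding res_cls_def
      using fsupp_add[OF ab(2,4)] qcong_add[OF ab(3,5)] by (intro image_eqI[of _ _ "\<lambda>i. a i + b i"]) auto
  next
    fix x assume "x \<in> res_cls (\<lambda>i. p i + r i)"
    then obtain a where a: "x = \<Psi> a" "a \<in> fsupp I" "\<And>i. a i \<approx> p i + r i" by (auto simp: res_cls_def)
    have "a i - r i \<approx> p i" for i using a(3)[of i] by (simp add: qcong_def algebra_simps)
    then show "x \<in> {\<Psi> (\<lambda>i. a i + b i) | a b. a \<in> fsupp I \<and> (\<forall>i. a i \<approx> p i) \<and> b \<in> fsupp I \<and> (\<forall>i. b i \<approx> r i)}"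
      using fsupp_minus[OF a(2) pr(2)] pr(2) a(1)
      by (intro CollectI exI[of _ "\<lambda>i. a i - r i"] exI[of _ r]) auto
  qed
  finally show ?thesis .
qed

lemma res_cls_nonempty: "p \<in> fsupp I \<Longrightarrow> res_cls p \<noteq> {}"
  by (auto simp: res_cls_def)

abbreviation Q where "Q \<equiv> residue_space M lat"

lemma Q_simps:
  "carrier Q = res_cls ` {p \<in> fsupp I. \<forall>i. p i \<in> nlat}"
  "\<zero>\<^bsub>Q\<^esub> = res_cls (\<lambda>i. 0)"
  "p \<in> fsupp I \<Longrightarrow> r \<in> fsupp I \<Longrightarrow> res_cls p \<oplus>\<^bsub>Q\<^esub> res_cls r = res_cls (\<lambda>i. p i + r i)"
  "p \<in> fsupp I \<Longrightarrow> a \<odot>\<^bsub>Q\<^esub> res_cls p = res_cls (\<lambda>i. rq_const a *\<^sub>N p i)"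
proof -
  let ?W = "restrict_scalars rq_const ((vs M)\<lparr>carrier := lat\<rparr>)"
  have coset: "X +>\<^bsub>?W\<^esub> x = X +>\<^bsub>M\<^esub> x" for X x
    by (simp add: a_r_coset_def' restrict_scalars_def)
  have carr: "carrier ?W = lat" by (simp add: restrict_scalars_def)
  show "carrier Q = res_cls ` {p \<in> fsupp I. \<forall>i. p i \<in> nlat}"
  proof -
    have "carrier Q = (\<lambda>x. residue_class M lat x) ` lat"
      by (auto simp: residue_space_def quot_module_def A_RCOSETS_def' coset carr residue_class_def)
    also have "\<dots> = res_cls ` {p \<in> fsupp I. \<forall>i. p i \<in> nlat}"
    proof -
      have "g ` lat = (\<lambda>p. g (\<Psi> p)) ` {p \<in> fsupp I. \<forall>i. p i \<in> nlat}" for g :: "'m \<Rightarrow> 'm set"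
        by (simp add: lat_def image_image)
      then show ?thesis by (simp add: residue_class_\<Psi>)
    qed
    finally show ?thesis .
  qed
  show "\<zero>\<^bsub>Q\<^esub> = res_cls (\<lambda>i. 0)" by (simp add: residue_space_def quot_module_def qh_mult_lat)
  show "res_cls p \<oplus>\<^bsub>Q\<^esub> res_cls r = res_cls (\<lambda>i. p i + r i)" if "p \<in> fsupp I" "r \<in> fsupp I"
    using res_cls_add[OF that] by (simp add: residue_space_def quot_module_def set_add_def' restrict_scalars_def)
  show "a \<odot>\<^bsub>Q\<^esub> res_cls p = res_cls (\<lambda>i. rq_const a *\<^sub>N p i)" if p: "p \<in> fsupp I"
  proof -
    have "a \<odot>\<^bsub>Q\<^esub> res_cls p = (\<Union>x\<in>res_cls p. residue_class M lat (uq_const (rq_const a) \<odot>\<^bsub>M\<^esub> x))"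
      unfolding residue_space_def quot_module_def residue_class_def by (simp add: coset) (simp add: restrict_scalars_def)
    moreover have "residue_class M lat (uq_const (rq_const a) \<odot>\<^bsub>M\<^esub> x) = res_cls (\<lambda>i. rq_const a *\<^sub>N p i)" if "x \<in> res_cls p" for x
    proof -
      from that obtain r where r: "r \<in> fsupp I" "\<And>i. r i \<approx> p i" "x = \<Psi> r" unfolding res_cls_def by auto
      have "(\<lambda>i. rq_const a *\<^sub>N r i) \<in> fsupp I" using r(1) by (rule fsupp_map) simp
      then show ?thesis using r qcong_scl[OF r(2), of "rq_const a"]
        by (simp add: \<Psi>_const residue_class_\<Psi> res_cls_eq_iff)
    qed
    ultimately show ?thesis using res_cls_nonempty[OF p] by auto
  qed
qed

text \<open>The operator on the residue space is well defined since \<open>T\<close> respects congruence.\<close>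

lemma induced_op_res_cls:
  assumes p: "p \<in> fsupp I" and T: "lin T" "\<And>a b. a \<approx> b \<Longrightarrow> T a \<approx> T b"
  shows "induced_op M lat (tilde_op I lam \<theta> T) (res_cls p) = res_cls (\<lambda>i. T (p i))"
proof -
  have "residue_class M lat (tilde_op I lam \<theta> T x) = res_cls (\<lambda>i. T (p i))" if "x \<in> res_cls p" for x
  proof -
    from that obtain r where r: "r \<in> fsupp I" "\<And>i. r i \<approx> p i" "x = \<Psi> r" unfolding res_cls_def by auto
    have "(\<lambda>i. T (r i)) \<in> fsupp I" using r(1) by (rule fsupp_map) (rule lin_zero[OF T(1)])
    then show ?thesis using r T(2)[OF r(2)] by (simp add: tilde_op_\<Psi> residue_class_\<Psi> res_cls_eq_iff)
  qed
  then show ?thesis using res_cls_nonempty[OF p] unfolding induced_op_def by auto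
qed

definition \<beta> :: "'i \<times> int list \<Rightarrow> 'm set" where
  "\<beta> t = res_cls (at_summand (fst t) (mon (snd t)))"

abbreviation labels :: "('i \<times> int list) set" where "labels \<equiv> I \<times> Collect dec"

lemma std_basis_\<beta>: "std_basis M I lam \<theta> = \<beta> ` labels"
proof -
  have eq: "(\<Union>y\<in>hw_map (lam i) ` {b. b \<approx> mon ns}. residue_class M lat (\<theta> (dsum_incl I lam i y))) = \<beta> (i, ns)"
    if i: "i \<in> I" for i ns
  proof -
    have "residue_class M lat (\<theta> (dsum_incl I lam i (hw_map (lam i) b))) = \<beta> (i, ns)" if "b \<approx> mon ns" for b
    proof -
      have "dsum_incl I lam i (hw_map (lam i) b) = emb (at_summand i b)"
        by (auto simp: dsum_incl_def emb_def at_summand_def hw_map_zero intro!: restrict_ext)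
      then show ?thesis using that residue_class_\<Psi>[OF at_summand_fsupp[OF i], of b]
        by (simp add: \<Psi>_def \<beta>_def res_cls_eq_iff at_summand_fsupp i) (simp add: at_summand_def)
    qed
    then show ?thesis by auto (use qcong_refl in blast)
  qed
  have "(\<lambda>X. \<Union>y\<in>X. residue_class M lat (\<theta> (dsum_incl I lam i y))) ` std_basis_summand (lam i)
    = (\<lambda>ns. \<beta> (i, ns)) ` Collect dec" if "i \<in> I" for i
    unfolding std_basis_summand_eq image_image using eq[OF that, unfolded image_image] by (intro image_cong) simp_all
  then show ?thesis unfolding std_basis_def std_lattice_lat by auto
qed

end

section \<open>Extension of scalars\<close>

text \<open>Every element of the field has the form \<open>q\<^sup>-\<^sup>n\<^sup>/\<^sup>2 a\<close> with \<open>a\<close> in the local ring. Hence every tensor is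
pure, of the form \<open>q\<^sup>-\<^sup>n\<^sup>/\<^sup>2 \<otimes> x\<close> (\<open>normal\<close> in the proof), and its image \<open>q\<^sup>-\<^sup>n\<^sup>/\<^sup>2 x\<close> vanishes only if \<open>x\<close>
does.\<close>

lemma tensor_bij:
  fixes V :: "('f::field_char_0 rq, 'm) module" (structure)
  assumes V: "abelian_group V"
    and closed: "\<And>c x. x \<in> carrier V \<Longrightarrow> c \<odot> x \<in> carrier V"
    and left: "\<And>c d x. x \<in> carrier V \<Longrightarrow> (c + d) \<odot> x = c \<odot> x \<oplus> d \<odot> x"
    and right: "\<And>c x y. x \<in> carrier V \<Longrightarrow> y \<in> carrier V \<Longrightarrow> c \<odot> (x \<oplus> y) = c \<odot> x \<oplus> c \<odot> y"
    and mult: "\<And>c d x. x \<in> carrier V \<Longrightarrow> (c * d) \<odot> x = c \<odot> (d \<odot> x)"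
    and one: "\<And>x. x \<in> carrier V \<Longrightarrow> 1 \<odot> x = x"
    and L: "submodule_over A0 V L"
    and span: "\<And>x. x \<in> carrier V \<Longrightarrow> \<exists>n. qh ^ n \<odot> x \<in> L"
  shows "bij_betw (natural_map V) (tensor A0 V L) (carrier V)"
proof -
  interpret abelian_group V by (rule V)
  have LV: "x \<in> L \<Longrightarrow> x \<in> carrier V" for x using L by (auto simp: submodule_over_def)
  have L0: "\<zero> \<in> L" and Ladd: "x \<in> L \<Longrightarrow> y \<in> L \<Longrightarrow> x \<oplus> y \<in> L" and Lscl: "a \<in> A0 \<Longrightarrow> x \<in> L \<Longrightarrow> a \<odot> x \<in> L" for x y a
    using L by (auto simp: submodule_over_def)
  define F where "F = {t :: 'f rq \<times> 'm \<Rightarrow>\<^sub>0 int. keys t \<subseteq> UNIV \<times> L}"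
  define rel where "rel = tensor_rels A0 V L"
  define g where "g t p = [lookup t p] \<cdot> (fst p \<odot> snd p)" for t :: "'f rq \<times> 'm \<Rightarrow>\<^sub>0 int" and p
  define ev where "ev t = (\<Oplus>p\<in>keys t. g t p)" for t
  have g_closed: "p \<in> UNIV \<times> L \<Longrightarrow> g t p \<in> carrier V" for t p
    unfolding g_def using LV closed by (auto intro!: add.int_pow_closed)
  have ev_superset: "ev t = (\<Oplus>p\<in>W. g t p)" if "finite W" "keys t \<subseteq> W" "W \<subseteq> UNIV \<times> L" for t W
    unfolding ev_def
  proof (rule add.finprod_mono_neutral_cong_left[OF that(1,2)])
    show "g t p = \<zero>" if "p \<in> W - keys t" for p
      using that by (simp add: g_def in_keys_iff add_pow_def)
  qed (use that g_closed in auto)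
  have F_add: "s + t \<in> F" if "s \<in> F" "t \<in> F" for s t
    using that Poly_Mapping.keys_add[of s t] by (auto simp: F_def)
  have F_diff: "s - t \<in> F" if "s \<in> F" "t \<in> F" for s t
    using that keys_diff[of s t] by (auto simp: F_def)
  have F_of: "x \<in> L \<Longrightarrow> frag_of (c, x) \<in> F" for c x by (simp add: F_def)
  have ev_closed: "t \<in> F \<Longrightarrow> ev t \<in> carrier V" for t
    unfolding ev_def F_def using g_closed by (auto intro!: finsum_closed)
  have ev_add: "ev (s + t) = ev s \<oplus> ev t" if "s \<in> F" "t \<in> F" for s t
  proof -
    let ?W = "keys s \<union> keys t"
    have W: "finite ?W" "?W \<subseteq> UNIV \<times> L" using that by (auto simp: F_def)
    have "ev (s + t) = (\<Oplus>p\<in>?W. g (s + t) p)"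
      by (rule ev_superset[OF W(1) _ W(2)]) (rule Poly_Mapping.keys_add)
    also have "\<dots> = (\<Oplus>p\<in>?W. g s p \<oplus> g t p)"
    proof (rule finsum_cong')
      fix p assume "p \<in> ?W"
      then have "fst p \<odot> snd p \<in> carrier V" using W(2) LV closed by auto
      then show "g (s + t) p = g s p \<oplus> g t p" by (simp add: g_def lookup_add add.int_pow_mult)
    next
      show "(\<lambda>p. g s p \<oplus> g t p) \<in> ?W \<rightarrow> carrier V"
        using W(2) g_closed by (intro funcsetI a_closed) blast+
    qed simp
    also have "\<dots> = (\<Oplus>p\<in>?W. g s p) \<oplus> (\<Oplus>p\<in>?W. g t p)"
      using W(2) g_closed by (intro finsum_addf funcsetI) blast+
    also have "\<dots> = ev s \<oplus> ev t" using W by (simp add: ev_superset[of ?W])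
    finally show ?thesis .
  qed
  have ev_diff: "ev (s - t) = ev s \<ominus> ev t" if st: "s \<in> F" "t \<in> F" for s t
  proof -
    have "ev s = ev (s - t) \<oplus> ev t" using ev_add[OF F_diff[OF st] st(2)] by simp
    then show ?thesis using ev_closed[OF F_diff[OF st]] ev_closed[OF st(2)]
      by (simp add: a_minus_def a_assoc r_neg)
  qed
  have ev_of: "ev (frag_of (c, x)) = c \<odot> x" if "x \<in> L" for c x
    using LV[OF that] closed by (simp add: ev_def g_def add.int_pow_1)
  have minus_zero_iff: "x \<ominus> y = \<zero> \<longleftrightarrow> x = y" if "x \<in> carrier V" "y \<in> carrier V" for x y
  proof
    assume "x \<ominus> y = \<zero>"
    then have "(x \<ominus> y) \<oplus> y = y" using that by simp
    then show "x = y" using that by (simp add: a_minus_def a_assoc l_neg)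
  qed (use that in \<open>simp add: a_minus_def r_neg\<close>)
  have zero_minus: "a \<ominus> b \<ominus> d = \<zero>"
    if "a = b \<oplus> d" "b \<in> carrier V" "d \<in> carrier V" for a b d
  proof -
    have "a \<ominus> b = d" using that by (simp add: a_minus_def a_comm[of b d] a_assoc r_neg)
    then show ?thesis using that by (simp add: a_minus_def r_neg)
  qed
  have rel_ev: "r \<in> F \<and> ev r = \<zero>" if "r \<in> rel" for r
    using that unfolding rel_def
  proof induction
    case zero show ?case by (simp add: F_def ev_def)
  next
    case (diff s t) then show ?case using F_diff ev_diff by (simp add: a_minus_def)
  next
    case (left x c d)
    then show ?case using LV closed
      by (auto simp: F_of F_diff ev_diff ev_of assms(3) intro!: zero_minus)
  next
    case (right x y c)
    then show ?case using LV closed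
      by (auto simp: F_of F_diff ev_diff ev_of Ladd assms(4) intro!: zero_minus)
  next
    case (balanced x a c)
    then show ?case using LV closed
      by (auto simp: F_of F_diff ev_diff ev_of Lscl mult minus_zero_iff)
  qed
  have rel0: "0 \<in> rel" and rel_diff: "s \<in> rel \<Longrightarrow> t \<in> rel \<Longrightarrow> s - t \<in> rel" for s t
    unfolding rel_def by (auto intro: tensor_rels.intros)
  have rel_uminus: "s \<in> rel \<Longrightarrow> - s \<in> rel" for s using rel_diff[OF rel0, of s] by simp
  have rel_add: "s \<in> rel \<Longrightarrow> t \<in> rel \<Longrightarrow> s + t \<in> rel" for s t using rel_diff[OF _ rel_uminus, of s t] by simp
  have rel_trans: "s - t \<in> rel \<Longrightarrow> t - u \<in> rel \<Longrightarrow> s - u \<in> rel" for s t u using rel_add[of "s - t" "t - u"] by simp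
  have q0: "qh \<noteq> (0 :: 'f rq)" by (rule qh_nonzero)
  have balanced: "frag_of (c * a, x) - frag_of (c, a \<odot> x) \<in> rel" if "x \<in> L" "a \<in> A0" for c a x
    unfolding rel_def by (rule tensor_rels.balanced[OF that])
  have right': "frag_of (c, x \<oplus> y) - frag_of (c, x) - frag_of (c, y) \<in> rel" if "x \<in> L" "y \<in> L" for c x y
    unfolding rel_def by (rule tensor_rels.right[OF that])
  (* The relation for 0 + 0 is the negative of the assertion. *)
  have of_zero: "frag_of (c, \<zero>) \<in> rel" for c
    using rel_uminus[OF right'[OF L0 L0, of c]] by simp
  have L_minus: "\<ominus> y \<in> L" if y: "y \<in> L" for y
  proof -
    have "(- 1) \<odot> y \<oplus> y = (- 1 + 1) \<odot> y" using LV[OF y] by (simp only: left one)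
    also have "\<dots> = \<zero>"
      using left[of y 0 0] LV[OF y] closed[of y 0] by (metis add.l_cancel_one' add.right_neutral ab_group_add_class.ab_left_minus)
    finally have "\<ominus> y = (- 1) \<odot> y" using LV[OF y] closed by (simp add: minus_equality)
    then show ?thesis using Lscl[of "- 1" y] y by simp
  qed
  have of_diff: "frag_of (c, x) - frag_of (c, y) - frag_of (c, x \<ominus> y) \<in> rel" if xy: "x \<in> L" "y \<in> L" for c x y
  proof -
    have my: "\<ominus> y \<in> L" by (rule L_minus[OF xy(2)])
    have d: "x \<ominus> y \<in> L" using Ladd[OF xy(1) my] by (simp add: a_minus_def)
    have "(x \<ominus> y) \<oplus> y = x" using LV xy by (simp add: a_minus_def a_assoc l_neg)
    then show ?thesis using right'[OF d xy(2), of c] by (simp add: algebra_simps)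
  qed
  have normal: "\<exists>n x. x \<in> L \<and> t - frag_of (inverse (qh ^ n), x) \<in> rel" if "keys t \<subseteq> UNIV \<times> L" for t
    using that
  proof (induction t rule: frag_induction)
    case zero
    show ?case using rel_uminus[OF of_zero] L0 by (intro exI[of _ 0] exI[of _ "\<zero>"]) simp
  next
    case (one p)
    obtain c x where p: "p = (c, x)" "x \<in> L" using one by auto
    obtain n where n: "qh ^ n * c \<in> A0"
    proof (cases "c = 0")
      case True then show ?thesis using that[of 0] by simp
    next
      case False
      then obtain k u where u: "c = qh powi k * u" "u \<in> A0" by (auto elim: rq_unit_part)
      show ?thesis
      proof (cases "k \<ge> 0")
        case True
        then show ?thesis using that[of 0] u qh_powi_A0[of k, where 'f='f] by simp
      next
        case False
        define j where "j = nat (- k)"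
        have "k = - int j" using False by (simp add: j_def)
        then have "qh ^ j * c = u" using u(1) q0 by (simp add: power_int_minus)
        then show ?thesis using that[of j] u(2) by simp
      qed
    qed
    have e: "inverse (qh ^ n) * (qh ^ n * c) = c" using q0 by simp
    have "frag_of p - frag_of (inverse (qh ^ n), (qh ^ n * c) \<odot> x) \<in> rel"
      using balanced[OF p(2) n, of "inverse (qh ^ n)"] unfolding p(1) e .
    then show ?case using Lscl[OF n p(2)] by blast
  next
    case (diff s t)
    then obtain n x m y where a: "x \<in> L" "s - frag_of (inverse (qh ^ n), x) \<in> rel" "y \<in> L" "t - frag_of (inverse (qh ^ m), y) \<in> rel"
      by blast
    (* Bring both pure tensors to a common denominator. *)
    let ?c = "inverse (qh ^ (n + m)) :: 'f rq"
    have "?c * qh ^ m = inverse (qh ^ n)" "?c * qh ^ n = inverse (qh ^ m)" using q0 by (simp_all add: power_add field_simps)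
    then have b: "frag_of (inverse (qh ^ n), x) - frag_of (?c, qh ^ m \<odot> x) \<in> rel"
      "frag_of (inverse (qh ^ m), y) - frag_of (?c, qh ^ n \<odot> y) \<in> rel"
      using balanced[OF a(1), of "qh ^ m" ?c] balanced[OF a(3), of "qh ^ n" ?c] by simp_all
    have s: "s - frag_of (?c, qh ^ m \<odot> x) \<in> rel" and t: "t - frag_of (?c, qh ^ n \<odot> y) \<in> rel"
      using rel_trans a b by blast+
    have xy: "qh ^ m \<odot> x \<in> L" "qh ^ n \<odot> y \<in> L" using a Lscl by simp_all
    have z: "qh ^ m \<odot> x \<ominus> qh ^ n \<odot> y \<in> L"
      using Ladd[OF xy(1) L_minus[OF xy(2)]] by (simp add: a_minus_def)
    have "(s - t) - (frag_of (?c, qh ^ m \<odot> x) - frag_of (?c, qh ^ n \<odot> y)) \<in> rel"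
      using rel_diff[OF s t] by (simp add: algebra_simps)
    from rel_trans[OF this of_diff[OF xy]] z show ?case by blast
  qed
  have kernel: "t \<in> rel" if t: "t \<in> F" "ev t = \<zero>" for t
  proof -
    obtain n x where x: "x \<in> L" "t - frag_of (inverse (qh ^ n), x) \<in> rel" using normal[of t] t(1) unfolding F_def by blast
    have "inverse (qh ^ n) \<odot> x = \<zero>"
    proof -
      have "ev t \<ominus> ev (frag_of (inverse (qh ^ n), x)) = \<zero>"
        using rel_ev[OF x(2)] ev_diff[OF t(1) F_of[OF x(1)]] by simp
      then show ?thesis using t(2) x(1) LV closed by (simp add: ev_of minus_zero_iff)
    qed
    then have "qh ^ n \<odot> (inverse (qh ^ n) \<odot> x) = qh ^ n \<odot> \<zero>" by simp
    moreover have "qh ^ n \<odot> \<zero> = \<zero>"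
      using right[of "\<zero>" "\<zero>" "qh ^ n"] closed[of "\<zero>" "qh ^ n"] by (simp add: add.l_cancel_one')
    ultimately have "x = \<zero>" using mult[of x "qh ^ n" "inverse (qh ^ n)"] one[of x] LV[OF x(1)] q0 by simp
    then have "frag_of (inverse (qh ^ n), x) \<in> rel" using of_zero by simp
    then show ?thesis using rel_add[OF x(2)] by fastforce
  qed
  define E where "E = {(s, t). s \<in> F \<and> t \<in> F \<and> s - t \<in> rel}"
  have tensor: "tensor A0 V L = F // E"
    by (simp add: tensor_def F_def E_def rel_def Let_def)
  have E: "(s, t) \<in> E \<longleftrightarrow> s \<in> F \<and> t \<in> F \<and> ev s = ev t" for s t
  proof -
    have "s - t \<in> rel \<longleftrightarrow> ev s = ev t" if "s \<in> F" "t \<in> F"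
      using that rel_ev[of "s - t"] kernel[OF F_diff[OF that]] ev_diff[OF that] ev_closed by (auto simp: minus_zero_iff)
    then show ?thesis by (auto simp: E_def)
  qed
  have nat: "natural_map V (E `` {t}) = ev t" if "t \<in> F" for t
  proof -
    have "ev ` (E `` {t}) = {ev t}" using that by (auto simp: E)
    then show ?thesis unfolding natural_map_def using ev_def g_def by (simp add: ev_def[abs_def] g_def[abs_def])
  qed
  show ?thesis
  proof (rule bij_betw_imageI)
    show "inj_on (natural_map V) (tensor A0 V L)"
    proof (rule inj_onI)
      fix X Y assume XY: "X \<in> tensor A0 V L" "Y \<in> tensor A0 V L" "natural_map V X = natural_map V Y"
      obtain s t where "s \<in> F" "t \<in> F" "X = E `` {s}" "Y = E `` {t}" using XY(1,2) by (auto simp: tensor quotient_def)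
      moreover from this XY(3) have "ev s = ev t" by (simp add: nat)
      ultimately show "X = Y" by (auto simp: E)
    qed
    show "natural_map V ` tensor A0 V L = carrier V"
    proof (intro equalityI subsetI)
      fix y assume "y \<in> natural_map V ` tensor A0 V L"
      then show "y \<in> carrier V" using nat ev_closed by (auto simp: tensor quotient_def)
    next
      fix y assume y: "y \<in> carrier V"
      obtain n where n: "qh ^ n \<odot> y \<in> L" using span[OF y] by blast
      let ?t = "frag_of (inverse (qh ^ n), qh ^ n \<odot> y)"
      have "ev ?t = y" using ev_of[OF n] mult[OF y, of "inverse (qh ^ n)" "qh ^ n"] q0 one[OF y] by simp
      then have "natural_map V (E `` {?t}) = y" using nat[OF F_of[OF n]] by simp
      moreover have "E `` {?t} \<in> tensor A0 V L" unfolding tensor by (rule quotientI[OF F_of[OF n]])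
      ultimately show "y \<in> natural_map V ` tensor A0 V L" by (metis imageI)
    qed
  qed
qed

section \<open>Coordinates on a decomposed module\<close>

lemma inj_Pair: "inj (Pair i)" by (rule injI) simp

definition slice :: "('i \<times> int list \<Rightarrow>\<^sub>0 'k::zero) \<Rightarrow> 'i \<Rightarrow> int list \<Rightarrow>\<^sub>0 'k" where
  "slice c i = Poly_Mapping.map_key (Pair i) c"

lemma lookup_slice: "lookup (slice c i) w = lookup c (i, w)"
  by (simp add: slice_def map_key.rep_eq[OF inj_Pair])

lemma slice_zero [simp]: "slice 0 i = 0"
  by (rule poly_mapping_eqI) (simp add: lookup_slice)

lemma slice_add: "slice (c + d) i = slice c i + slice d i"
  by (rule poly_mapping_eqI) (simp add: lookup_slice lookup_add)

lemma slice_scl: "slice (Poly_Mapping.map ((*) s) c) i = Poly_Mapping.map ((*) s) (slice c i)" for s :: "'k::comm_ring_1"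
  by (rule poly_mapping_eqI) (simp add: lookup_slice lookup_map_times)

lemma slice_single: "slice (single (j, w) a) i = (if i = j then single w a else 0)"
  by (rule poly_mapping_eqI) (auto simp: lookup_slice lookup_single when_def)

lemma slice_keys: "keys c \<subseteq> I \<times> Collect dec \<Longrightarrow> keys (slice c i) \<subseteq> Collect dec"
  by (auto simp: in_keys_iff lookup_slice subset_iff)

definition comb :: "('i \<times> int list \<Rightarrow>\<^sub>0 'f::field_char_0 rq) \<Rightarrow> 'i \<Rightarrow> 'f nm" where
  "comb c i = ncomb (slice c i)"

lemma comb_zero: "comb 0 = (\<lambda>i. 0)"
  by (simp add: comb_def fun_eq_iff)

lemma comb_add: "comb (c + d) = (\<lambda>i. comb c i + comb d i)"
  by (simp add: comb_def fun_eq_iff slice_add ncomb_add)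

lemma comb_scl: "comb (Poly_Mapping.map ((*) s) c) = (\<lambda>i. s *\<^sub>N comb c i)"
  by (simp add: comb_def fun_eq_iff slice_scl ncomb_scl)

lemma comb_single: "comb (single t a) = at_summand (fst t) (a *\<^sub>N mon (snd t))"
  by (cases t) (simp add: comb_def fun_eq_iff slice_single at_summand_def ncomb_single)

lemma comb_diff: "comb (c - d) = (\<lambda>i. comb c i - comb d i)"
  using comb_add[of "c - d" d] by (simp add: fun_eq_iff)

lemma comb_fsupp: "keys c \<subseteq> I \<times> Collect dec \<Longrightarrow> comb c \<in> fsupp I"
proof -
  assume c: "keys c \<subseteq> I \<times> Collect dec"
  have ne: "i \<in> fst ` keys c" if "comb c i \<noteq> 0" for i
  proof -
    have "slice c i \<noteq> 0" using that by (auto simp: comb_def)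
    then obtain w where "lookup c (i, w) \<noteq> 0" by (metis lookup_slice lookup_zero poly_mapping_eqI)
    then show ?thesis by (intro image_eqI[of _ _ "(i, w)"]) (auto simp: in_keys_iff)
  qed
  have "{i. comb c i \<noteq> 0} \<subseteq> fst ` keys c" using ne by blast
  then have "finite {i. comb c i \<noteq> 0}" by (rule finite_subset) simp
  moreover have "comb c i = 0" if "i \<notin> I" for i
    by (rule ccontr) (use ne[of i] c that in auto)
  ultimately show ?thesis by (simp add: fsupp_def)
qed

lemma comb_bij: "bij_betw comb {c. keys c \<subseteq> I \<times> Collect dec} (fsupp I :: ('i \<Rightarrow> 'f::field_char_0 nm) set)"
proof (rule bij_betw_imageI)
  show "inj_on comb {c :: 'i \<times> int list \<Rightarrow>\<^sub>0 'f rq. keys c \<subseteq> I \<times> Collect dec}"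
  proof (rule inj_onI)
    fix c d :: "'i \<times> int list \<Rightarrow>\<^sub>0 'f rq"
    assume "c \<in> {c. keys c \<subseteq> I \<times> Collect dec}" "d \<in> {c. keys c \<subseteq> I \<times> Collect dec}" and e: "comb c = comb d"
    then have k: "keys (slice c i) \<subseteq> Collect dec" "keys (slice d i) \<subseteq> Collect dec" for i
      by (simp_all add: slice_keys)
    have "slice c i = slice d i" for i
      using fun_cong[OF e, of i] ncomb_bij[where 'f='f] k[of i] unfolding comb_def bij_betw_def inj_on_def by blast
    then show "c = d" by (intro poly_mapping_eqI) (metis lookup_slice surj_pair)
  qed
  show "comb ` {c :: 'i \<times> int list \<Rightarrow>\<^sub>0 'f rq. keys c \<subseteq> I \<times> Collect dec} = fsupp I"
  proof (intro equalityI subsetI)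
    fix p :: "'i \<Rightarrow> 'f nm" assume p: "p \<in> fsupp I"
    have "\<exists>d. keys d \<subseteq> Collect dec \<and> ncomb d = p i" for i
      using ncomb_bij[where 'f='f] unfolding bij_betw_def by (metis (mono_tags, lifting) UNIV_I imageE mem_Collect_eq)
    then obtain d where d: "\<And>i. keys (d i) \<subseteq> Collect dec" "\<And>i. ncomb (d i) = p i" by metis
    have d0: "d i = 0" if "p i = 0" for i using ncomb_eq_0[OF d(1), of i] d(2)[of i] that by simp
    define c where "c = Abs_poly_mapping (\<lambda>(i, w). lookup (d i) w)"
    have "{t. (case t of (i, w) \<Rightarrow> lookup (d i) w) \<noteq> 0} \<subseteq> Sigma {i. p i \<noteq> 0} (\<lambda>i. keys (d i))"
      using d0 by (auto simp: in_keys_iff)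
    moreover have "finite (Sigma {i. p i \<noteq> 0} (\<lambda>i. keys (d i)))" using p by (auto simp: fsupp_def)
    ultimately have "finite {t. (case t of (i, w) \<Rightarrow> lookup (d i) w) \<noteq> 0}" by (rule finite_subset)
    then have c: "lookup c (i, w) = lookup (d i) w" for i w
      unfolding c_def by simp
    have "slice c i = d i" for i by (rule poly_mapping_eqI) (simp add: lookup_slice c)
    then have "comb c = p" by (simp add: comb_def d(2) fun_eq_iff)
    moreover have "keys c \<subseteq> I \<times> Collect dec"
    proof
      fix t assume "t \<in> keys c"
      then have t: "lookup (d (fst t)) (snd t) \<noteq> 0" using c[of "fst t" "snd t"] by (simp add: in_keys_iff)
      then have "p (fst t) \<noteq> 0" using d0[of "fst t"] by auto
      then show "t \<in> I \<times> Collect dec" using t d(1)[of "fst t"] p by (cases t) (auto simp: fsupp_def in_keys_iff subset_iff)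
    qed
    ultimately show "p \<in> comb ` {c. keys c \<subseteq> I \<times> Collect dec}" by blast
  qed (auto simp: comb_fsupp)
qed

lemma comb_nlat:
  assumes "keys c \<subseteq> I \<times> Collect dec"
  shows "(\<forall>i. comb c i \<in> nlat) \<longleftrightarrow> c \<in> coeffs_in A0 (I \<times> Collect dec)"
proof
  assume "\<forall>i. comb c i \<in> nlat"
  then have "lookup (slice c i) w \<in> A0" for i w
    using ncomb_nlat_coeff[OF slice_keys[OF assms]] by (simp add: comb_def)
  then show "c \<in> coeffs_in A0 (I \<times> Collect dec)" using assms by (auto simp: coeffs_in_iff lookup_slice)
next
  assume c: "c \<in> coeffs_in A0 (I \<times> Collect dec)"
  have "slice c i \<in> coeffs_in A0 (Collect dec)" for i
    using c slice_keys[OF assms] by (simp add: coeffs_in_iff lookup_slice)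
  then show "\<forall>i. comb c i \<in> nlat" by (auto simp: comb_def nlat_eq)
qed

lemma comb_image_nlat: "comb ` coeffs_in A0 (I \<times> Collect dec) = {p \<in> fsupp I. \<forall>i. p i \<in> nlat}"
proof (intro equalityI subsetI)
  fix p assume "p \<in> comb ` coeffs_in A0 (I \<times> Collect dec)"
  then obtain c where c: "p = comb c" "c \<in> coeffs_in A0 (I \<times> Collect dec)" by blast
  then have k: "keys c \<subseteq> I \<times> Collect dec" by (simp add: coeffs_in_iff)
  show "p \<in> {p \<in> fsupp I. \<forall>i. p i \<in> nlat}" using comb_nlat[OF k] comb_fsupp[OF k] c by simp
next
  fix p :: "'a \<Rightarrow> 'b nm" assume p: "p \<in> {p \<in> fsupp I. \<forall>i. p i \<in> nlat}"
  then obtain c where c: "keys c \<subseteq> I \<times> Collect dec" "p = comb c"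
  proof -
    have "p \<in> comb ` {c. keys c \<subseteq> I \<times> Collect dec}"
      using comb_bij[of I, where 'f='b] p by (simp add: bij_betw_def)
    then show ?thesis using that by blast
  qed
  then show "p \<in> comb ` coeffs_in A0 (I \<times> Collect dec)" using p comb_nlat[OF c(1)] by blast
qed

lemma lookup_map_const: "lookup (Poly_Mapping.map rq_const d) t = rq_const (lookup d t)"
  by (simp add: map.rep_eq when_def rq_const_hom)

text \<open>The difference of the coefficient functions is divisible by \<open>q\<^sup>1\<^sup>/\<^sup>2\<close> in the lattice if and only if
each coefficient is, that is, if all residues vanish.\<close>

lemma comb_qcong_const:
  fixes c :: "'i \<times> int list \<Rightarrow>\<^sub>0 'f::field_char_0 rq"
  assumes c: "c \<in> coeffs_in A0 (I \<times> Collect dec)" and d: "keys d \<subseteq> I \<times> Collect dec"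
  shows "(\<forall>i. comb c i \<approx> comb (Poly_Mapping.map rq_const d) i)
    \<longleftrightarrow> (\<forall>t. A0_res (lookup c t) = lookup d t)"
proof -
  define e where "e = c - Poly_Mapping.map rq_const d"
  have e_keys: "keys e \<subseteq> I \<times> Collect dec"
  proof (rule subsetI, rule ccontr)
    fix t assume t: "t \<in> keys e" "t \<notin> I \<times> Collect dec"
    then have "t \<notin> keys c" "t \<notin> keys d" using c d by (auto simp: coeffs_in_iff)
    then show False using t(1) by (simp add: e_def in_keys_iff lookup_minus lookup_map_const rq_const_hom)
  qed
  let ?e = "Poly_Mapping.map ((*) (inverse qh)) e"
  have e_keys': "keys ?e \<subseteq> I \<times> Collect dec"
    using e_keys by (auto simp: in_keys_iff lookup_map_times subset_iff)
  have q0: "qh \<noteq> (0 :: 'f rq)" by (rule qh_nonzero)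
  have "(\<forall>i. comb c i \<approx> comb (Poly_Mapping.map rq_const d) i) \<longleftrightarrow> (\<forall>i. comb ?e i \<in> nlat)"
  proof -
    have "comb c i \<approx> comb (Poly_Mapping.map rq_const d) i \<longleftrightarrow> comb ?e i \<in> nlat" for i
    proof
      assume "comb c i \<approx> comb (Poly_Mapping.map rq_const d) i"
      then obtain y where "y \<in> nlat" "comb e i = qh *\<^sub>N y" by (auto simp: qcong_def e_def comb_diff)
      then show "comb ?e i \<in> nlat" using q0 by (simp add: comb_scl)
    next
      assume "comb ?e i \<in> nlat"
      moreover have "comb c i - comb (Poly_Mapping.map rq_const d) i = qh *\<^sub>N comb ?e i"
        using q0 by (simp add: comb_scl) (simp add: e_def comb_diff)
      ultimately show "comb c i \<approx> comb (Poly_Mapping.map rq_const d) i" unfolding qcong_def by blast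
    qed
    then show ?thesis by blast
  qed
  also have "\<dots> \<longleftrightarrow> (\<forall>t. inverse qh * lookup e t \<in> A0)"
    unfolding comb_nlat[OF e_keys'] using e_keys' by (simp add: coeffs_in_iff lookup_map_times)
  also have "\<dots> \<longleftrightarrow> (\<forall>t. A0_res (lookup c t) = lookup d t)"
  proof -
    have "inverse qh * lookup e t \<in> A0 \<longleftrightarrow> A0_res (lookup c t) = lookup d t" for t
    proof -
      have ct: "lookup c t \<in> A0" using c by (simp add: coeffs_in_iff del: split_paired_All)
      have et: "lookup e t = lookup c t - rq_const (lookup d t)"
        by (simp add: e_def lookup_minus lookup_map_const)
      have eA: "lookup e t \<in> A0" "A0_res (lookup e t) = A0_res (lookup c t) - lookup d t"
        unfolding et using ct by simp_all
      have "inverse qh * lookup e t \<in> A0 \<longleftrightarrow> A0_res (lookup e t) = 0"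
      proof
        assume a: "inverse qh * lookup e t \<in> A0"
        have "lookup e t = qh * (inverse qh * lookup e t)" using q0 by simp
        then show "A0_res (lookup e t) = 0" using a by (metis A0_arith(4) A0_qh mult_zero_left)
      next
        assume "A0_res (lookup e t) = 0"
        then obtain y where "y \<in> A0" "lookup e t = qh * y" using eA(1) by (auto elim: A0_res_eq_0)
        then show "inverse qh * lookup e t \<in> A0" using q0 by (simp flip: mult.assoc)
      qed
      then show ?thesis unfolding eA(2) by simp
    qed
    then show ?thesis by blast
  qed
  finally show ?thesis .
qed

context decomposed
begin

definition \<Phi> :: "('i \<times> int list \<Rightarrow>\<^sub>0 'f rq) \<Rightarrow> 'm" where "\<Phi> c = \<Psi> (comb c)"

lemma C_fsupp: "c \<in> coeffs_in R labels \<Longrightarrow> comb c \<in> fsupp I"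
  by (simp add: coeffs_in_iff comb_fsupp)

lemma \<Phi>_bij: "bij_betw \<Phi> (coeffs_in UNIV labels) (carrier M)"
  using bij_betw_trans[OF comb_bij \<Psi>_bij] by (simp add: \<Phi>_def[abs_def] comp_def coeffs_in_def)

lemma lat_\<Phi>: "lat = \<Phi> ` coeffs_in A0 labels"
  unfolding lat_def comb_image_nlat[symmetric] by (simp add: \<Phi>_def image_image)

sublocale V: coord "vs M" UNIV labels \<Phi>
  by standard (auto simp: \<Phi>_bij \<Phi>_def comb_add \<Psi>_add C_fsupp comb_scl \<Psi>_const comb_zero \<Psi>_zero)

lemma A0_C: "c \<in> coeffs_in A0 labels \<Longrightarrow> c \<in> coeffs_in UNIV labels"
  by (simp add: coeffs_in_iff)

sublocale LV: coord "(vs M)\<lparr>carrier := lat\<rparr>" A0 labels \<Phi>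
proof
  show "bij_betw \<Phi> (coeffs_in A0 labels) (carrier ((vs M)\<lparr>carrier := lat\<rparr>))"
    using \<Phi>_bij by (auto simp: lat_\<Phi> bij_betw_def intro: inj_on_subset dest: A0_C)
qed (auto simp: V.\<Phi>_add[simplified] A0_C V.\<Phi>_scl[simplified] V.\<Phi>_zero[simplified] A0_subring)

definition \<Xi> :: "('i \<times> int list \<Rightarrow>\<^sub>0 'f) \<Rightarrow> 'm set" where
  "\<Xi> d = res_cls (comb (Poly_Mapping.map rq_const d))"

lemma map_const_C: "d \<in> coeffs_in UNIV labels \<Longrightarrow> Poly_Mapping.map rq_const d \<in> coeffs_in A0 labels"
proof -
  assume d: "d \<in> coeffs_in UNIV labels"
  have "keys (Poly_Mapping.map rq_const d) \<subseteq> keys d"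
  proof
    fix t assume "t \<in> keys (Poly_Mapping.map rq_const d)"
    then have "lookup d t \<noteq> 0"
      using rq_const_hom(3) by (auto simp: in_keys_iff lookup_map_const)
    then show "t \<in> keys d" by (simp add: in_keys_iff)
  qed
  then show ?thesis using d by (simp add: coeffs_in_iff lookup_map_const)
qed

lemma res_cls_comb_eq_\<Xi>:
  assumes "c \<in> coeffs_in A0 labels" "d \<in> coeffs_in UNIV labels"
  shows "res_cls (comb c) = \<Xi> d \<longleftrightarrow> (\<forall>t. A0_res (lookup c t) = lookup d t)"
proof -
  have "keys d \<subseteq> labels" using assms by (simp add: coeffs_in_iff)
  from comb_qcong_const[OF assms(1) this] show ?thesis by (simp add: \<Xi>_def res_cls_eq_iff C_fsupp[OF assms(1)])
qed

lemma map_const_hom: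
  "Poly_Mapping.map rq_const (c + d) = Poly_Mapping.map rq_const c + Poly_Mapping.map rq_const d"
  "Poly_Mapping.map rq_const (Poly_Mapping.map ((*) s) c) = Poly_Mapping.map ((*) (rq_const s)) (Poly_Mapping.map rq_const c)"
  by (rule poly_mapping_eqI; simp add: lookup_map_const lookup_add lookup_map_times rq_const_hom)+

sublocale QV: coord Q UNIV labels \<Xi>
proof
  show "bij_betw \<Xi> (coeffs_in UNIV labels) (carrier Q)"
  proof (rule bij_betw_imageI)
    show "inj_on \<Xi> (coeffs_in UNIV labels)"
    proof (rule inj_onI)
      fix c d assume cd: "c \<in> coeffs_in UNIV labels" "d \<in> coeffs_in UNIV labels" "\<Xi> c = \<Xi> d"
      then have "\<forall>t. A0_res (lookup (Poly_Mapping.map rq_const c) t) = lookup d t"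
        using res_cls_comb_eq_\<Xi>[OF map_const_C[OF cd(1)] cd(2)] by (simp add: \<Xi>_def)
      then show "c = d" by (intro poly_mapping_eqI) (simp add: lookup_map_const del: split_paired_All)
    qed
    show "\<Xi> ` coeffs_in UNIV labels = carrier Q"
    proof (intro equalityI subsetI)
      fix X assume "X \<in> \<Xi> ` coeffs_in UNIV labels"
      then obtain d where d: "d \<in> coeffs_in UNIV labels" "X = \<Xi> d" by blast
      have "comb (Poly_Mapping.map rq_const d) \<in> {p \<in> fsupp I. \<forall>i. p i \<in> nlat}"
        unfolding comb_image_nlat[symmetric] using map_const_C[OF d(1)] by blast
      then show "X \<in> carrier Q" unfolding Q_simps d(2) \<Xi>_def by blast
    next
      fix X assume "X \<in> carrier Q"
      then obtain c where c: "c \<in> coeffs_in A0 labels" "X = res_cls (comb c)"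
        unfolding Q_simps comb_image_nlat[symmetric] by blast
      let ?d = "Poly_Mapping.map A0_res c"
      have l: "lookup ?d t = A0_res (lookup c t)" for t by (simp add: map.rep_eq when_def)
      have "keys ?d \<subseteq> keys c"
      proof
        fix t assume "t \<in> keys ?d"
        then have "lookup c t \<noteq> 0" using A0_0(2) by (auto simp: in_keys_iff l)
        then show "t \<in> keys c" by (simp add: in_keys_iff)
      qed
      then have d: "?d \<in> coeffs_in UNIV labels" using c(1) unfolding coeffs_in_iff by blast
      then have "X = \<Xi> ?d" using res_cls_comb_eq_\<Xi>[OF c(1) d] c(2) l by simp
      then show "X \<in> \<Xi> ` coeffs_in UNIV labels" using d by blast
    qed
  qed
next
  fix c d :: "'i \<times> int list \<Rightarrow>\<^sub>0 'f" assume "c \<in> coeffs_in UNIV labels" "d \<in> coeffs_in UNIV labels"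
  then show "\<Xi> (c + d) = \<Xi> c \<oplus>\<^bsub>Q\<^esub> \<Xi> d"
    using Q_simps(3)[OF C_fsupp[OF map_const_C] C_fsupp[OF map_const_C]] by (simp add: \<Xi>_def map_const_hom comb_add)
next
  fix s and c :: "'i \<times> int list \<Rightarrow>\<^sub>0 'f" assume "c \<in> coeffs_in UNIV labels"
  then show "\<Xi> (Poly_Mapping.map ((*) s) c) = s \<odot>\<^bsub>Q\<^esub> \<Xi> c"
    using Q_simps(4)[OF C_fsupp[OF map_const_C]] by (simp add: \<Xi>_def map_const_hom comb_scl)
next
  have "Poly_Mapping.map rq_const 0 = (0 :: 'i \<times> int list \<Rightarrow>\<^sub>0 'f rq)" by (rule poly_mapping_eqI) (simp add: lookup_map_const rq_const_hom)
  then show "\<Xi> 0 = \<zero>\<^bsub>Q\<^esub>" by (simp add: \<Xi>_def comb_zero Q_simps)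
qed simp_all

lemma \<beta>_basis_vec: "QV.basis_vec t = \<beta> t"
proof -
  have "Poly_Mapping.map rq_const (single t 1) = (single t 1 :: 'i \<times> int list \<Rightarrow>\<^sub>0 'f rq)"
    by (rule poly_mapping_eqI) (simp add: lookup_map_const lookup_single when_def rq_const_hom)
  then show ?thesis by (simp add: QV.basis_vec_def \<Xi>_def comb_single \<beta>_def)
qed

subsection \<open>Weights\<close>

text \<open>The weight of the basis vector with a given label; the coefficient of \<open>\<Lambda>\<^sub>0\<close> makes it a weight of level 0.\<close>

definition weight_of :: "'i \<times> int list \<Rightarrow> weight" where
  "weight_of t = (let h = at_h (lam (fst t)) - 2 * int (length (snd t)); d = at_d (lam (fst t)) + sum_list (snd t)
     in Weight (- h) h d)"

lemma weight_of_P0: "weight_of t \<in> P0"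
  by (simp add: weight_of_def P0_def Let_def)

lemma weight_of_at: "at_h (weight_of t) = at_h (lam (fst t)) - 2 * int (length (snd t))"
  "at_d (weight_of t) = at_d (lam (fst t)) + sum_list (snd t)"
  by (simp_all add: weight_of_def Let_def)

lemma P0_eqI: "\<mu> \<in> P0 \<Longrightarrow> \<nu> \<in> P0 \<Longrightarrow> at_h \<mu> = at_h \<nu> \<Longrightarrow> at_d \<mu> = at_d \<nu> \<Longrightarrow> \<mu> = \<nu>"
  by (cases \<mu>; cases \<nu>) (simp add: P0_def)

lemma diag_\<Phi>:
  assumes T: "\<And>i. lin (T i)" and eig: "\<And>i ns. T i (mon ns) = e (i, ns) *\<^sub>N mon ns" and c: "c \<in> coeffs_in UNIV labels"
  shows "\<Psi> (\<lambda>i. T i (comb c i)) = \<Phi> (Poly_Mapping.mapp (\<lambda>t x. e t * x) c)"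
    and "Poly_Mapping.mapp (\<lambda>t x. e t * x) c \<in> coeffs_in UNIV labels"
proof -
  let ?m = "Poly_Mapping.mapp (\<lambda>t x. e t * x) c"
  have l: "lookup ?m t = e t * lookup c t" for t
    by (simp add: lookup_mapp when_def in_keys_iff)
  have "T i (comb c i) = comb ?m i" for i
  proof -
    have "comb ?m i = (\<Sum>w\<in>keys (slice c i). lookup (slice ?m i) w *\<^sub>N mon w)"
      unfolding comb_def by (rule ncomb_superset) (auto simp: in_keys_iff lookup_slice l)
    also have "\<dots> = (\<Sum>w\<in>keys (slice c i). lookup (slice c i) w *\<^sub>N T i (mon w))"
      by (intro sum.cong refl) (simp only: lookup_slice l eig N.scale_scale, simp only: mult.commute)
    finally show ?thesis by (simp add: comb_def ncomb_def lin_rules[OF T])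
  qed
  then show "\<Psi> (\<lambda>i. T i (comb c i)) = \<Phi> ?m" by (simp add: \<Phi>_def)
  show "?m \<in> coeffs_in UNIV labels" using c keys_mapp_subset[of _ c] by (auto simp: coeffs_in_iff)
qed

lemma grading_mon: "w \<noteq> 0 \<Longrightarrow> grading z w (mon ns) = (z ^ length ns * w powi sum_list ns) *\<^sub>N mon ns"
  by (induction ns) (simp_all add: grading_gen lin_rules[OF grading_lin] power_int_add mult_ac)

lemma Uop_mon:
  "Uop (lam i) Kp (mon ns) = (qq powi at_h (weight_of (i, ns))) *\<^sub>N (mon ns :: 'f nm)"
  "Uop (lam i) Dp (mon ns) = (qq powi at_d (weight_of (i, ns))) *\<^sub>N (mon ns :: 'f nm)"
proof -
  have q0: "qq \<noteq> (0 :: 'f rq)" by (rule qq_nonzero)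
  have "(qq powi (- 2)) ^ n = (qq powi (- 2 * int n) :: 'f rq)" for n by (simp only: power_int_mult power_int_of_nat)
  then show "Uop (lam i) Kp (mon ns) = (qq powi at_h (weight_of (i, ns))) *\<^sub>N (mon ns :: 'f nm)"
    using q0 by (simp add: Kop_def grading_mon weight_of_at power_int_add[symmetric] del: power_int_minus_left)
  show "Uop (lam i) Dp (mon ns) = (qq powi at_d (weight_of (i, ns))) *\<^sub>N (mon ns :: 'f nm)"
    using q0 by (simp add: grading_mon weight_of_at power_int_add)
qed

lemma eigen_\<Phi>:
  assumes c: "c \<in> coeffs_in UNIV labels"
    and eig: "\<And>i ns. Uop (lam i) g (mon ns) = (qq powi e (i, ns)) *\<^sub>N (mon ns :: 'f nm)"
  shows "uq_gen g \<odot>\<^bsub>M\<^esub> \<Phi> c = uq_const (qq powi k) \<odot>\<^bsub>M\<^esub> \<Phi> c \<longleftrightarrow> (\<forall>t\<in>keys c. e t = k)"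
proof -
  let ?m = "Poly_Mapping.mapp (\<lambda>t x. qq powi e t * x) c" and ?n = "Poly_Mapping.map ((*) (qq powi k)) c"
  have m: "uq_gen g \<odot>\<^bsub>M\<^esub> \<Phi> c = \<Phi> ?m" "?m \<in> coeffs_in UNIV labels"
    using diag_\<Phi>[OF Uop_lin eig c] by (simp_all add: \<Phi>_def \<Psi>_smult[OF C_fsupp[OF c]] uact_gen)
  have n: "uq_const (qq powi k) \<odot>\<^bsub>M\<^esub> \<Phi> c = \<Phi> ?n" using V.\<Phi>_scl[OF _ c, of "qq powi k"] by simp
  have n': "?n \<in> coeffs_in UNIV labels" using c by (auto simp: coeffs_in_iff in_keys_iff lookup_map_times subset_iff)
  have "\<Phi> ?m = \<Phi> ?n \<longleftrightarrow> ?m = ?n" using \<Phi>_bij m(2) n' by (auto simp: bij_betw_def dest: inj_onD)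
  also have "\<dots> \<longleftrightarrow> (\<forall>t. lookup ?m t = lookup ?n t)" by (metis poly_mapping_eqI)
  also have "\<dots> \<longleftrightarrow> (\<forall>t\<in>keys c. e t = k)"
  proof -
    have "lookup ?m t = lookup ?n t \<longleftrightarrow> (t \<in> keys c \<longrightarrow> e t = k)" for t
      by (auto simp: lookup_mapp lookup_map_times when_def in_keys_iff qq_powi_inj)
    then show ?thesis by blast
  qed
  finally show ?thesis unfolding m(1) n .
qed

text \<open>The powers of \<open>q\<close> are distinct, so \<open>K\<close> and \<open>D\<close> separate the weights of level 0.\<close>

lemma weight_space_\<Phi>:
  assumes c: "c \<in> coeffs_in UNIV labels" and \<mu>: "\<mu> \<in> P0"
  shows "\<Phi> c \<in> weight_space M \<mu> \<longleftrightarrow> (\<forall>t\<in>keys c. weight_of t = \<mu>)"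
proof -
  have "\<Phi> c \<in> weight_space M \<mu> \<longleftrightarrow> (\<forall>t\<in>keys c. at_h (weight_of t) = at_h \<mu>) \<and> (\<forall>t\<in>keys c. at_d (weight_of t) = at_d \<mu>)"
    using eigen_\<Phi>[OF c Uop_mon(1)] eigen_\<Phi>[OF c Uop_mon(2)] V.\<Phi>_closed[OF c] by (simp add: weight_space_def)
  also have "\<dots> \<longleftrightarrow> (\<forall>t\<in>keys c. weight_of t = \<mu>)" by (auto intro: P0_eqI[OF weight_of_P0 \<mu>])
  finally show ?thesis .
qed

definition weight_part :: "weight \<Rightarrow> ('i \<times> int list \<Rightarrow>\<^sub>0 'f rq) \<Rightarrow> 'i \<times> int list \<Rightarrow>\<^sub>0 'f rq" where
  "weight_part \<mu> c = Poly_Mapping.mapp (\<lambda>t x. if weight_of t = \<mu> then x else 0) c"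

lemma lookup_weight_part: "lookup (weight_part \<mu> c) t = (if weight_of t = \<mu> then lookup c t else 0)"
  by (simp add: weight_part_def lookup_mapp when_def in_keys_iff)

lemma weight_part_C: "c \<in> coeffs_in A0 labels \<Longrightarrow> weight_part \<mu> c \<in> coeffs_in A0 labels"
  using keys_mapp_subset[of "\<lambda>t x. if weight_of t = \<mu> then x else 0" c]
  by (auto simp: coeffs_in_iff lookup_weight_part simp flip: weight_part_def)

lemma lat_weight:
  assumes "\<mu> \<in> P0"
  shows "lat \<inter> weight_space M \<mu> = \<Phi> ` {c \<in> coeffs_in A0 labels. weight_part \<mu> c = c}"
proof -
  have "(\<forall>t\<in>keys c. weight_of t = \<mu>) \<longleftrightarrow> weight_part \<mu> c = c" for c
  proof
    assume "\<forall>t\<in>keys c. weight_of t = \<mu>"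
    then show "weight_part \<mu> c = c" by (intro poly_mapping_eqI) (auto simp: lookup_weight_part in_keys_iff)
  next
    assume r: "weight_part \<mu> c = c"
    have "lookup c t = (if weight_of t = \<mu> then lookup c t else 0)" for t
      using lookup_weight_part[of \<mu> c t] unfolding r .
    then show "\<forall>t\<in>keys c. weight_of t = \<mu>" by (metis in_keys_iff)
  qed
  then show ?thesis unfolding lat_\<Phi> using weight_space_\<Phi>[OF A0_C assms] by auto
qed

lemma \<Phi>_inv: "c \<in> coeffs_in A0 labels \<Longrightarrow> inv_into (coeffs_in A0 labels) \<Phi> (\<Phi> c) = c"
  using LV.bij by (auto simp: bij_betw_def intro: inv_into_f_f)

text \<open>The component of weight \<open>\<mu>\<close> of a vector is given by its coordinates with labels of weight \<open>\<mu>\<close>, so both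
composites are identities once a family of components is written in the form \<open>weight_part \<mu> c\<close> for
one coefficient function \<open>c\<close> (\<open>A_form\<close> in the proof).\<close>

lemma lat_internal_dsum: "is_internal_dsum (vs M) P0 (\<lambda>\<mu>. lat \<inter> weight_space M \<mu>) lat"
proof -
  let ?C = "coeffs_in A0 labels"
  let ?A = "carrier (dsum P0 (\<lambda>\<mu>. (vs M)\<lparr>carrier := lat \<inter> weight_space M \<mu>\<rparr>))"
  let ?g = "\<lambda>f. \<Oplus>\<^bsub>vs M\<^esub>\<mu>\<in>{\<mu>\<in>P0. f \<mu> \<noteq> \<zero>\<^bsub>vs M\<^esub>}. f \<mu>"
  let ?h = "\<lambda>x. \<lambda>\<mu>\<in>P0. \<Phi> (weight_part \<mu> (inv_into ?C \<Phi> x))"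
  have A: "f \<in> ?A \<longleftrightarrow> f \<in> (\<Pi>\<^sub>E \<mu>\<in>P0. lat \<inter> weight_space M \<mu>) \<and> finite {\<mu>\<in>P0. f \<mu> \<noteq> \<zero>\<^bsub>vs M\<^esub>}" for f
    by (simp add: dsum_def)
  have \<Phi>0: "\<Phi> c = \<zero>\<^bsub>vs M\<^esub> \<longleftrightarrow> c = 0" if "c \<in> ?C" for c
    using that LV.bij LV.C_zero LV.\<Phi>_zero by (auto simp: bij_betw_def dest: inj_onD[of _ _ c 0])
  have h: "?h (\<Phi> c) = (\<lambda>\<mu>\<in>P0. \<Phi> (weight_part \<mu> c))" if "c \<in> ?C" for c
    using that by (simp add: \<Phi>_inv)
  have supp: "finite {\<mu>\<in>P0. weight_part \<mu> c \<noteq> 0}" for c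
  proof -
    have "{\<mu>\<in>P0. weight_part \<mu> c \<noteq> 0} \<subseteq> weight_of ` keys c"
    proof clarsimp
      fix \<mu> assume "weight_part \<mu> c \<noteq> 0"
      then obtain t where "lookup (weight_part \<mu> c) t \<noteq> 0" by (metis lookup_zero poly_mapping_eqI)
      then show "\<mu> \<in> weight_of ` keys c"
        by (intro image_eqI[of _ _ t]) (auto simp: lookup_weight_part in_keys_iff split: if_splits)
    qed
    then show ?thesis by (rule finite_subset) simp
  qed
  have sum_weight_part: "(\<Sum>\<mu>\<in>{\<mu>\<in>P0. weight_part \<mu> c \<noteq> 0}. weight_part \<mu> c) = c" for c
  proof (rule poly_mapping_eqI)
    fix t
    have "lookup (\<Sum>\<mu>\<in>{\<mu>\<in>P0. weight_part \<mu> c \<noteq> 0}. weight_part \<mu> c) t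
      = (\<Sum>\<mu>\<in>{\<mu>\<in>P0. weight_part \<mu> c \<noteq> 0}. if \<mu> = weight_of t then lookup c t else 0)"
      unfolding Poly_Mapping.lookup_sum by (intro sum.cong) (auto simp: lookup_weight_part)
    also have "\<dots> = lookup c t"
    proof (cases "weight_part (weight_of t) c = 0")
      case True
      then have "lookup c t = 0" using lookup_weight_part[of "weight_of t" c t] by simp
      then show ?thesis by (simp add: if_distrib cong: if_cong)
    qed (use supp weight_of_P0 in simp)
    finally show "lookup (\<Sum>\<mu>\<in>{\<mu>\<in>P0. weight_part \<mu> c \<noteq> 0}. weight_part \<mu> c) t = lookup c t" .
  qed
  have gh: "?g (\<lambda>\<mu>\<in>P0. \<Phi> (weight_part \<mu> c)) = \<Phi> c" if c: "c \<in> ?C" for c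
  proof -
    have "{\<mu>\<in>P0. (\<lambda>\<mu>\<in>P0. \<Phi> (weight_part \<mu> c)) \<mu> \<noteq> \<zero>\<^bsub>vs M\<^esub>} = {\<mu>\<in>P0. weight_part \<mu> c \<noteq> 0}"
      using \<Phi>0[OF weight_part_C[OF c]] by auto
    then have "?g (\<lambda>\<mu>\<in>P0. \<Phi> (weight_part \<mu> c)) = (\<Oplus>\<^bsub>vs M\<^esub>\<mu>\<in>{\<mu>\<in>P0. weight_part \<mu> c \<noteq> 0}. (\<lambda>\<mu>\<in>P0. \<Phi> (weight_part \<mu> c)) \<mu>)"
      by (simp only:)
    also have "\<dots> = (\<Oplus>\<^bsub>vs M\<^esub>\<mu>\<in>{\<mu>\<in>P0. weight_part \<mu> c \<noteq> 0}. \<Phi> (weight_part \<mu> c))"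
    proof (rule V.finsum_cong')
      show "(\<lambda>\<mu>. \<Phi> (weight_part \<mu> c)) \<in> {\<mu>\<in>P0. weight_part \<mu> c \<noteq> 0} \<rightarrow> carrier (vs M)"
        using weight_part_C[OF c] V.\<Phi>_closed A0_C by blast
    qed auto
    also have "\<dots> = \<Phi> (\<Sum>\<mu>\<in>{\<mu>\<in>P0. weight_part \<mu> c \<noteq> 0}. weight_part \<mu> c)"
      by (rule V.\<Phi>_sum[OF supp]) (use weight_part_C[OF c] A0_C in blast)
    finally show ?thesis unfolding sum_weight_part .
  qed
  have hA: "(\<lambda>\<mu>\<in>P0. \<Phi> (weight_part \<mu> c)) \<in> ?A" if c: "c \<in> ?C" for c
  proof -
    have "weight_part \<mu> (weight_part \<mu> c) = weight_part \<mu> c" for \<mu> by (rule poly_mapping_eqI) (simp add: lookup_weight_part)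
    then have "(\<lambda>\<mu>\<in>P0. \<Phi> (weight_part \<mu> c)) \<in> (\<Pi>\<^sub>E \<mu>\<in>P0. lat \<inter> weight_space M \<mu>)"
      using weight_part_C[OF c] by (intro restrict_PiE_iff[THEN iffD2] ballI) (auto simp: lat_weight)
    moreover have "{\<mu>\<in>P0. (\<lambda>\<mu>\<in>P0. \<Phi> (weight_part \<mu> c)) \<mu> \<noteq> \<zero>\<^bsub>vs M\<^esub>} = {\<mu>\<in>P0. weight_part \<mu> c \<noteq> 0}"
      using \<Phi>0[OF weight_part_C[OF c]] by auto
    ultimately show ?thesis unfolding A using supp by (simp only: simp_thms)
  qed
  have A_form: "\<exists>c\<in>?C. f = (\<lambda>\<mu>\<in>P0. \<Phi> (weight_part \<mu> c))" if f: "f \<in> ?A" for f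
  proof -
    have "\<forall>\<mu>\<in>P0. \<exists>c. c \<in> ?C \<and> weight_part \<mu> c = c \<and> f \<mu> = \<Phi> c"
      using f lat_weight unfolding A by (fastforce simp: PiE_iff)
    then obtain c where c: "\<And>\<mu>. \<mu> \<in> P0 \<Longrightarrow> c \<mu> \<in> ?C" "\<And>\<mu>. \<mu> \<in> P0 \<Longrightarrow> weight_part \<mu> (c \<mu>) = c \<mu>" "\<And>\<mu>. \<mu> \<in> P0 \<Longrightarrow> f \<mu> = \<Phi> (c \<mu>)"
      by metis
    let ?S = "{\<mu>\<in>P0. f \<mu> \<noteq> \<zero>\<^bsub>vs M\<^esub>}"
    have fin: "finite ?S" using f by (simp only: A)
    let ?d = "\<Sum>\<mu>\<in>?S. c \<mu>"
    have d: "?d \<in> ?C" using c(1) by (intro LV.C_sum) auto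
    have "weight_part \<nu> ?d = c \<nu>" if \<nu>: "\<nu> \<in> P0" for \<nu>
    proof (rule poly_mapping_eqI)
      fix t
      have l: "lookup (c \<mu>) t = (if weight_of t = \<mu> then lookup (c \<mu>) t else 0)" if "\<mu> \<in> P0" for \<mu>
        using lookup_weight_part[of \<mu> "c \<mu>" t] unfolding c(2)[OF that] .
      show "lookup (weight_part \<nu> ?d) t = lookup (c \<nu>) t"
      proof (cases "weight_of t = \<nu>")
        case True
        have "lookup ?d t = (\<Sum>\<mu>\<in>?S. if \<mu> = \<nu> then lookup (c \<nu>) t else 0)"
          unfolding Poly_Mapping.lookup_sum
        proof (rule sum.cong[OF refl])
          fix \<mu> assume "\<mu> \<in> ?S"
          then show "lookup (c \<mu>) t = (if \<mu> = \<nu> then lookup (c \<nu>) t else 0)"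
            using l[of \<mu>] True by auto
        qed
        also have "\<dots> = lookup (c \<nu>) t"
          using fin \<nu> c(1,3)[OF \<nu>] \<Phi>0[of "c \<nu>"] by auto
        finally show ?thesis using True by (simp add: lookup_weight_part)
      next
        case False then show ?thesis using l[OF \<nu>] by (simp add: lookup_weight_part)
      qed
    qed
    then have "f = (\<lambda>\<mu>\<in>P0. \<Phi> (weight_part \<mu> ?d))"
      using f c(3) unfolding A by (auto simp: PiE_iff extensional_def fun_eq_iff)
    then show ?thesis using d by blast
  qed
  show ?thesis unfolding is_internal_dsum_def
  proof (rule bij_betw_byWitness[where f' = ?h])
    show "\<forall>f\<in>?A. ?h (?g f) = f"
    proof
      fix f assume "f \<in> ?A"
      then obtain c where c: "c \<in> ?C" "f = (\<lambda>\<mu>\<in>P0. \<Phi> (weight_part \<mu> c))" using A_form by blast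
      show "?h (?g f) = f" unfolding c(2) gh[OF c(1)] by (rule h[OF c(1)])
    qed
    show "\<forall>x\<in>lat. ?g (?h x) = x"
    proof
      fix x assume "x \<in> lat"
      then obtain c where c: "c \<in> ?C" "x = \<Phi> c" unfolding lat_\<Phi> by blast
      show "?g (?h x) = x" unfolding c(2) h[OF c(1)] by (rule gh[OF c(1)])
    qed
    show "?g ` ?A \<subseteq> lat"
    proof (rule image_subsetI)
      fix f assume "f \<in> ?A"
      then obtain c where c: "c \<in> ?C" "f = (\<lambda>\<mu>\<in>P0. \<Phi> (weight_part \<mu> c))" using A_form by blast
      show "?g f \<in> lat" unfolding c(2) gh[OF c(1)] lat_\<Phi> using c(1) by (rule imageI)
    qed
    show "?h ` lat \<subseteq> ?A"
    proof (rule image_subsetI)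
      fix x assume "x \<in> lat"
      then obtain c where c: "c \<in> ?C" "x = \<Phi> c" unfolding lat_\<Phi> by blast
      show "?h x \<in> ?A" unfolding c(2) h[OF c(1)] by (rule hA[OF c(1)])
    qed
  qed
qed

subsection \<open>The crystal basis\<close>

lemma submodule_lat: "submodule_over A0 (vs M) lat"
proof -
  have "\<zero>\<^bsub>vs M\<^esub> \<in> lat" unfolding V.\<Phi>_zero[symmetric] lat_\<Phi> using LV.C_zero by blast
  moreover have "x \<oplus>\<^bsub>vs M\<^esub> y \<in> lat" if xy: "x \<in> lat" "y \<in> lat" for x y
  proof -
    obtain c d where "x = \<Phi> c" "y = \<Phi> d" "c \<in> coeffs_in A0 labels" "d \<in> coeffs_in A0 labels" using xy unfolding lat_\<Phi> by blast
    then show ?thesis unfolding lat_\<Phi> using LV.C_add V.\<Phi>_add[OF A0_C A0_C] by (metis imageI)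
  qed
  moreover have "a \<odot>\<^bsub>vs M\<^esub> x \<in> lat" if ax: "a \<in> A0" "x \<in> lat" for a x
  proof -
    obtain c where c: "x = \<Phi> c" "c \<in> coeffs_in A0 labels" using ax(2) unfolding lat_\<Phi> by blast
    have "Poly_Mapping.map ((*) a) c \<in> coeffs_in A0 labels"
      using c(2) ax(1) by (auto simp: coeffs_in_iff lookup_map_times in_keys_iff subset_iff)
    then show ?thesis unfolding lat_\<Phi> using V.\<Phi>_scl[OF UNIV_I A0_C[OF c(2)], of a] c(1) by (metis imageI)
  qed
  moreover have "lat \<subseteq> carrier (vs M)" unfolding lat_\<Phi> using V.\<Phi>_closed A0_C by blast
  ultimately show ?thesis by (simp add: submodule_over_def)
qed

lemma common_denominator:
  fixes c :: "'i \<times> int list \<Rightarrow>\<^sub>0 'f rq"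
  shows "\<exists>n. \<forall>t. qh ^ n * lookup c t \<in> A0"
proof -
  have "\<exists>n. \<forall>m\<ge>n. qh ^ m * x \<in> A0" for x :: "'f rq"
  proof (cases "x = 0")
    case False
    then obtain k u where u: "x = qh powi k * u" "u \<in> A0" by (auto elim: rq_unit_part)
    have "qh ^ m * x \<in> A0" if "m \<ge> nat (- k)" for m
    proof -
      have "qh ^ m * x = qh powi (int m + k) * u"
        using u(1) qh_nonzero[where 'f='f] by (simp add: power_int_add)
      then show ?thesis using u(2) qh_powi_A0[of "int m + k", where 'f='f] that by simp
    qed
    then show ?thesis by blast
  qed simp
  (* An exponent that works for x also works when it is increased. *)
  then obtain N where N: "\<And>x m. N x \<le> m \<Longrightarrow> qh ^ m * (x :: 'f rq) \<in> A0" by metis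
  let ?n = "Max (insert 0 ((\<lambda>t. N (lookup c t)) ` keys c))"
  have "qh ^ ?n * lookup c t \<in> A0" for t
  proof (cases "t \<in> keys c")
    case True then show ?thesis by (intro N Max_ge) auto
  qed (simp add: in_keys_iff)
  then show ?thesis by blast
qed

lemma tensor_lat: "bij_betw (natural_map (vs M)) (tensor A0 (vs M) lat) (carrier (vs M))"
proof (rule tensor_bij[OF V.abelian_group_axioms _ _ _ _ _ submodule_lat])
  fix x assume x: "x \<in> carrier (vs M)"
  then obtain c where c: "c \<in> coeffs_in UNIV labels" "x = \<Phi> c" using \<Phi>_bij by (auto simp: bij_betw_def)
  obtain n where n: "\<forall>t. qh ^ n * lookup c t \<in> A0" using common_denominator by blast
  have "Poly_Mapping.map ((*) (qh ^ n)) c \<in> coeffs_in A0 labels"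
    using c(1) n by (auto simp: coeffs_in_iff lookup_map_times in_keys_iff subset_iff)
  then have "qh ^ n \<odot>\<^bsub>vs M\<^esub> x \<in> lat"
    unfolding lat_\<Phi> using V.\<Phi>_scl[OF UNIV_I c(1), of "qh ^ n"] c(2) by (metis imageI)
  then show "\<exists>n. qh ^ n \<odot>\<^bsub>vs M\<^esub> x \<in> lat" ..
qed (use left_module in \<open>simp_all add: left_module_def uq_const_hom(1-3)\<close>)

lemma tilde_op_lat:
  assumes "lin T" "\<And>a. a \<in> nlat \<Longrightarrow> T a \<in> nlat"
  shows "tilde_op I lam \<theta> T ` lat \<subseteq> lat"
proof
  fix y assume "y \<in> tilde_op I lam \<theta> T ` lat"
  then obtain p where p: "p \<in> fsupp I" "\<And>i. p i \<in> nlat" "y = tilde_op I lam \<theta> T (\<Psi> p)" by (auto simp: lat_def)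
  have "(\<lambda>i. T (p i)) \<in> fsupp I" using p(1) by (rule fsupp_map) (rule lin_zero[OF assms(1)])
  then show "y \<in> lat" using p assms(2) unfolding lat_def by (intro image_eqI[of _ _ "\<lambda>i. T (p i)"]) (auto simp: tilde_op_\<Psi>)
qed

lemma lattice_lat: "imaginary_crystal_lattice M I lam \<theta> lat"
proof -
  have "is_basis A0 ((vs M)\<lparr>carrier := lat\<rparr>) (LV.basis_vec ` labels)" by (rule LV.is_basis_basis_vec) simp
  moreover have "tilde_Omega I lam \<theta> m ` lat \<subseteq> lat" "tilde_x I lam \<theta> m ` lat \<subseteq> lat" for m
    by (intro tilde_op_lat Omega_lin nlat_Omega gen_lin nlat_gen; assumption)+
  ultimately show ?thesis
    unfolding imaginary_crystal_lattice_def using submodule_lat tensor_lat lat_internal_dsum by auto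
qed

lemma single_A0: "t \<in> labels \<Longrightarrow> single t (1 :: 'f rq) \<in> coeffs_in A0 labels"
  by (rule LV.C_single) simp_all

lemma \<beta>_\<Phi>: "t \<in> labels \<Longrightarrow> \<beta> t = residue_class M lat (\<Phi> (single t 1))"
  using residue_class_\<Psi>[OF C_fsupp[OF single_A0]] by (simp add: \<Phi>_def \<beta>_def comb_single)

text \<open>A basis class with a representative of weight \<open>\<mu>\<close> has weight \<open>\<mu>\<close>: the coefficient of the representative
at the label has residue 1, so it is nonzero.\<close>

lemma \<beta>_weight:
  assumes \<mu>: "\<mu> \<in> P0"
  shows "\<beta> ` labels \<inter> residue_class M lat ` (lat \<inter> weight_space M \<mu>) = \<beta> ` {t \<in> labels. weight_of t = \<mu>}"
proof (intro equalityI subsetI)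
  fix X assume "X \<in> \<beta> ` labels \<inter> residue_class M lat ` (lat \<inter> weight_space M \<mu>)"
  then obtain t c where t: "t \<in> labels" "X = \<beta> t" and c: "c \<in> coeffs_in A0 labels" "weight_part \<mu> c = c" "X = residue_class M lat (\<Phi> c)"
    unfolding lat_weight[OF \<mu>] by blast
  have "res_cls (comb c) = \<Xi> (single t 1)"
    using t c residue_class_\<Psi>[OF C_fsupp[OF c(1)]] \<beta>_basis_vec[of t] by (simp add: \<Phi>_def QV.basis_vec_def)
  moreover have "single t (1 :: 'f) \<in> coeffs_in UNIV labels" using t(1) by (intro QV.C_single) simp_all
  ultimately have "A0_res (lookup c t) = 1"
    using res_cls_comb_eq_\<Xi>[OF c(1)] by (simp add: lookup_single when_def del: split_paired_All)
  then have "weight_of t = \<mu>" using lookup_weight_part[of \<mu> c t] c(2) by (auto split: if_splits)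
  then show "X \<in> \<beta> ` {t \<in> labels. weight_of t = \<mu>}" using t by blast
next
  fix X assume "X \<in> \<beta> ` {t \<in> labels. weight_of t = \<mu>}"
  then obtain t where t: "t \<in> labels" "X = \<beta> t" "weight_of t = \<mu>" by blast
  have "weight_part \<mu> (single t 1) = (single t 1 :: _ \<Rightarrow>\<^sub>0 'f rq)"
    using t(3) by (intro poly_mapping_eqI) (auto simp: lookup_weight_part lookup_single when_def)
  then have "\<Phi> (single t 1) \<in> lat \<inter> weight_space M \<mu>"
    unfolding lat_weight[OF \<mu>] using single_A0[OF t(1)] by blast
  then show "X \<in> \<beta> ` labels \<inter> residue_class M lat ` (lat \<inter> weight_space M \<mu>)" using t \<beta>_\<Phi>[OF t(1)] by blast
qed

lemma \<beta>_inj: "inj_on \<beta> labels"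
  using QV.basis_vec_inj by (simp add: \<beta>_basis_vec[abs_def])

lemma induced_at_summand:
  assumes "i \<in> I" "lin T" "\<And>a b. a \<approx> b \<Longrightarrow> T a \<approx> T b" "T a \<approx> b"
  shows "induced_op M lat (tilde_op I lam \<theta> T) (res_cls (at_summand i a)) = res_cls (at_summand i b)"
proof -
  have "(\<lambda>j. T (at_summand i a j)) = at_summand i (T a)" by (auto simp: at_summand_def lin_zero[OF assms(2)])
  then have "induced_op M lat (tilde_op I lam \<theta> T) (res_cls (at_summand i a)) = res_cls (at_summand i (T a))"
    using induced_op_res_cls[OF at_summand_fsupp[OF assms(1)] assms(2,3)] by simp
  also have "\<dots> = res_cls (at_summand i b)" using assms(1,4) by (auto simp: res_cls_eq_iff at_summand_fsupp) (auto simp: at_summand_def)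
  finally show ?thesis .
qed

lemma res_cls_signed_mon:
  assumes i: "i \<in> I" and r: "\<And>s w. r = Some (s, w) \<Longrightarrow> dec w \<and> s \<in> {1, - 1}"
  shows "res_cls (at_summand i (signed_mon r)) \<in> \<beta> ` labels \<union> {\<ominus>\<^bsub>Q\<^esub> b | b. b \<in> \<beta> ` labels} \<union> {\<zero>\<^bsub>Q\<^esub>}"
proof (cases r)
  case None
  have "at_summand i (signed_mon r) = (\<lambda>i. 0 :: 'f nm)" using None by (auto simp: at_summand_def signed_mon_def)
  then show ?thesis by (simp add: Q_simps)
next
  case (Some sw)
  obtain s w where r': "r = Some (s, w)" using Some by (cases sw) auto
  have w: "dec w" "s = 1 \<or> s = - 1" using r[OF r'] by auto
  have b: "\<beta> (i, w) \<in> \<beta> ` labels" using i w(1) by blast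
  show ?thesis
  proof (cases "s = 1")
    case True
    then have "res_cls (at_summand i (signed_mon r)) = \<beta> (i, w)" using r' by (simp add: signed_mon_def \<beta>_def)
    then show ?thesis using b by blast
  next
    case False
    then have s: "signed_mon r = - mon w" using r' w(2) by (simp add: signed_mon_def)
    have sum0: "(\<lambda>j. at_summand i (- mon w) j + at_summand i (mon w) j) = (\<lambda>j. 0)" by (auto simp: at_summand_def)
    have carr: "res_cls (at_summand i a) \<in> carrier Q" if "a \<in> nlat" for a
    proof -
      have "at_summand i a j \<in> nlat" for j using that by (simp add: at_summand_def nlat.zero)
      then show ?thesis unfolding Q_simps using at_summand_fsupp[OF i] by blast
    qed
    have "\<ominus>\<^bsub>Q\<^esub> \<beta> (i, w) = res_cls (at_summand i (signed_mon r))"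
      using Q_simps(3)[OF at_summand_fsupp[OF i] at_summand_fsupp[OF i], of "- mon w" "mon w"] carr[of "mon w"] carr[of "- mon w"]
      unfolding s sum0 by (intro QV.minus_equality) (simp_all add: \<beta>_def Q_simps nlat_mon nlat_uminus)
    then show ?thesis using b by blast
  qed
qed

abbreviation "Om m \<equiv> induced_op M lat (tilde_Omega I lam \<theta> m)"
abbreviation "X m \<equiv> induced_op M lat (tilde_x I lam \<theta> m)"

lemma X_res_cls: "i \<in> I \<Longrightarrow> nm_gen m * a \<approx> b \<Longrightarrow> X m (res_cls (at_summand i a)) = res_cls (at_summand i b)"
  by (rule induced_at_summand) (auto intro: gen_lin qcong_gen)

lemma Om_res_cls: "i \<in> I \<Longrightarrow> Omega_psi m a \<approx> b \<Longrightarrow> Om m (res_cls (at_summand i a)) = res_cls (at_summand i b)"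
  by (rule induced_at_summand) (auto intro: Omega_lin qcong_Omega)

lemma X_\<beta>: "i \<in> I \<Longrightarrow> dec ns \<Longrightarrow> X m (\<beta> (i, ns)) = res_cls (at_summand i (signed_mon (x_cr m ns)))"
  by (simp add: \<beta>_def X_res_cls gen_mon_qcong)

lemma Om_\<beta>: "i \<in> I \<Longrightarrow> dec ns \<Longrightarrow> Om (- m) (\<beta> (i, ns)) = res_cls (at_summand i (signed_mon (Om_cr m ns)))"
  by (simp add: \<beta>_def Om_res_cls Omega_mon_qcong)

lemma x_cr_dec': "x_cr m ns = Some (s, w) \<Longrightarrow> dec ns \<Longrightarrow> dec w \<and> s \<in> {1, - 1}"
proof -
  assume a: "x_cr m ns = Some (s, w)" "dec ns"
  define M where "M = Max (insert m (set ns))"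
  have "m \<le> M" "\<forall>x\<in>set ns. x \<le> M" by (simp_all add: M_def)
  then show ?thesis using x_cr_dec[OF a, of M] by fastforce
qed

lemma Om_cr_dec': "Om_cr m ns = Some (s, w) \<Longrightarrow> dec ns \<Longrightarrow> dec w \<and> s \<in> {1, - 1}"
  using Om_cr_dec[of m ns s w "Max (set ns)"] by simp

lemma scaled_signed_mon: "s \<in> {1, - 1} \<Longrightarrow> of_int s *\<^sub>N signed_mon (Some (s, w)) = mon w"
  by (auto simp: signed_mon_def)

text \<open>Both composites are the identity on a basis class that neither operator kills: each operator undoes
the other, and the sign occurs twice.\<close>

lemma X_Om_commute:
  assumes i: "i \<in> I" and ns: "dec ns" and nz: "Om (- m) (\<beta> (i, ns)) \<noteq> \<zero>\<^bsub>Q\<^esub>" "X m (\<beta> (i, ns)) \<noteq> \<zero>\<^bsub>Q\<^esub>"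
  shows "X m (Om (- m) (\<beta> (i, ns))) = Om (- m) (X m (\<beta> (i, ns)))"
proof -
  have zero: "res_cls (at_summand i (signed_mon None)) = \<zero>\<^bsub>Q\<^esub>"
    by (simp add: signed_mon_def Q_simps) (simp add: at_summand_def)
  obtain s w where rm: "Om_cr m ns = Some (s, w)"
    using nz(1) zero unfolding Om_\<beta>[OF i ns] by (cases "Om_cr m ns") auto
  obtain s' w' where st: "x_cr m ns = Some (s', w')"
    using nz(2) zero unfolding X_\<beta>[OF i ns] by (cases "x_cr m ns") auto
  have w: "dec w" "s \<in> {1, - 1}" using Om_cr_dec'[OF rm ns] by auto
  have w': "dec w'" "s' \<in> {1, - 1}" using x_cr_dec'[OF st ns] by auto
  have "X m (Om (- m) (\<beta> (i, ns))) = \<beta> (i, ns)"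
  proof -
    have "nm_gen m * mon w \<approx> (signed_mon (Some (s, ns)) :: 'f nm)" using gen_mon_qcong[OF w(1), of m] x_cr_Om_cr[OF rm ns] by simp
    from qcong_scl[OF this A0_of_int(1)[of s]] have "nm_gen m * (of_int s *\<^sub>N mon w) \<approx> (mon ns :: 'f nm)"
      by (simp add: scaled_signed_mon[OF w(2)])
    then show ?thesis unfolding Om_\<beta>[OF i ns] rm by (simp add: signed_mon_def X_res_cls i \<beta>_def)
  qed
  moreover have "Om (- m) (X m (\<beta> (i, ns))) = \<beta> (i, ns)"
  proof -
    have "Omega_psi (- m) (mon w') \<approx> (signed_mon (Some (s', ns)) :: 'f nm)" using Omega_mon_qcong[OF w'(1), of m] Om_cr_x_cr[OF st] by simp
    from qcong_scl[OF this A0_of_int(1)[of s']] have "Omega_psi (- m) (of_int s' *\<^sub>N mon w') \<approx> (mon ns :: 'f nm)"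
      by (simp add: scaled_signed_mon[OF w'(2)] lin_scl[OF Omega_lin])
    then show ?thesis unfolding X_\<beta>[OF i ns] st by (simp add: signed_mon_def Om_res_cls i \<beta>_def)
  qed
  ultimately show ?thesis by simp
qed

lemma crystal_basis: "imaginary_crystal_basis M I lam \<theta> lat (\<beta> ` labels)"
proof -
  let ?B = "\<beta> ` labels"
  let ?B' = "?B \<union> {\<ominus>\<^bsub>Q\<^esub> b | b. b \<in> ?B} \<union> {\<zero>\<^bsub>Q\<^esub>}"
  let ?Bw = "\<lambda>\<mu>. ?B \<inter> residue_class M lat ` (lat \<inter> weight_space M \<mu>)"
  have b1: "is_basis UNIV Q ?B"
    using QV.is_basis_basis_vec by (simp add: \<beta>_basis_vec[abs_def])
  have b2: "?B = (\<Union>\<mu>\<in>P0. ?Bw \<mu>)"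
  proof -
    have "(\<Union>\<mu>\<in>P0. ?Bw \<mu>) = (\<Union>\<mu>\<in>P0. \<beta> ` {t \<in> labels. weight_of t = \<mu>})" by (simp add: \<beta>_weight)
    also have "\<dots> = ?B" using weight_of_P0 by blast
    finally show ?thesis ..
  qed
  have b3: "disjoint_family_on ?Bw P0"
    unfolding disjoint_family_on_def
  proof (intro ballI impI)
    fix \<mu> \<nu> assume "\<mu> \<in> P0" "\<nu> \<in> P0" "\<mu> \<noteq> \<nu>"
    then have "\<beta> ` {t \<in> labels. weight_of t = \<mu>} \<inter> \<beta> ` {t \<in> labels. weight_of t = \<nu>} = {}"
      using inj_onD[OF \<beta>_inj] by blast
    then show "?Bw \<mu> \<inter> ?Bw \<nu> = {}" using \<open>\<mu> \<in> P0\<close> \<open>\<nu> \<in> P0\<close> by (simp only: \<beta>_weight)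
  qed
  have b4: "X m ` ?B \<subseteq> ?B'" for m
  proof
    fix Y assume "Y \<in> X m ` ?B"
    then obtain i ns where t: "i \<in> I" "dec ns" "Y = X m (\<beta> (i, ns))" by auto
    have "dec w \<and> s \<in> {1, - 1}" if "x_cr m ns = Some (s, w)" for s w
      by (rule x_cr_dec'[OF that t(2)])
    then show "Y \<in> ?B'" unfolding t(3) X_\<beta>[OF t(1,2)] by (rule res_cls_signed_mon[OF t(1)])
  qed
  have b5: "Om m ` ?B \<subseteq> ?B'" for m
  proof
    fix Y assume "Y \<in> Om m ` ?B"
    then obtain i ns where t: "i \<in> I" "dec ns" "Y = Om (- (- m)) (\<beta> (i, ns))" by auto
    have "dec w \<and> s \<in> {1, - 1}" if "Om_cr (- m) ns = Some (s, w)" for s w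
      by (rule Om_cr_dec'[OF that t(2)])
    then show "Y \<in> ?B'" unfolding t(3) Om_\<beta>[OF t(1,2)] by (rule res_cls_signed_mon[OF t(1)])
  qed
  have b6: "\<forall>b\<in>?B. Om (- m) b \<noteq> \<zero>\<^bsub>Q\<^esub> \<and> X m b \<noteq> \<zero>\<^bsub>Q\<^esub> \<longrightarrow> X m (Om (- m) b) = Om (- m) (X m b)" for m
    using X_Om_commute by auto
  show ?thesis
    unfolding imaginary_crystal_basis_def Let_def
    by (intro conjI allI) (rule lattice_lat b1 b2 b3 b4 b5 b6)+
qed

end

theorem theorem5p3:
  fixes M :: "('f::field_char_0 uq, 'm) module"
    and I :: "'i set"
    and lam :: "'i \<Rightarrow> weight"
    and \<theta> :: "('i \<Rightarrow> 'f uq set) \<Rightarrow> 'm"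
  assumes "O_red_im M"
    and "decomposes M I lam \<theta>"
  shows "imaginary_crystal_basis M I lam \<theta> (std_lattice I lam \<theta>) (std_basis M I lam \<theta>)"
proof -
  interpret decomposed M I lam \<theta>
    using assms by unfold_locales (simp_all add: O_red_im_def)
  show ?thesis unfolding std_lattice_lat std_basis_\<beta> by (rule crystal_basis)
qed

end
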